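(* The group $\Gamma=\mathrm{PSL}_2(R)$ is generated by the pairing transformations of $\mathcal{F}$ with respect to $\Gamma$, i.e. by the elements $\gamma\in\Gamma\setminus\{1\}$ such that $\mathcal{F}\cap\gamma^{-1}(\mathcal{F})$ has dimension $3$.
   Context: Let $k>1$ be a square-free integer; $k_0=1$ if $k\not\equiv 1 \pmod 4$ and $k_0=2$ if $k\equiv 1\pmod 4$; $\omega=\frac{1+\sqrt{k}}{k_0}$; $R=\mathbb{Z}[\omega]$ is the ring of integers of $K=\mathbb{Q}(\sqrt k)$. For $\alpha\in K$, $\alpha'$ is its algebraic conjugate. $\epsilon_0$ is the smallest unit of $R$ greater than $1$. $\Gamma=\mathrm{PSL}_2(R)$ acts on $\mathbb{H}^2\times\mathbb{H}^2$ ($\mathbb{H}^2$ the upper half plane) by $\gamma(Z_1,Z_2)=(\gamma\cdot Z_1,\gamma'\cdot Z_2)$, where $\gamma'$ is obtained by conjugating all entries of $\gamma$ and $\cdot$ is the Möbius action. Points are written $Z=(x_1+y_1i,x_2+y_2i)$, $x_j\in\mathbb{R}$, $y_j>0$. Another coordinate system $(s_1,s_2,r,h)\in\mathbb{R}^2\times(\mathbb{R}^+)^2$ is given by $x_1=s_1+s_2\omega$, $x_2=s_1+s_2\omega'$, $r=y_1/y_2$, $h=y_1y_2$. For $c,d\in R$ put $$\Vert cZ+d\Vert=\big((cx_1+d)^2+c^2y_1^2\big)\big((c'x_2+d')^2+c'^2y_2^2\big).$$ Let $\mathcal{S}=\{(c,d)\in R^2: cR+dR=R\}$ and $$\mathcal{F}_\infty=\{(s_1,s_2,r,h):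 |s_1|,|s_2|\le \tfrac12,\ \epsilon_0^{-2}\le r\le\epsilon_0^2\},\quad \mathcal{F}_0=\{Z:\Vert cZ+d\Vert\ge 1\text{ for all }(c,d)\in\mathcal{S}\},\quad \mathcal{F}=\mathcal{F}_\infty\cap\mathcal{F}_0.$$ $\mathcal{F}$ is a fundamental domain of $\Gamma$. Dimension means dimension of real semi-algebraic sets (in $\mathbb{R}^4$ via the coordinates $(x_1,x_2,y_1,y_2)$). *)

theory Defs
  imports
    "HOL-Analysis.Analysis"
    "HOL-Algebra.Generated_Groups"
    "HOL-Algebra.Ideal"
    "HOL-Computational_Algebra.Squarefree"
    "HOL-Computational_Algebra.Polynomial"
    "HOL-Library.Extended_Nat"
begin

section \<open>The real quadratic order\<close>

text \<open>The field \<open>K = \<rat>(\<surd>k)\<close> and its ring of integers are regarded as sets of real numbers.\<close>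

definition k0 :: "int \<Rightarrow> real" where
  "k0 k = (if k mod 4 = 1 then 2 else 1)"

definition omega :: "int \<Rightarrow> real" where
  "omega k = (1 + sqrt (real_of_int k)) / k0 k"

definition quad_int :: "int \<Rightarrow> real set" where
  "quad_int k = range (\<lambda>p :: int poly. poly (map_poly of_int p) (omega k))"

text \<open>Only meaningful on \<open>K\<close>, where \<open>a\<close> and \<open>b\<close> are unique because \<open>\<surd>k\<close> is irrational.\<close>

definition qconj :: "int \<Rightarrow> real \<Rightarrow> real" where
  "qconj k \<alpha> = (THE \<beta>. \<exists>a\<in>\<rat>. \<exists>b\<in>\<rat>.
     \<alpha> = a + b * sqrt (real_of_int k) \<and> \<beta> = a - b * sqrt (real_of_int k))"

definition quad_units :: "int \<Rightarrow> real set" where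
  "quad_units k = {u \<in> quad_int k. \<exists>v \<in> quad_int k. u * v = 1}"

definition eps0 :: "int \<Rightarrow> real" where
  "eps0 k = (LEAST u. u \<in> quad_units k \<and> u > 1)"


section \<open>The Hilbert modular group and its action\<close>

definition SL2 :: "int \<Rightarrow> (real^2^2) monoid" where
  "SL2 k = \<lparr>carrier = {A. (\<forall>i j. A $ i $ j \<in> quad_int k) \<and> det A = 1},
            mult = (**), one = mat 1\<rparr>"

definition PSL2 :: "int \<Rightarrow> (real^2^2) set monoid" where
  "PSL2 k = SL2 k Mod {mat 1, - mat 1}"

definition upper_half_plane :: "complex set" where
  "upper_half_plane = {z. Im z > 0}"

definition moebius :: "real^2^2 \<Rightarrow> complex \<Rightarrow> complex" where
  "moebius A z = (of_real (A $ 1 $ 1) * z + of_real (A $ 1 $ 2))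
               / (of_real (A $ 2 $ 1) * z + of_real (A $ 2 $ 2))"

definition conj_matrix :: "int \<Rightarrow> real^2^2 \<Rightarrow> real^2^2" where
  "conj_matrix k A = (\<chi> i j. qconj k (A $ i $ j))"

definition SL2_act :: "int \<Rightarrow> real^2^2 \<Rightarrow> complex \<times> complex \<Rightarrow> complex \<times> complex" where
  "SL2_act k A = (\<lambda>(z1, z2). (moebius A z1, moebius (conj_matrix k A) z2))"

text \<open>The two representatives \<open>A\<close> and \<open>-A\<close> of an element of \<open>PSL2 k\<close> act in the same way, so
  the image below is a singleton.\<close>

definition PSL2_act :: "int \<Rightarrow> (real^2^2) set \<Rightarrow> complex \<times> complex \<Rightarrow> complex \<times> complex" where
  "PSL2_act k \<gamma> Z = the_elem ((\<lambda>A. SL2_act k A Z) ` \<gamma>)"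


section \<open>The fundamental domain\<close>

definition cusp_norm :: "int \<Rightarrow> real \<Rightarrow> real \<Rightarrow> complex \<times> complex \<Rightarrow> real" where
  "cusp_norm k c d = (\<lambda>(z1, z2).
     ((c * Re z1 + d)\<^sup>2 + c\<^sup>2 * (Im z1)\<^sup>2) *
     ((qconj k c * Re z2 + qconj k d)\<^sup>2 + (qconj k c)\<^sup>2 * (Im z2)\<^sup>2))"

definition unimodular_pairs :: "int \<Rightarrow> (real \<times> real) set" where
  "unimodular_pairs k = {(c, d). c \<in> quad_int k \<and> d \<in> quad_int k \<and>
     {c * u + d * v | u v. u \<in> quad_int k \<and> v \<in> quad_int k} = quad_int k}"

text \<open>The ratio \<open>Im z1 / Im z2\<close> is the coordinate \<open>r\<close>; the coordinate \<open>h = Im z1 * Im z2\<close> is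
  unconstrained.\<close>

definition F_infty :: "int \<Rightarrow> (complex \<times> complex) set" where
  "F_infty k = {(z1, z2) \<in> upper_half_plane \<times> upper_half_plane.
     (\<exists>s1 s2. Re z1 = s1 + s2 * omega k \<and> Re z2 = s1 + s2 * qconj k (omega k) \<and>
        \<bar>s1\<bar> \<le> 1/2 \<and> \<bar>s2\<bar> \<le> 1/2) \<and>
     1 / (eps0 k)\<^sup>2 \<le> Im z1 / Im z2 \<and> Im z1 / Im z2 \<le> (eps0 k)\<^sup>2}"

definition F_zero :: "int \<Rightarrow> (complex \<times> complex) set" where
  "F_zero k = {Z \<in> upper_half_plane \<times> upper_half_plane.
     \<forall>(c, d) \<in> unimodular_pairs k. cusp_norm k c d Z \<ge> 1}"

definition F_dom :: "int \<Rightarrow> (complex \<times> complex) set" where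
  "F_dom k = F_infty k \<inter> F_zero k"


section \<open>Dimension of semi-algebraic sets\<close>

text \<open>The dimension of a semi-algebraic set \<open>S\<close> in real \<open>n\<close>-space is by definition (Bochnak, Coste
  and Roy, \<^emph>\<open>Real Algebraic Geometry\<close>, Section 2.8) the Krull dimension of the ring of polynomial
  functions on \<open>S\<close>, i.e. of the real polynomial ring in \<open>n\<close> variables modulo the ideal of the
  polynomials that vanish on \<open>S\<close>. Restriction to \<open>S\<close> realises this quotient.\<close>

definition poly_fun_ring :: "(real^'n) set \<Rightarrow> (real^'n \<Rightarrow> real) ring" where
  "poly_fun_ring S =
     \<lparr>carrier = (\<lambda>p. restrict p S) ` {p. real_polynomial_function p},
      mult = (\<lambda>f g. restrict (\<lambda>x. f x * g x) S), one = restrict (\<lambda>x. 1) S,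
      zero = restrict (\<lambda>x. 0) S, add = (\<lambda>f g. restrict (\<lambda>x. f x + g x) S)\<rparr>"

text \<open>The zero ring has no prime ideals and is assigned \<open>0\<close> instead of \<open>-\<infinity>\<close>.\<close>

definition krull_dim :: "('a, 'b) ring_scheme \<Rightarrow> enat" where
  "krull_dim R = Sup {enat n | n. \<exists>P :: nat \<Rightarrow> 'a set.
     (\<forall>i\<le>n. primeideal (P i) R) \<and> (\<forall>i<n. P i \<subset> P (Suc i))}"

definition semialg_dim :: "(real^'n) set \<Rightarrow> enat" where
  "semialg_dim S = krull_dim (poly_fun_ring S)"


section \<open>Pairing transformations\<close>

definition real_coords :: "complex \<times> complex \<Rightarrow> real^4" where
  "real_coords = (\<lambda>(z1, z2). vector [Re z1, Re z2, Im z1, Im z2])"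

definition pairing_transformations :: "int \<Rightarrow> (real^2^2) set set" where
  "pairing_transformations k = {\<gamma> \<in> carrier (PSL2 k) - {\<one>\<^bsub>PSL2 k\<^esub>}.
     semialg_dim (real_coords ` (F_dom k \<inter> PSL2_act k (inv\<^bsub>PSL2 k\<^esub> \<gamma>) ` F_dom k)) = 3}"

end

theory Submission
  imports Defs "HOL-Complex_Analysis.Complex_Analysis"
begin

text \<open>Write \<open>X\<close> for the product of the two half planes and \<open>F\<close> for the fundamental domain. The
  tiles \<open>A F\<close>, for \<open>A\<close> in \<open>SL\<^sub>2(R)\<close>, are closed in \<open>X\<close>, cover \<open>X\<close>, and only finitely many of them meet a
  small neighbourhood of a given point. Let \<open>I\<close> consist of the matrices whose class lies in the
  subgroup generated by the pairing transformations, and \<open>J\<close> of the others. If \<open>J\<close> were not empty, the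
  tiles of \<open>I\<close> and the tiles of \<open>J\<close> would fill two closed sets with nonempty interior, and since \<open>X\<close>
  is connected these two sets would have a common frontier. The claim is that somewhere on the
  frontier a tile \<open>A F\<close> of \<open>I\<close> and a tile \<open>B F\<close> of \<open>J\<close> share a piece of a hypersurface. Then
  \<open>F \<inter> D\<inverse> F\<close> with \<open>D = B\<inverse> A\<close> contains a piece of a hypersurface as well, so that it has dimension
  three, \<open>D\<close> is a pairing transformation, and \<open>B\<close> belongs to \<open>I\<close>: a contradiction.

  The shared piece is usually found by moving a path away from all intersections of codimension two.
  The lemma \<open>common_wall_piece\<close> gets it without general position. Two different tiles meet inside a
  wall, which is a hypersurface that locally has two sides (\<open>face_in_wall\<close>, \<open>wall_two_sided\<close>). At a
  frontier point where the number of pairs of tiles that meet nearby is minimal, one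
  pair of tiles accounts for the whole frontier nearby. The two sides of the wall of this pair then
  avoid the frontier, hence they lie in the closures of the two different open sets that the frontier
  bounds, and every nearby point of the wall is a frontier point and so belongs to both tiles.

  The dimension of a set is the Krull dimension of its ring of polynomial functions. It is at most
  three on the zero set of a nonzero polynomial in four variables
  (\<open>semialg_dim_le_of_vanishing\<close>), because polynomials chosen from the steps of a chain
  of prime ideals are algebraically independent (\<open>prime_chain_independent\<close>), while five
  polynomials in four variables are not (\<open>algebraically_dependent\<close>). It is at least three on an open
  piece of a wall (\<open>semialg_dim_ge_chart\<close>): a chart with real-analytic coordinates straightens the wall,
  and the functions that vanish on the image of a convex set form a prime ideal by the identity theorem,
  so that a descending flag of convex sets gives a chain of primes. The curved walls
  \<open>\<parallel>cZ + d\<parallel> = 1\<close> become hyperplanes after the substitution \<open>z = exp L - d/c\<close>.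

  Two facts about \<open>F\<close> need arithmetic. The tiles cover \<open>X\<close> (\<open>cover\<close>) because the height \<open>y\<^sub>1 y\<^sub>2\<close> attains
  a maximum on each orbit, after which the fundamental unit, which exists by Pell's equation, and
  translations bring the other coordinates into range. The tiles are locally finite
  (\<open>locally_finite_tiles\<close>) because a point is moved into \<open>F\<close> only by matrices for which
  \<open>\<parallel>cZ + d\<parallel> \<le> 1\<close>, and the condition on the ratio \<open>y\<^sub>1 / y\<^sub>2\<close> then bounds both factors of this norm
  separately, so that all entries and their conjugates are bounded.\<close>

(* On power series the same symbol would make every matrix entry below ambiguous. *)
no_notation fps_nth (infixl \<open>$\<close> 75)


section \<open>Common walls in a locally finite closed cover\<close>

text \<open>The sets \<open>P\<close> and \<open>Q\<close> are the two sides of \<open>H\<close> near \<open>p\<close>, and both accumulate at every point of \<open>M \<inter> H\<close>. They may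
  leave \<open>M\<close> but not the given \<open>N\<close>, so that half balls and their homeomorphic images qualify.\<close>

definition two_sided :: "'a::topological_space set \<Rightarrow> 'a set \<Rightarrow> bool" where
  "two_sided X H \<longleftrightarrow> (\<forall>p\<in>H. \<forall>N. open N \<and> p \<in> N \<and> N \<subseteq> X \<longrightarrow>
     (\<exists>M P Q. open M \<and> p \<in> M \<and> M \<subseteq> N \<and> connected P \<and> connected Q \<and> P \<subseteq> N - H \<and> Q \<subseteq> N - H \<and>
        M \<subseteq> P \<union> Q \<union> H \<and> M \<inter> H \<subseteq> closure P \<inter> closure Q))"

text \<open>Among the open sets that meet \<open>Y\<close> one is chosen for which the number of pairs \<open>(i, j)\<close> with
  \<open>C i \<inter> C j\<close> meeting \<open>Y\<close> inside it is minimal. If a pair did not contain all of \<open>Y\<close> there,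
  removing the closed set \<open>C i \<inter> C j\<close> would give a smaller number.\<close>

lemma single_pair_locally:
  fixes C :: "'i \<Rightarrow> 'a::topological_space set"
  assumes Y: "Y \<noteq> {}" "Y \<subseteq> X"
    and cl: "\<And>i. i \<in> I \<union> J \<Longrightarrow> closedin (top_of_set X) (C i)" and X: "open X"
    and fin: "\<And>p. p \<in> X \<Longrightarrow> \<exists>N. open N \<and> p \<in> N \<and> N \<subseteq> X \<and> finite {i \<in> I \<union> J. C i \<inter> N \<noteq> {}}"
    and cov: "Y \<subseteq> (\<Union>i\<in>I. C i)" "Y \<subseteq> (\<Union>j\<in>J. C j)"
  shows "\<exists>i\<in>I. \<exists>j\<in>J. \<exists>N. open N \<and> N \<subseteq> X \<and> N \<inter> Y \<noteq> {} \<and> N \<inter> Y \<subseteq> C i \<inter> C j"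
proof -
  define meets where "meets N = {(i,j). i \<in> I \<and> j \<in> J \<and> C i \<inter> C j \<inter> N \<inter> Y \<noteq> {}}" for N
  define good where "good N \<longleftrightarrow> open N \<and> N \<subseteq> X \<and> N \<inter> Y \<noteq> {} \<and> finite (meets N)" for N
  have "\<exists>N. good N"
  proof -
    from Y obtain p where p: "p \<in> Y" "p \<in> X" by auto
    from fin[OF p(2)] obtain N where N: "open N" "p \<in> N" "N \<subseteq> X" "finite {i \<in> I \<union> J. C i \<inter> N \<noteq> {}}"
      by blast
    have "meets N \<subseteq> {i \<in> I \<union> J. C i \<inter> N \<noteq> {}} \<times> {i \<in> I \<union> J. C i \<inter> N \<noteq> {}}"
      unfolding meets_def by auto
    then have "finite (meets N)" using N(4) finite_subset by blast
    then show ?thesis using N p unfolding good_def by blast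
  qed
  then obtain N where N: "good N" and least: "\<And>N'. good N' \<Longrightarrow> card (meets N) \<le> card (meets N')"
    using ex_has_least_nat[of good _ "\<lambda>N. card (meets N)"] by blast
  from N obtain p where p: "p \<in> N" "p \<in> Y" unfolding good_def by auto
  with cov obtain i j where ij: "i \<in> I" "j \<in> J" "p \<in> C i" "p \<in> C j" by blast
  have "N \<inter> Y \<subseteq> C i \<inter> C j"
  proof (rule ccontr)
    assume not: "\<not> N \<inter> Y \<subseteq> C i \<inter> C j"
    define N' where "N' = N \<inter> (X - C i \<inter> C j)"
    have "openin (top_of_set X) (X - C i \<inter> C j)"
      using cl ij by (intro openin_diff closedin_Int) auto
    then have "open N'" using N X unfolding N'_def good_def by (metis openin_open_eq open_Int)
    moreover have "N' \<inter> Y \<noteq> {}" using not N Y unfolding N'_def good_def by blast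
    moreover have sub: "meets N' \<subset> meets N"
    proof -
      have "(i,j) \<in> meets N" using ij p by (auto simp: meets_def)
      moreover have "(i,j) \<notin> meets N'" by (auto simp: meets_def N'_def)
      moreover have "meets N' \<subseteq> meets N" by (auto simp: meets_def N'_def)
      ultimately show ?thesis by blast
    qed
    ultimately have "good N'" using N unfolding good_def N'_def
      by (auto intro: finite_subset)
    from least[OF this] sub N show False
      by (metis good_def leD psubset_card_mono)
  qed
  with ij N show ?thesis unfolding good_def by blast
qed

lemma closedin_locally_finite_UN:
  fixes C :: "'i \<Rightarrow> 'a::topological_space set"
  assumes cl: "\<And>i. i \<in> I \<Longrightarrow> closedin (top_of_set X) (C i)" and X: "open X"
    and fin: "\<And>p. p \<in> X \<Longrightarrow> \<exists>N. open N \<and> p \<in> N \<and> N \<subseteq> X \<and> finite {i \<in> I. C i \<inter> N \<noteq> {}}"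
  shows "closedin (top_of_set X) (\<Union>i\<in>I. C i)"
proof (rule closedin_locally_finite_Union)
  show "\<And>S. S \<in> C ` I \<Longrightarrow> closedin (top_of_set X) S" using cl by auto
  show "locally_finite_in (top_of_set X) (C ` I)"
    unfolding locally_finite_in_def
  proof (intro conjI ballI)
    show "\<Union> (C ` I) \<subseteq> topspace (top_of_set X)" using cl closedin_subset by fastforce
    fix p assume "p \<in> topspace (top_of_set X)"
    then obtain N where N: "open N" "p \<in> N" "N \<subseteq> X" "finite {i \<in> I. C i \<inter> N \<noteq> {}}"
      using fin by auto
    have "{U \<in> C ` I. U \<inter> N \<noteq> {}} \<subseteq> C ` {i \<in> I. C i \<inter> N \<noteq> {}}" by auto
    then have "finite {U \<in> C ` I. U \<inter> N \<noteq> {}}" using N(4) finite_surj by blast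
    moreover have "openin (top_of_set X) N" using N X by (simp add: openin_open_eq)
    ultimately show "\<exists>V. openin (top_of_set X) V \<and> p \<in> V \<and> finite {U \<in> C ` I. U \<inter> V \<noteq> {}}"
      using N by blast
  qed
qed

text \<open>Let \<open>U\<close> and \<open>W\<close> be the unions of the two families. If \<open>U \<inter> W\<close> has interior points, a single pair
  already contains an open set. Otherwise the complements of \<open>W\<close> and of \<open>U\<close> are open sets \<open>O1\<close> and \<open>O2\<close> whose closures
  together cover \<open>X\<close> and therefore meet, and the argument takes place at a common point of the closures, on both
  sides of the wall that carries the intersection of the single pair found there.\<close>

lemma common_wall_piece:
  fixes C :: "'i \<Rightarrow> 'a::topological_space set"
  assumes X: "open X" "connected X"
    and cl: "\<And>i. i \<in> I \<union> J \<Longrightarrow> closedin (top_of_set X) (C i)"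
    and fin: "\<And>p. p \<in> X \<Longrightarrow> \<exists>N. open N \<and> p \<in> N \<and> N \<subseteq> X \<and> finite {i \<in> I \<union> J. C i \<inter> N \<noteq> {}}"
    and cov: "X \<subseteq> (\<Union>i\<in>I \<union> J. C i)"
    and int: "\<And>i. i \<in> I \<union> J \<Longrightarrow> interior (C i) \<noteq> {}" and ne: "I \<noteq> {}" "J \<noteq> {}"
    and H: "\<And>i j. i \<in> I \<Longrightarrow> j \<in> J \<Longrightarrow> C i \<inter> C j \<subseteq> H i j \<and> two_sided X (H i j)"
  shows "\<exists>i\<in>I. \<exists>j\<in>J. \<exists>M. open M \<and> M \<inter> H i j \<noteq> {} \<and> M \<inter> H i j \<subseteq> C i \<inter> C j"
proof -
  define U where "U = (\<Union>i\<in>I. C i)"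
  define W where "W = (\<Union>j\<in>J. C j)"
  have sub: "C i \<subseteq> X" if "i \<in> I \<union> J" for i using cl[OF that] closedin_subset by fastforce
  have fI: "\<exists>N. open N \<and> p \<in> N \<and> N \<subseteq> X \<and> finite {i \<in> I. C i \<inter> N \<noteq> {}}"
    and fJ: "\<exists>N. open N \<and> p \<in> N \<and> N \<subseteq> X \<and> finite {i \<in> J. C i \<inter> N \<noteq> {}}" if "p \<in> X" for p
  proof -
    from fin[OF that] obtain N where N: "open N" "p \<in> N" "N \<subseteq> X" "finite {i \<in> I \<union> J. C i \<inter> N \<noteq> {}}"
      by blast
    have "finite {i \<in> I. C i \<inter> N \<noteq> {}}" "finite {i \<in> J. C i \<inter> N \<noteq> {}}"
      by (rule finite_subset[OF _ N(4)]; auto)+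
    with N show "\<exists>N. open N \<and> p \<in> N \<and> N \<subseteq> X \<and> finite {i \<in> I. C i \<inter> N \<noteq> {}}"
      "\<exists>N. open N \<and> p \<in> N \<and> N \<subseteq> X \<and> finite {i \<in> J. C i \<inter> N \<noteq> {}}" by blast+
  qed
  have clU: "closedin (top_of_set X) U" and clW: "closedin (top_of_set X) W"
    unfolding U_def W_def by (intro closedin_locally_finite_UN cl X fI fJ; simp)+
  have UW: "X = U \<union> W"
  proof
    show "X \<subseteq> U \<union> W" using cov unfolding U_def W_def UN_Un .
    show "U \<union> W \<subseteq> X" using sub unfolding U_def W_def by (intro Un_least UN_least) simp_all
  qed
  define O1 where "O1 = X - W"
  define O2 where "O2 = X - U"
  have op: "open O1" "open O2"
    using openin_diff[OF _ clW] openin_diff[OF _ clU] X unfolding O1_def O2_def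
    by (metis openin_open_trans openin_subtopology_self)+
  show ?thesis
  proof (cases "interior (U \<inter> W) = {}")
    case False
    let ?Y = "interior (U \<inter> W)"
    have YX: "?Y \<subseteq> X" using UW interior_subset by fastforce
    have Y12: "?Y \<subseteq> (\<Union>i\<in>I. C i)" "?Y \<subseteq> (\<Union>j\<in>J. C j)" using interior_subset[of "U \<inter> W"] 
      unfolding U_def W_def by blast+
    obtain i j N where *: "i \<in> I" "j \<in> J" "open N" "N \<inter> ?Y \<noteq> {}" "N \<inter> ?Y \<subseteq> C i \<inter> C j"
      using single_pair_locally[OF False YX cl X(1) fin Y12] by metis
    then have "N \<inter> ?Y \<inter> H i j \<noteq> {}" using H by blast
    moreover have "open (N \<inter> ?Y)" using *(3) by (intro open_Int open_interior)
    ultimately show ?thesis using * by (meson inf.coboundedI1)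
  next
    case True
    have c1: "closure O1 \<inter> X \<subseteq> U" and c2: "closure O2 \<inter> X \<subseteq> W"
    proof -
      have "closure G \<inter> X \<subseteq> K" if "closedin (top_of_set X) K" "G \<subseteq> K" for G K
        using that closure_minimal[of G] unfolding closedin_closed by blast
      moreover have "O1 \<subseteq> U" "O2 \<subseteq> W" using UW by (auto simp: O1_def O2_def)
      ultimately show "closure O1 \<inter> X \<subseteq> U" "closure O2 \<inter> X \<subseteq> W" using clU clW by auto
    qed
    have dense: "X \<subseteq> closure O1 \<union> closure O2"
    proof -
      have "X - (closure O1 \<union> closure O2) \<subseteq> U \<inter> W"
        using closure_subset[of O1] closure_subset[of O2] by (auto simp: O1_def O2_def)
      moreover have "open (X - (closure O1 \<union> closure O2))" using X by (intro open_Diff) auto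
      ultimately have "X - (closure O1 \<union> closure O2) \<subseteq> interior (U \<inter> W)" by (rule interior_maximal)
      with True show ?thesis by auto
    qed
    have ne12: "O1 \<noteq> {}" "O2 \<noteq> {}"
    proof -
      have False if "O1 = {}"
      proof -
        from ne obtain i where "i \<in> I" by auto
        have "C i \<subseteq> U \<inter> W" using \<open>i \<in> I\<close> that sub unfolding O1_def U_def by blast
        then show False using int[of i] \<open>i \<in> I\<close> True interior_mono by blast
      qed
      moreover have False if "O2 = {}"
      proof -
        from ne obtain i where "i \<in> J" by auto
        have "C i \<subseteq> U \<inter> W" using \<open>i \<in> J\<close> that sub unfolding O2_def W_def by blast
        then show False using int[of i] \<open>i \<in> J\<close> True interior_mono by blast
      qed
      ultimately show "O1 \<noteq> {}" "O2 \<noteq> {}" by auto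
    qed
    define Y where "Y = closure O1 \<inter> closure O2 \<inter> X"
    have Yne: "Y \<noteq> {}"
    proof
      assume "Y = {}"
      then have "closure O1 \<inter> X = {} \<or> closure O2 \<inter> X = {}"
        using X(2) dense unfolding connected_closed Y_def by (metis closed_closure)
      then show False using ne12 closure_subset[of O1] closure_subset[of O2]
        unfolding O1_def O2_def by blast
    qed
    have YX: "Y \<subseteq> X" by (auto simp: Y_def)
    have Y12: "Y \<subseteq> (\<Union>i\<in>I. C i)" "Y \<subseteq> (\<Union>j\<in>J. C j)" using c1 c2 unfolding U_def W_def Y_def by auto
    obtain i j N where *: "i \<in> I" "j \<in> J" "open N" "N \<subseteq> X" "N \<inter> Y \<noteq> {}" "N \<inter> Y \<subseteq> C i \<inter> C j"
      using single_pair_locally[OF Yne YX cl X(1) fin Y12] by metis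
    have Hij: "C i \<inter> C j \<subseteq> H i j" "two_sided X (H i j)" using H[OF *(1,2)] by auto
    obtain p where p: "p \<in> N" "p \<in> Y" "p \<in> H i j" using *(5,6) Hij(1) by blast
    have "\<exists>M P Q. open M \<and> p \<in> M \<and> M \<subseteq> N \<and> connected P \<and> connected Q \<and> P \<subseteq> N - H i j \<and> Q \<subseteq> N - H i j \<and>
        M \<subseteq> P \<union> Q \<union> H i j \<and> M \<inter> H i j \<subseteq> closure P \<inter> closure Q"
      using Hij(2)[unfolded two_sided_def, rule_format, OF p(3), of N] p(1) *(3,4) by simp
    then obtain M P Q where M: "open M" "p \<in> M" "M \<subseteq> N" "connected P" "connected Q"
        "P \<subseteq> N - H i j" "Q \<subseteq> N - H i j" "M \<subseteq> P \<union> Q \<union> H i j" "M \<inter> H i j \<subseteq> closure P \<inter> closure Q"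
      by auto
    \<comment> \<open>a connected set that avoids the frontier \<open>Y\<close> stays on one side\<close>
    have side: "(R \<subseteq> closure O1 \<or> R \<subseteq> closure O2) \<and> R \<inter> closure O1 \<inter> closure O2 = {}"
      if R: "connected R" "R \<subseteq> N - H i j" for R
    proof -
      have e: "closure O1 \<inter> closure O2 \<inter> R = {}"
        using R(2) *(4,6) Hij(1) unfolding Y_def by blast
      have d: "R \<subseteq> closure O1 \<union> closure O2" using R(2) *(4) dense by blast
      from e d R(1) have "closure O1 \<inter> R = {} \<or> closure O2 \<inter> R = {}"
        unfolding connected_closed by (metis closed_closure)
      then show ?thesis using e d by blast
    qed
    \<comment> \<open>an open subset of \<open>M\<close> cannot lie inside \<open>H\<close>, because \<open>P\<close> accumulates at the points of \<open>M \<inter> H\<close>\<close>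
    have hit: "G \<inter> (P \<union> Q) \<noteq> {}" if G: "open G" "p \<in> closure G" for G
    proof
      assume no: "G \<inter> (P \<union> Q) = {}"
      have "M \<inter> G \<noteq> {}" using open_Int_closure_eq_empty[OF M(1), of G] G(2) M(2) by blast
      then obtain x where x: "x \<in> G" "x \<in> M" by auto
      then have "x \<in> closure P" using M no by blast
      moreover have "open (G \<inter> M)" using G M by blast
      ultimately have "P \<inter> (G \<inter> M) \<noteq> {}" using x open_Int_closure_eq_empty[of "G \<inter> M" P] by blast
      then show False using no by blast
    qed
    have "p \<in> closure O1" "p \<in> closure O2" using p(2) unfolding Y_def by auto
    then have "O1 \<inter> (P \<union> Q) \<noteq> {}" "O2 \<inter> (P \<union> Q) \<noteq> {}" using hit op by blast+
    then obtain x y where "x \<in> O1" "y \<in> O2" and PQ: "x \<in> P \<or> x \<in> Q" "y \<in> P \<or> y \<in> Q" by blast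
    then have xy: "x \<in> closure O1" "y \<in> closure O2" using closure_subset by blast+
    have "P \<subseteq> closure O1 \<and> Q \<subseteq> closure O2 \<or> P \<subseteq> closure O2 \<and> Q \<subseteq> closure O1"
      using side[OF M(4,6)] side[OF M(5,7)] xy PQ by blast
    then have "closure P \<inter> closure Q \<subseteq> closure O1 \<inter> closure O2"
    proof
      assume "P \<subseteq> closure O1 \<and> Q \<subseteq> closure O2"
      then have "closure P \<subseteq> closure O1" "closure Q \<subseteq> closure O2" by (simp_all add: closure_minimal)
      then show ?thesis by blast
    next
      assume "P \<subseteq> closure O2 \<and> Q \<subseteq> closure O1"
      then have "closure P \<subseteq> closure O2" "closure Q \<subseteq> closure O1" by (simp_all add: closure_minimal)
      then show ?thesis by blast
    qed
    then have "M \<inter> H i j \<subseteq> N \<inter> Y" using M(3,9) *(4) unfolding Y_def by blast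
    then have "M \<inter> H i j \<subseteq> C i \<inter> C j" "M \<inter> H i j \<noteq> {}" using *(6) p(3) M(2) by blast+
    then show ?thesis using *(1,2) M(1) by blast
  qed
qed

lemma two_sided_image:
  assumes "two_sided X H" "homeomorphism X Y f g" "open X" "open Y" "H \<subseteq> X"
  shows "two_sided Y (f ` H)"
  unfolding two_sided_def
proof (intro ballI allI impI, elim conjE)
  fix q N assume q: "q \<in> f ` H" and N: "open N" "q \<in> N" "N \<subseteq> Y"
  from q obtain p where p: "p \<in> H" "q = f p" by auto
  have contf: "continuous_on X f" and contg: "continuous_on Y g"
    and gf: "\<And>x. x \<in> X \<Longrightarrow> g (f x) = x" and fg: "\<And>y. y \<in> Y \<Longrightarrow> f (g y) = y"
    and im: "f ` X = Y" "g ` Y = X"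
    using assms(2) by (auto simp: homeomorphism_def)
  have opg: "open (g ` V)" if "open V" "V \<subseteq> Y" for V
  proof -
    have "g ` V = f -` V \<inter> X" using that im gf fg by force
    then show ?thesis using continuous_open_preimage[OF contf assms(3) that(1)] by (simp add: Int_commute)
  qed
  have opf: "open (f ` V)" if "open V" "V \<subseteq> X" for V
  proof -
    have "f ` V = g -` V \<inter> Y" using that im gf fg by force
    then show ?thesis using continuous_open_preimage[OF contg assms(4) that(1)] by (simp add: Int_commute)
  qed
  have "p \<in> g ` N" using p N gf assms(5) by force
  moreover have gN: "g ` N \<subseteq> X" using N im by auto
  ultimately obtain M P Q where M: "open M" "p \<in> M" "M \<subseteq> g ` N" "connected P" "connected Q"
     "P \<subseteq> g ` N - H" "Q \<subseteq> g ` N - H" "M \<subseteq> P \<union> Q \<union> H" "M \<inter> H \<subseteq> closure P \<inter> closure Q"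
    using assms(1) p(1) opg[OF N(1,3)] unfolding two_sided_def by meson
  have fgN: "f ` g ` N = N" using N(3) fg by force
  have inj: "inj_on f X" using gf by (metis inj_on_inverseI)
  have sub: "f ` P \<subseteq> N - f ` H" if "P \<subseteq> g ` N - H" for P
  proof -
    have "P \<subseteq> X" using that gN by auto
    then have "f ` P \<inter> f ` H = f ` (P \<inter> H)" using inj assms(5) by (simp add: inj_on_image_Int)
    also have "\<dots> = {}" using that by blast
    finally have "f ` P \<inter> f ` H = {}" .
    then show ?thesis using that fgN by blast
  qed
  have cl: "f x \<in> closure (f ` P)" if "x \<in> X" "x \<in> closure P" "P \<subseteq> X" for x P
  proof (rule ccontr)
    define V where "V = Y - closure (f ` P)"
    assume "f x \<notin> closure (f ` P)"
    then have "f x \<in> V" using that(1) im unfolding V_def by blast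
    then have "x \<in> g ` V" using gf[OF that(1)] by (metis imageI)
    moreover have "open (g ` V)" using assms(4) unfolding V_def by (intro opg) auto
    ultimately have "g ` V \<inter> P \<noteq> {}" using that(2) open_Int_closure_eq_empty[of "g ` V" P] by blast
    then obtain v where v: "v \<in> V" "g v \<in> P" by auto
    then have "v \<in> f ` P" using fg unfolding V_def by force
    then show False using v(1) closure_subset[of "f ` P"] unfolding V_def by blast
  qed
  show "\<exists>M P Q. open M \<and> q \<in> M \<and> M \<subseteq> N \<and> connected P \<and> connected Q \<and> P \<subseteq> N - f ` H \<and>
        Q \<subseteq> N - f ` H \<and> M \<subseteq> P \<union> Q \<union> f ` H \<and> M \<inter> f ` H \<subseteq> closure P \<inter> closure Q"
  proof (intro exI conjI)
    have MX: "M \<subseteq> X" "P \<subseteq> X" "Q \<subseteq> X" using M gN by auto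
    show "open (f ` M)" using opf M MX by auto
    show "q \<in> f ` M" using p M by auto
    show "f ` M \<subseteq> N" using M fgN by blast
    show "connected (f ` P)" "connected (f ` Q)"
      using M MX contf by (meson connected_continuous_image continuous_on_subset)+
    show "f ` P \<subseteq> N - f ` H" "f ` Q \<subseteq> N - f ` H" using sub M by auto
    show "f ` M \<subseteq> f ` P \<union> f ` Q \<union> f ` H" using M by blast
    have "f ` M \<inter> f ` H = f ` (M \<inter> H)" by (rule inj_on_image_Int[OF inj MX(1) assms(5), symmetric])
    then show "f ` M \<inter> f ` H \<subseteq> closure (f ` P) \<inter> closure (f ` Q)"
      using cl[of _ P] cl[of _ Q] M(9) MX by (smt (verit) Int_iff image_iff subset_iff)
  qed
qed

lemma two_sided_hyperplane:
  fixes a :: "'a::euclidean_space"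
  assumes "a \<noteq> 0"
  shows "two_sided X {x \<in> X. a \<bullet> x = t}"
  unfolding two_sided_def
proof (intro ballI allI impI, elim conjE)
  fix p N assume p: "p \<in> {x \<in> X. a \<bullet> x = t}" and N: "open N" "p \<in> N" "N \<subseteq> X"
  obtain e where e: "e > 0" "ball p e \<subseteq> N" using N openE by blast
  let ?M = "ball p e" and ?P = "ball p e \<inter> {x. a \<bullet> x > t}" and ?Q = "ball p e \<inter> {x. a \<bullet> x < t}"
  have aa: "a \<bullet> a > 0" using assms by simp
  have near: "\<exists>s>0. \<forall>u. \<bar>u\<bar> \<le> s \<longrightarrow> x + u *\<^sub>R a \<in> V" if V: "open V" "x \<in> V" for V and x :: 'a
  proof -
    obtain d where d: "d > 0" "ball x d \<subseteq> V" using V by (meson openE)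
    have "x + u *\<^sub>R a \<in> ball x d" if "\<bar>u\<bar> \<le> d / 2 / norm a" for u
      using that assms d(1) by (simp add: dist_norm field_simps)
    then show ?thesis using d assms by (intro exI[of _ "d / 2 / norm a"]) auto
  qed
  show "\<exists>M P Q. open M \<and> p \<in> M \<and> M \<subseteq> N \<and> connected P \<and> connected Q \<and>
        P \<subseteq> N - {x \<in> X. a \<bullet> x = t} \<and> Q \<subseteq> N - {x \<in> X. a \<bullet> x = t} \<and>
        M \<subseteq> P \<union> Q \<union> {x \<in> X. a \<bullet> x = t} \<and> M \<inter> {x \<in> X. a \<bullet> x = t} \<subseteq> closure P \<inter> closure Q"
  proof (rule exI[of _ ?M], rule exI[of _ ?P], rule exI[of _ ?Q], intro conjI)
    show "connected ?P" by (intro convex_connected convex_Int convex_ball convex_halfspace_gt)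
    show "connected ?Q" by (intro convex_connected convex_Int convex_ball convex_halfspace_lt)
    show "?M \<inter> {x \<in> X. a \<bullet> x = t} \<subseteq> closure ?P \<inter> closure ?Q"
    proof (intro subsetI IntI)
      fix x assume x: "x \<in> ?M \<inter> {x \<in> X. a \<bullet> x = t}"
      have hit: "\<exists>s>0. x + s *\<^sub>R a \<in> V \<and> x + s *\<^sub>R a \<in> ?P \<and> x + (-s) *\<^sub>R a \<in> V \<and> x + (-s) *\<^sub>R a \<in> ?Q"
        if V: "open V" "x \<in> V" for V
      proof -
        obtain s where s: "s > 0" "\<forall>u. \<bar>u\<bar> \<le> s \<longrightarrow> x + u *\<^sub>R a \<in> V \<inter> ?M"
          using near[of "V \<inter> ?M" x] V x by auto
        then have "x + s *\<^sub>R a \<in> V \<inter> ?M" "x + (-s) *\<^sub>R a \<in> V \<inter> ?M"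
          using s(2)[rule_format, of s] s(2)[rule_format, of "-s"] by simp_all
        moreover have "a \<bullet> (x + s *\<^sub>R a) > t" "a \<bullet> (x + (-s) *\<^sub>R a) < t"
          using x s aa by (simp_all add: inner_add_right inner_diff_right)
        ultimately show ?thesis using s(1) by blast
      qed
      show "x \<in> closure ?P"
      proof (rule ccontr)
        assume "x \<notin> closure ?P"
        then show False using hit[of "- closure ?P"] closure_subset[of ?P] by blast
      qed
      show "x \<in> closure ?Q"
      proof (rule ccontr)
        assume "x \<notin> closure ?Q"
        then show False using hit[of "- closure ?Q"] closure_subset[of ?Q] by blast
      qed
    qed
  qed (use e N in \<open>auto simp: not_less_iff_gr_or_eq\<close>)
qed


section \<open>Vanishing ideals and lower bounds for the dimension\<close>

lemma poly_fun_ring_simps: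
  "carrier (poly_fun_ring S) = {restrict p S | p. real_polynomial_function p}"
  "f \<otimes>\<^bsub>poly_fun_ring S\<^esub> g = restrict (\<lambda>x. f x * g x) S"
  "f \<oplus>\<^bsub>poly_fun_ring S\<^esub> g = restrict (\<lambda>x. f x + g x) S"
  "\<one>\<^bsub>poly_fun_ring S\<^esub> = restrict (\<lambda>x. 1) S" "\<zero>\<^bsub>poly_fun_ring S\<^esub> = restrict (\<lambda>x. 0) S"
  by (auto simp: poly_fun_ring_def)

lemma restrict_mult_eq: "restrict (\<lambda>x. restrict p S x * restrict q S x) S = restrict (\<lambda>x. p x * q x) S"
  and restrict_add_eq: "restrict (\<lambda>x. restrict p S x + restrict q S x) S = restrict (\<lambda>x. p x + q x) S"
  by (auto simp: fun_eq_iff)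

lemma cring_poly_fun_ring: "cring (poly_fun_ring S)"
proof (rule cringI)
  let ?R = "poly_fun_ring S"
  have add: "f \<oplus>\<^bsub>?R\<^esub> g \<in> carrier ?R" and mult: "f \<otimes>\<^bsub>?R\<^esub> g \<in> carrier ?R"
    if "f \<in> carrier ?R" "g \<in> carrier ?R" for f g
  proof -
    from that obtain p q where pq: "real_polynomial_function p" "real_polynomial_function q" "f = restrict p S" "g = restrict q S"
      by (auto simp: poly_fun_ring_simps)
    show "f \<oplus>\<^bsub>?R\<^esub> g \<in> carrier ?R" "f \<otimes>\<^bsub>?R\<^esub> g \<in> carrier ?R"
      unfolding poly_fun_ring_simps pq(3,4) restrict_mult_eq restrict_add_eq
      using pq(1,2) by auto
  qed
  have ext: "f = restrict f S" if "f \<in> carrier ?R" for f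
    using that by (auto simp: poly_fun_ring_simps)
  have neutral: "restrict (\<lambda>x. restrict (\<lambda>x. 0) S x + f x) S = f" "restrict (\<lambda>x. restrict (\<lambda>x. 1) S x * f x) S = f"
    if "f \<in> carrier ?R" for f
    by (subst (2) ext[OF that], simp add: fun_eq_iff restrict_def)+
  show "abelian_group ?R"
  proof (rule abelian_groupI)
    show "\<exists>g\<in>carrier ?R. g \<oplus>\<^bsub>?R\<^esub> f = \<zero>\<^bsub>?R\<^esub>" if "f \<in> carrier ?R" for f
    proof -
      obtain p where p: "real_polynomial_function p" "f = restrict p S"
        using \<open>f \<in> carrier ?R\<close> by (auto simp: poly_fun_ring_simps)
      then show ?thesis
        by (intro bexI[of _ "restrict (\<lambda>x. - p x) S"])
           (auto simp: poly_fun_ring_simps restrict_add_eq)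
    qed
    show "\<zero>\<^bsub>?R\<^esub> \<oplus>\<^bsub>?R\<^esub> f = f" if "f \<in> carrier ?R" for f
      using neutral[OF that] by (simp only: poly_fun_ring_simps)
  qed (auto intro!: add simp: poly_fun_ring_simps fun_eq_iff restrict_def)
  show "comm_monoid ?R"
  proof (rule comm_monoidI)
    show "\<one>\<^bsub>?R\<^esub> \<otimes>\<^bsub>?R\<^esub> f = f" if "f \<in> carrier ?R" for f
      using neutral[OF that] by (simp only: poly_fun_ring_simps)
  qed (auto intro!: mult simp: poly_fun_ring_simps fun_eq_iff restrict_def)
qed (simp add: poly_fun_ring_simps fun_eq_iff restrict_def algebra_simps)

text \<open>This is irreducibility in the Zariski topology: the polynomials that vanish on \<open>T\<close> form a prime ideal.\<close>

definition irreducible_set :: "(real^'n) set \<Rightarrow> bool" where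
  "irreducible_set T \<longleftrightarrow> T \<noteq> {} \<and> (\<forall>p q. real_polynomial_function p \<and> real_polynomial_function q \<and>
     (\<forall>x\<in>T. p x * q x = 0) \<longrightarrow> (\<forall>x\<in>T. p x = 0) \<or> (\<forall>x\<in>T. q x = 0))"

lemma primeideal_vanishing:
  assumes T: "irreducible_set T" "T \<subseteq> S"
  shows "primeideal {f \<in> carrier (poly_fun_ring S). \<forall>x\<in>T. f x = 0} (poly_fun_ring S)"
    (is "primeideal ?I ?R")
proof (rule primeidealI)
  interpret cring ?R by (rule cring_poly_fun_ring)
  have at: "(f \<otimes>\<^bsub>?R\<^esub> g) x = f x * g x" "(f \<oplus>\<^bsub>?R\<^esub> g) x = f x + g x" "\<zero>\<^bsub>?R\<^esub> x = 0" "\<one>\<^bsub>?R\<^esub> x = 1" if "x \<in> T" for f g x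
    using that T(2) by (auto simp: poly_fun_ring_simps)
  show "ideal ?I ?R"
  proof (rule idealI)
    show "ring ?R" by (rule ring_axioms)
    show "subgroup ?I (add_monoid ?R)"
    proof (rule add.subgroupI)
      have "\<zero>\<^bsub>?R\<^esub> \<in> ?I" using zero_closed at(3) by simp
      then show "?I \<noteq> {}" by (metis empty_iff)
      show "\<ominus>\<^bsub>?R\<^esub> f \<in> ?I" if "f \<in> ?I" for f
      proof -
        have "f x + (\<ominus>\<^bsub>?R\<^esub> f) x = 0" if "x \<in> T" for x
        proof -
          have "(f \<oplus>\<^bsub>?R\<^esub> \<ominus>\<^bsub>?R\<^esub> f) x = \<zero>\<^bsub>?R\<^esub> x" using r_neg[of f] \<open>f \<in> ?I\<close> by simp
          then show ?thesis using at(2)[OF \<open>x \<in> T\<close>, of f "\<ominus>\<^bsub>?R\<^esub> f"] at(3)[OF \<open>x \<in> T\<close>] by simp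
        qed
        then show ?thesis using that by auto
      qed
    qed (auto simp: at)
  qed (auto simp: at)
  show "cring ?R" by (rule cring_poly_fun_ring)
  have "\<one>\<^bsub>?R\<^esub> \<notin> ?I" using T(1) at unfolding irreducible_set_def by fastforce
  then show "carrier ?R \<noteq> ?I" using one_closed by blast
  fix f g assume fg: "f \<in> carrier ?R" "g \<in> carrier ?R" "f \<otimes>\<^bsub>?R\<^esub> g \<in> ?I"
  then obtain p q where pq: "real_polynomial_function p" "real_polynomial_function q" "f = restrict p S" "g = restrict q S"
    by (auto simp: poly_fun_ring_simps)
  have "\<forall>x\<in>T. p x * q x = 0"
  proof
    fix x assume x: "x \<in> T"
    with fg(3) have "f x * g x = 0" using at(1)[OF x] by auto
    then show "p x * q x = 0" using x T(2) pq by auto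
  qed
  then have "(\<forall>x\<in>T. p x = 0) \<or> (\<forall>x\<in>T. q x = 0)" using T(1) pq unfolding irreducible_set_def by blast
  then show "f \<in> ?I \<or> g \<in> ?I" using fg T(2) pq by (auto simp: subset_iff)
qed

text \<open>The vanishing ideals of a descending chain of irreducible subsets form an ascending chain of prime
  ideals; the polynomials \<open>q\<close> show that it is strict.\<close>

lemma semialg_dim_ge:
  fixes T :: "nat \<Rightarrow> (real^'n) set"
  assumes irr: "\<And>i. i \<le> n \<Longrightarrow> irreducible_set (T i)" and sub: "T 0 \<subseteq> S" "\<And>i. i < n \<Longrightarrow> T (Suc i) \<subseteq> T i"
    and Q: "\<And>i. i < n \<Longrightarrow> \<exists>q. real_polynomial_function q \<and> (\<forall>x\<in>T (Suc i). q x = 0) \<and> (\<exists>x\<in>T i. q x \<noteq> 0)"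
  shows "enat n \<le> semialg_dim S"
proof -
  have TS: "T i \<subseteq> S" if "i \<le> n" for i
    using that by (induction i) (use sub in \<open>auto simp: Suc_le_eq\<close>)
  define P where "P i = {f \<in> carrier (poly_fun_ring S). \<forall>x\<in>T i. f x = 0}" for i
  have "primeideal (P i) (poly_fun_ring S)" if "i \<le> n" for i
    unfolding P_def by (rule primeideal_vanishing[OF irr[OF that] TS[OF that]])
  moreover have "P i \<subset> P (Suc i)" if "i < n" for i
  proof -
    obtain q x where q: "real_polynomial_function q" "\<forall>x\<in>T (Suc i). q x = 0" "x \<in> T i" "q x \<noteq> 0"
      using Q[OF \<open>i < n\<close>] by blast
    have "restrict q S \<in> P (Suc i)" "restrict q S \<notin> P i"
      using q TS[of i] TS[of "Suc i"] that by (auto simp: P_def poly_fun_ring_simps subset_iff)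
    moreover have "P i \<subseteq> P (Suc i)" using sub(2)[OF that] by (auto simp: P_def)
    ultimately show ?thesis by blast
  qed
  ultimately have "\<exists>P. (\<forall>i\<le>n. primeideal (P i) (poly_fun_ring S)) \<and> (\<forall>i<n. P i \<subset> P (Suc i))"
    by (intro exI[of _ P] conjI allI impI)
  then show ?thesis
    unfolding semialg_dim_def krull_dim_def by (intro Sup_upper CollectI exI[of _ n] conjI refl)
qed

text \<open>A substitute for real analyticity in several variables that only needs holomorphic functions of one
  variable: it suffices for the identity theorem because any two points of a convex set lie on a line.\<close>

definition entire_on_lines :: "('a::real_vector \<Rightarrow> real) \<Rightarrow> bool" where
  "entire_on_lines f \<longleftrightarrow> (\<forall>p v. \<exists>G. G holomorphic_on UNIV \<and> (\<forall>t::real. G (of_real t) = of_real (f (p + t *\<^sub>R v))))"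

lemma entire_on_lines_const: "entire_on_lines (\<lambda>x. c)"
  unfolding entire_on_lines_def by (intro allI exI[of _ "\<lambda>z. of_real c"]) auto

lemma entire_on_lines_linear:
  assumes "linear f" shows "entire_on_lines f"
  unfolding entire_on_lines_def
  by (intro allI, rule_tac x="\<lambda>z. of_real (f p) + z * of_real (f v)" in exI)
     (auto intro!: holomorphic_intros simp: linear_add[OF assms] linear_scale[OF assms])

lemma entire_on_lines_add:
  assumes "entire_on_lines f" "entire_on_lines g" shows "entire_on_lines (\<lambda>x. f x + g x)"
  unfolding entire_on_lines_def
proof (intro allI)
  fix p v
  from assms obtain F G where "F holomorphic_on UNIV" "\<forall>t::real. F (of_real t) = of_real (f (p + t *\<^sub>R v))"
    "G holomorphic_on UNIV" "\<forall>t::real. G (of_real t) = of_real (g (p + t *\<^sub>R v))"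
    unfolding entire_on_lines_def by meson
  then show "\<exists>G. G holomorphic_on UNIV \<and> (\<forall>t::real. G (of_real t) = of_real (f (p + t *\<^sub>R v) + g (p + t *\<^sub>R v)))"
    by (intro exI[of _ "\<lambda>z. F z + G z"]) (auto intro: holomorphic_intros)
qed

lemma entire_on_lines_mult:
  assumes "entire_on_lines f" "entire_on_lines g" shows "entire_on_lines (\<lambda>x. f x * g x)"
  unfolding entire_on_lines_def
proof (intro allI)
  fix p v
  from assms obtain F G where "F holomorphic_on UNIV" "\<forall>t::real. F (of_real t) = of_real (f (p + t *\<^sub>R v))"
    "G holomorphic_on UNIV" "\<forall>t::real. G (of_real t) = of_real (g (p + t *\<^sub>R v))"
    unfolding entire_on_lines_def by meson
  then show "\<exists>G. G holomorphic_on UNIV \<and> (\<forall>t::real. G (of_real t) = of_real (f (p + t *\<^sub>R v) * g (p + t *\<^sub>R v)))"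
    by (intro exI[of _ "\<lambda>z. F z * G z"]) (auto intro: holomorphic_intros)
qed

lemma entire_on_lines_compose:
  assumes "entire_on_lines f" "H holomorphic_on UNIV" "\<And>t::real. H (of_real t) = of_real (h t)"
  shows "entire_on_lines (\<lambda>x. h (f x))"
  unfolding entire_on_lines_def
proof (intro allI)
  fix p v
  from assms obtain F where F: "F holomorphic_on UNIV" "\<forall>t::real. F (of_real t) = of_real (f (p + t *\<^sub>R v))"
    unfolding entire_on_lines_def by meson
  have "(H \<circ> F) holomorphic_on UNIV" using F(1) assms(2) by (rule holomorphic_on_compose_gen) auto
  then show "\<exists>G. G holomorphic_on UNIV \<and> (\<forall>t::real. G (of_real t) = of_real (h (f (p + t *\<^sub>R v))))"
    using F assms(3) by (intro exI[of _ "H \<circ> F"]) auto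
qed

lemma entire_on_lines_polynomial:
  fixes \<phi> :: "'a::real_vector \<Rightarrow> real^'n"
  assumes \<phi>: "\<And>i. entire_on_lines (\<lambda>x. \<phi> x $ i)" and q: "real_polynomial_function q"
  shows "entire_on_lines (\<lambda>x. q (\<phi> x))"
  using q
proof induction
  case (linear f)
  interpret f: bounded_linear f by fact
  have fin: "entire_on_lines (\<lambda>x. \<Sum>i\<in>I. \<phi> x $ i * f (axis i 1))" if "finite I" for I
    using that
    by (induction I) (auto intro!: entire_on_lines_const entire_on_lines_add entire_on_lines_mult \<phi>)
  have "f y = (\<Sum>i\<in>UNIV. y $ i * f (axis i 1))" for y :: "real^'n"
  proof -
    have "y = (\<Sum>i\<in>UNIV. y $ i *\<^sub>R axis i 1)" by (simp add: vec_eq_iff axis_def if_distrib cong: if_cong)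
    then have "f y = f (\<Sum>i\<in>UNIV. y $ i *\<^sub>R axis i 1)" by simp
    also have "\<dots> = (\<Sum>i\<in>UNIV. y $ i * f (axis i 1))" by (simp add: f.sum f.scaleR)
    finally show ?thesis .
  qed
  then have "(\<lambda>x. f (\<phi> x)) = (\<lambda>x. \<Sum>i\<in>UNIV. \<phi> x $ i * f (axis i 1))" by (intro ext)
  then show ?case using fin[of UNIV] by simp
qed (auto intro: entire_on_lines_const entire_on_lines_add entire_on_lines_mult)

text \<open>Suppose that \<open>p q\<close> vanishes on the image while \<open>p\<close> is nonzero at \<open>\<phi> a\<close> and \<open>q\<close> at \<open>\<phi> b\<close>. On the segment
  from \<open>a\<close> to \<open>b\<close> both pull back to restrictions of entire functions with product zero, and the identity theorem
  forces one of these two to vanish identically.\<close>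

lemma irreducible_image_convex:
  fixes \<phi> :: "'a::real_vector \<Rightarrow> real^'n"
  assumes \<phi>: "\<And>i. entire_on_lines (\<lambda>x. \<phi> x $ i)" and D: "convex D" "D \<noteq> {}"
  shows "irreducible_set (\<phi> ` D)"
  unfolding irreducible_set_def
proof (intro conjI allI impI, goal_cases)
  case 1
  then show ?case using D by auto
next
  case (2 p q)
  show ?case
  proof (rule ccontr)
    assume "\<not> ?case"
    then obtain a b where ab: "a \<in> D" "b \<in> D" "p (\<phi> a) \<noteq> 0" "q (\<phi> b) \<noteq> 0" by auto
    have "entire_on_lines (\<lambda>x. p (\<phi> x))" "entire_on_lines (\<lambda>x. q (\<phi> x))"
      using 2 by (auto intro: entire_on_lines_polynomial \<phi>)
    then obtain F G where F: "F holomorphic_on UNIV" "\<And>t::real. F (of_real t) = of_real (p (\<phi> (a + t *\<^sub>R (b - a))))"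
      and G: "G holomorphic_on UNIV" "\<And>t::real. G (of_real t) = of_real (q (\<phi> (a + t *\<^sub>R (b - a))))"
      unfolding entire_on_lines_def by meson
    define U where "U = complex_of_real ` {0..1}"
    have FG0: "F z * G z = 0" if "z \<in> U" for z
    proof -
      obtain t :: real where t: "0 \<le> t" "t \<le> 1" "z = of_real t" using \<open>z \<in> U\<close> by (auto simp: U_def)
      have "a + t *\<^sub>R (b - a) = (1 - t) *\<^sub>R a + t *\<^sub>R b" by (simp add: algebra_simps)
      then have "a + t *\<^sub>R (b - a) \<in> D" using D ab t by (simp add: convexD)
      then have "p (\<phi> (a + t *\<^sub>R (b - a))) * q (\<phi> (a + t *\<^sub>R (b - a))) = 0" using 2 by blast
      then show ?thesis unfolding t(3) F(2) G(2) of_real_mult[symmetric] by simp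
    qed
    \<comment> \<open>the parameters of the segment accumulate at \<open>0\<close>, which is all that the identity theorem needs\<close>
    have lim: "0 islimpt U"
    proof -
      have "\<exists>z\<in>U. z \<noteq> 0 \<and> dist z 0 < e" if "e > 0" for e
        using that by (intro bexI[of _ "of_real (min 1 (e / 2))"]) (auto simp: U_def min_def)
      then show ?thesis by (auto simp: islimpt_approachable)
    qed
    have FG: "(\<lambda>z. F z * G z) holomorphic_on UNIV" using F G by (auto intro: holomorphic_intros)
    have all0: "F z * G z = 0" for z
      by (rule analytic_continuation[OF FG, of U 0]) (use lim FG0 in auto)
    have "F 0 \<noteq> 0" using F(2)[of 0] ab by simp
    then obtain e where e: "e > 0" "\<And>z. dist 0 z < e \<Longrightarrow> F z \<noteq> 0"
      using F(1) continuous_at_avoid[of 0 F 0] holomorphic_on_imp_continuous_on[OF F(1)]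
      by (auto simp: continuous_on_eq_continuous_at)
    have "G z = 0" if "z \<in> ball 0 e" for z using e(2)[of z] that all0[of z] by auto
    then have "G z = 0" for z
      by (rule analytic_continuation_open[of "ball 0 e" UNIV G "\<lambda>_. 0" z, rotated -2]) (use e G in auto)
    then have "G (of_real 1) = 0" by blast
    then show False using G(2)[of 1] ab by simp
  qed
qed

lemma semialg_dim_ge_chart:
  fixes \<phi> :: "'a::real_vector \<Rightarrow> real^'n"
  assumes \<phi>: "\<And>i. entire_on_lines (\<lambda>x. \<phi> x $ i)"
    and D: "\<And>i. i \<le> n \<Longrightarrow> convex (D i)" "D n \<noteq> {}" "\<And>i. i < n \<Longrightarrow> D (Suc i) \<subseteq> D i" "\<phi> ` D 0 \<subseteq> S"
    and Q: "\<And>i. i < n \<Longrightarrow> \<exists>q. real_polynomial_function q \<and> (\<forall>x\<in>D (Suc i). q (\<phi> x) = 0) \<and> (\<exists>x\<in>D i. q (\<phi> x) \<noteq> 0)"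
  shows "enat n \<le> semialg_dim S"
proof (rule semialg_dim_ge[of n "\<lambda>i. \<phi> ` D i"])
  have "D n \<subseteq> D i" if "i \<le> n" for i using that by (induction rule: inc_induct) (use D(3) in auto)
  then show "irreducible_set (\<phi> ` D i)" if "i \<le> n" for i
    using that D(1,2) by (intro irreducible_image_convex \<phi>) blast+
  show "\<phi> ` D (Suc i) \<subseteq> \<phi> ` D i" if "i < n" for i using D(3)[OF that] by blast
  show "\<exists>q. real_polynomial_function q \<and> (\<forall>x\<in>\<phi> ` D (Suc i). q x = 0) \<and> (\<exists>x\<in>\<phi> ` D i. q x \<noteq> 0)" if "i < n" for i
    using Q[OF that] by auto
qed (use D in auto)


section \<open>Algebraic dependence and upper bounds for the dimension\<close>

text \<open>A homogeneous linear system with more unknowns than equations has a nontrivial solution; one step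
  of Gaussian elimination removes an equation and an unknown.\<close>

lemma homogeneous_system_solution:
  fixes M :: "'a \<Rightarrow> 'b \<Rightarrow> real"
  assumes "finite B" "finite A" "card B < card A"
  shows "\<exists>c. (\<exists>a\<in>A. c a \<noteq> 0) \<and> (\<forall>b\<in>B. (\<Sum>a\<in>A. c a * M a b) = 0)"
  using assms
proof (induction B arbitrary: A M)
  case empty
  then obtain a where "a \<in> A" by fastforce
  then show ?case by (intro exI[of _ "\<lambda>_. 1"]) auto
next
  case (insert b0 B)
  show ?case
  proof (cases "\<forall>a\<in>A. M a b0 = 0")
    case True
    then show ?thesis using insert.IH[of A M] insert.prems insert.hyps by auto
  next
    case False
    then obtain a0 where a0: "a0 \<in> A" "M a0 b0 \<noteq> 0" by auto
    define A' where "A' = A - {a0}"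
    define M' where "M' a b = M a b - M a b0 / M a0 b0 * M a0 b" for a b
    have "card B < card A'" using insert.prems insert.hyps a0 by (simp add: A'_def)
    then obtain c where c: "\<exists>a\<in>A'. c a \<noteq> 0" "\<And>b. b \<in> B \<Longrightarrow> (\<Sum>a\<in>A'. c a * M' a b) = 0"
      using insert.IH[of A' M'] insert.prems by (auto simp: A'_def)
    define c' where "c' a = (if a = a0 then - (\<Sum>a\<in>A'. c a * M a b0) / M a0 b0 else c a)" for a
    have sum: "(\<Sum>a\<in>A. c' a * M a b) = (\<Sum>a\<in>A'. c a * M' a b)" for b
    proof -
      have "(\<Sum>a\<in>A. c' a * M a b) = c' a0 * M a0 b + (\<Sum>a\<in>A'. c' a * M a b)"
        using a0(1) insert.prems(1) by (simp add: sum.remove A'_def)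
      also have "(\<Sum>a\<in>A'. c' a * M a b) = (\<Sum>a\<in>A'. c a * M a b)"
        by (intro sum.cong) (auto simp: A'_def c'_def)
      also have "c' a0 * M a0 b = - (\<Sum>a\<in>A'. c a * (M a b0 / M a0 b0 * M a0 b))"
        by (simp add: c'_def sum_distrib_left sum_divide_distrib mult_ac)
      finally show ?thesis by (simp add: M'_def right_diff_distrib sum_subtractf)
    qed
    have "(\<Sum>a\<in>A. c' a * M a b) = 0" if "b \<in> insert b0 B" for b
      using that c(2) a0(2) by (auto simp: sum M'_def)
    moreover have "\<exists>a\<in>A. c' a \<noteq> 0" using c(1) by (auto simp: c'_def A'_def)
    ultimately show ?thesis by blast
  qed
qed

text \<open>The exponent vectors of the monomials in \<open>n\<close> variables of degree less than \<open>N\<close> in each variable,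
  as lists, so that induction on the number of variables is structural.\<close>

definition exponents :: "nat \<Rightarrow> nat \<Rightarrow> nat list set" where
  "exponents n N = {es. set es \<subseteq> {..<N} \<and> length es = n}"

lemma finite_exponents: "finite (exponents n N)" and card_exponents: "card (exponents n N) = N ^ n"
  by (simp_all add: exponents_def finite_lists_length_eq card_lists_length_eq)

fun monomial :: "('a \<Rightarrow> real) list \<Rightarrow> nat list \<Rightarrow> 'a \<Rightarrow> real" where
  "monomial (f # fs) (e # es) x = f x ^ e * monomial fs es x"
| "monomial _ _ x = 1"

lemma sum_exponents_Suc:
  "(\<Sum>es\<in>exponents (Suc n) N. c es * monomial (f # fs) es x) =
   (\<Sum>e<N. f x ^ e * (\<Sum>es\<in>exponents n N. c (e # es) * monomial fs es x))"
proof -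
  have inj: "inj_on (\<lambda>(e, es). e # es) ({..<N} \<times> exponents n N)" by (auto simp: inj_on_def)
  have im: "exponents (Suc n) N = (\<lambda>(e, es). e # es) ` ({..<N} \<times> exponents n N)"
  proof (intro equalityI subsetI)
    fix es assume "es \<in> exponents (Suc n) N"
    then show "es \<in> (\<lambda>(e, es). e # es) ` ({..<N} \<times> exponents n N)"
      by (cases es) (auto simp: exponents_def image_iff)
  qed (auto simp: exponents_def)
  show ?thesis
    unfolding im by (subst sum.reindex[OF inj])
      (simp add: sum.cartesian_product split_def sum_distrib_left mult_ac)
qed

lemma monomial_Nil: "monomial [] es = (\<lambda>_. 1)" "monomial fs [] = (\<lambda>_. 1)"
  by (auto simp: fun_eq_iff)

lemma real_polynomial_function_monomial:
  "\<forall>f\<in>set fs. real_polynomial_function f \<Longrightarrow> real_polynomial_function (monomial fs es)"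
proof (induction fs es rule: list_induct2')
  case (4 f fs e es)
  then show ?case by (auto intro: real_polynomial_function.intros(4) real_polynomial_function_power)
qed (auto simp: monomial_Nil)

text \<open>Prime ideals of the ring of polynomial functions, described by closure properties on plain functions. The
  ideals of \<open>poly_fun_ring S\<close> are pulled back to this ring, because all members of a chain, and the
  zero ideal below them, then live in one ring.\<close>

definition poly_prime :: "((real^'n) \<Rightarrow> real) set \<Rightarrow> bool" where
  "poly_prime J \<longleftrightarrow> J \<subseteq> Collect real_polynomial_function \<and>
     (\<forall>f\<in>J. \<forall>g\<in>J. (\<lambda>x. f x + g x) \<in> J) \<and>
     (\<forall>f\<in>J. \<forall>g. real_polynomial_function g \<longrightarrow> (\<lambda>x. f x * g x) \<in> J) \<and>
     (\<forall>f g. real_polynomial_function f \<and> real_polynomial_function g \<and> (\<lambda>x. f x * g x) \<in> J \<longrightarrow> f \<in> J \<or> g \<in> J) \<and>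
     (\<forall>c. (\<lambda>x. c) \<in> J \<longrightarrow> c = 0)"

lemma poly_primeD:
  assumes "poly_prime J"
  shows "f \<in> J \<Longrightarrow> real_polynomial_function f"
    and "f \<in> J \<Longrightarrow> g \<in> J \<Longrightarrow> (\<lambda>x. f x + g x) \<in> J"
    and "f \<in> J \<Longrightarrow> real_polynomial_function g \<Longrightarrow> (\<lambda>x. f x * g x) \<in> J"
    and "real_polynomial_function f \<Longrightarrow> real_polynomial_function g \<Longrightarrow> (\<lambda>x. f x * g x) \<in> J \<Longrightarrow> f \<in> J \<or> g \<in> J"
    and "(\<lambda>x. c) \<in> J \<Longrightarrow> c = 0"
proof -
  note J = assms[unfolded poly_prime_def]
  note J1 = J[THEN conjunct1] and K = J[THEN conjunct2]
  note J2 = K[THEN conjunct1] and L = K[THEN conjunct2]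
  note J3 = L[THEN conjunct1] and M = L[THEN conjunct2]
  note J4 = M[THEN conjunct1] and J5 = M[THEN conjunct2]
  show "f \<in> J \<Longrightarrow> real_polynomial_function f" using J1 by (rule subsetD[THEN CollectD])
  show "f \<in> J \<Longrightarrow> g \<in> J \<Longrightarrow> (\<lambda>x. f x + g x) \<in> J" using J2 by simp
  show "f \<in> J \<Longrightarrow> real_polynomial_function g \<Longrightarrow> (\<lambda>x. f x * g x) \<in> J" using J3 by simp
  show "real_polynomial_function f \<Longrightarrow> real_polynomial_function g \<Longrightarrow> (\<lambda>x. f x * g x) \<in> J \<Longrightarrow> f \<in> J \<or> g \<in> J"
    using J4 by simp
  show "(\<lambda>x. c) \<in> J \<Longrightarrow> c = 0" using J5 by simp
qed

lemma poly_prime_power: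
  assumes J: "poly_prime J" and f: "real_polynomial_function f" "f \<notin> J" and g: "real_polynomial_function g"
    and fg: "(\<lambda>x. f x ^ e * g x) \<in> J"
  shows "g \<in> J"
  using fg
proof (induction e)
  case (Suc e)
  have "(\<lambda>x. f x * (f x ^ e * g x)) \<in> J" using Suc.prems by (simp add: mult_ac)
  then have "(\<lambda>x. f x ^ e * g x) \<in> J"
    using poly_primeD(4)[OF J f(1), of "\<lambda>x. f x ^ e * g x"] f g
      real_polynomial_function.intros(4)[OF real_polynomial_function_power[OF f(1), of e] g] by blast
  then show ?case by (rule Suc.IH)
qed simp

lemma sum_lessThan_add: "(\<Sum>i<m + k. g i) = (\<Sum>i<m. g i) + (\<Sum>i<k. g (m + i))" for g :: "nat \<Rightarrow> real"
  by (induction k) (auto simp: add.assoc)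

text \<open>A relation between the \<open>fs\<close> modulo \<open>J 0\<close> is expanded in powers of the first polynomial \<open>f\<close>, with coefficients \<open>T e\<close>.
  Once all coefficients below \<open>T e\<close> are known to be trivial, the relation is \<open>f ^ e * (T e + f * R)\<close>. As \<open>f\<close> is not in the prime
  \<open>J 0\<close>, the second factor is in \<open>J 0\<close>, and as \<open>f\<close> is in \<open>J 1\<close>, so is \<open>T e\<close>: this is a relation between the
  remaining polynomials modulo the next prime, hence trivial as well.\<close>

lemma prime_chain_independent:
  assumes J: "\<And>i. i \<le> length fs \<Longrightarrow> poly_prime (J i)" and mono: "\<And>i. i < length fs \<Longrightarrow> J i \<subseteq> J (Suc i)"
    and fs: "\<And>i. i < length fs \<Longrightarrow> fs ! i \<in> J (Suc i) - J i"
    and rel: "(\<lambda>x. \<Sum>es\<in>exponents (length fs) N. c es * monomial fs es x) \<in> J 0"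
    and es: "es \<in> exponents (length fs) N"
  shows "c es = 0"
  using assms
proof (induction fs arbitrary: J c es)
  case Nil
  have "exponents 0 N = {[]}" by (auto simp: exponents_def)
  then show ?case using Nil(4,5) poly_primeD(5)[OF Nil(1)[of 0]] by (auto simp: exponents_def)
next
  case (Cons f fs)
  have pr0: "poly_prime (J 0)" and pr1: "poly_prime (J 1)" using Cons(2)[of 0] Cons(2)[of 1] by auto
  have sub01: "J 0 \<subseteq> J 1" using Cons(3)[of 0] by simp
  have f: "f \<in> J 1" "f \<notin> J 0" using Cons(4)[of 0] by auto
  have rf: "real_polynomial_function f" by (rule poly_primeD(1)[OF pr1 f(1)])
  have rfs: "\<forall>g\<in>set fs. real_polynomial_function g"
  proof
    fix g assume "g \<in> set fs"
    then obtain i where "i < length fs" "g = fs ! i" by (metis in_set_conv_nth)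
    then show "real_polynomial_function g"
      using Cons(4)[of "Suc i"] Cons(2)[of "Suc (Suc i)"] poly_primeD(1) by fastforce
  qed
  define T where "T e x = (\<Sum>es\<in>exponents (length fs) N. c (e # es) * monomial fs es x)" for e x
  have rT: "real_polynomial_function (T e)" for e
    unfolding T_def using real_polynomial_function_monomial[OF rfs] finite_exponents[of "length fs" N]
    by (intro real_polynomial_function_sum) auto
  have IH: "c (e # es') = 0" if "T e \<in> J 1" "es' \<in> exponents (length fs) N" for e es'
  proof (rule Cons.IH[of "\<lambda>i. J (Suc i)" "\<lambda>es. c (e # es)"])
    show "(\<lambda>x. \<Sum>es\<in>exponents (length fs) N. c (e # es) * monomial fs es x) \<in> J (Suc 0)"
      using that(1) by (simp add: T_def[abs_def])
    show "fs ! i \<in> J (Suc (Suc i)) - J (Suc i)" if "i < length fs" for i using Cons(4)[of "Suc i"] that by simp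
    show "poly_prime (J (Suc i))" if "i \<le> length fs" for i using Cons(2)[of "Suc i"] that by simp
    show "J (Suc i) \<subseteq> J (Suc (Suc i))" if "i < length fs" for i using Cons(3)[of "Suc i"] that by simp
  qed (fact that(2))
  have zero: "e < N \<Longrightarrow> \<forall>es'\<in>exponents (length fs) N. c (e # es') = 0" for e
  proof (induction e rule: less_induct)
    case (less e)
    define R where "R x = (\<Sum>i<N - Suc e. f x ^ i * T (Suc e + i) x)" for x
    have rR: "real_polynomial_function R"
      unfolding R_def using rf rT by (intro real_polynomial_function_sum) auto
    have "(\<Sum>i<N. f x ^ i * T i x) = f x ^ e * (T e x + f x * R x)" for x
    proof -
      have "(\<Sum>i<N. f x ^ i * T i x) = (\<Sum>i<Suc e + (N - Suc e). f x ^ i * T i x)" using less.prems by simp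
      also have "\<dots> = (\<Sum>i<Suc e. f x ^ i * T i x) + (\<Sum>i<N - Suc e. f x ^ (Suc e + i) * T (Suc e + i) x)"
        by (rule sum_lessThan_add)
      also have "(\<Sum>i<Suc e. f x ^ i * T i x) = f x ^ e * T e x"
      proof -
        have "T i x = 0" if "i < e" for i
          using less.IH[OF that] that less.prems by (auto simp: T_def)
        then show ?thesis by simp
      qed
      finally show ?thesis by (simp add: R_def sum_distrib_left algebra_simps power_add)
    qed
    then have "(\<lambda>x. f x ^ e * (T e x + f x * R x)) \<in> J 0"
      using Cons(5) by (simp add: sum_exponents_Suc T_def)
    moreover have rr: "real_polynomial_function (\<lambda>x. T e x + f x * R x)" using rT rf rR by auto
    ultimately have "(\<lambda>x. T e x + f x * R x) \<in> J 1"
      using poly_prime_power[OF pr0 rf f(2)] sub01 by blast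
    moreover have "(\<lambda>x. f x * (- R x)) \<in> J 1"
      using poly_primeD(3)[OF pr1 f(1)] rR by blast
    ultimately have "(\<lambda>x. (T e x + f x * R x) + f x * (- R x)) \<in> J 1"
      by (rule poly_primeD(2)[OF pr1])
    then have "T e \<in> J 1" by simp
    then show ?case using IH by blast
  qed
  obtain e es' where "es = e # es'" "e < N" "es' \<in> exponents (length fs) N"
    using Cons(6) by (cases es) (auto simp: exponents_def)
  then show ?case using zero by blast
qed

definition coord_power :: "('n::finite \<Rightarrow> nat) \<Rightarrow> real^'n \<Rightarrow> real" where
  "coord_power b x = (\<Prod>i\<in>UNIV. (x $ i) ^ b i)"

text \<open>The bound is on the degree in each variable separately, so that the monomials are counted by a power of \<open>D + 1\<close>.\<close>

definition partial_degree_le :: "nat \<Rightarrow> (real^'n \<Rightarrow> real) \<Rightarrow> bool" where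
  "partial_degree_le D f \<longleftrightarrow> (\<exists>c. \<forall>x. f x = (\<Sum>b\<in>{b. \<forall>i. b i \<le> D}. c b * coord_power b x))"

lemma finite_bounded_fun: "finite {b::'n::finite \<Rightarrow> nat. \<forall>i. b i \<le> D}"
  and card_bounded_fun: "card {b::'n::finite \<Rightarrow> nat. \<forall>i. b i \<le> D} = Suc D ^ CARD('n)"
proof -
  have "{b::'n \<Rightarrow> nat. \<forall>i. b i \<le> D} = PiE UNIV (\<lambda>_. {..D})" by (auto simp: PiE_def)
  then show "finite {b::'n::finite \<Rightarrow> nat. \<forall>i. b i \<le> D}" "card {b::'n::finite \<Rightarrow> nat. \<forall>i. b i \<le> D} = Suc D ^ CARD('n)"
    by (auto simp: finite_PiE card_PiE)
qed

lemma partial_degree_le_coord_power: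
  assumes "\<And>i. b i \<le> D" shows "partial_degree_le D (coord_power b)"
  unfolding partial_degree_le_def
proof (intro exI allI)
  show "coord_power b x = (\<Sum>b'\<in>{b. \<forall>i. b i \<le> D}. (if b' = b then 1 else 0) * coord_power b' x)" for x
    using assms by (simp add: if_distrib[of "\<lambda>z. z * _"] sum.delta[OF finite_bounded_fun] cong: if_cong)
qed

lemma partial_degree_le_add:
  assumes "partial_degree_le D f" "partial_degree_le D g" shows "partial_degree_le D (\<lambda>x. f x + g x)"
proof -
  from assms obtain c d where "\<forall>x. f x = (\<Sum>b\<in>{b. \<forall>i. b i \<le> D}. c b * coord_power b x)"
     "\<forall>x. g x = (\<Sum>b\<in>{b. \<forall>i. b i \<le> D}. d b * coord_power b x)" unfolding partial_degree_le_def by blast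
  then show ?thesis unfolding partial_degree_le_def
    by (intro exI[of _ "\<lambda>b. c b + d b"]) (simp add: sum.distrib algebra_simps)
qed

lemma partial_degree_le_scale:
  assumes "partial_degree_le D f" shows "partial_degree_le D (\<lambda>x. r * f x)"
proof -
  from assms obtain c where "\<forall>x. f x = (\<Sum>b\<in>{b. \<forall>i. b i \<le> D}. c b * coord_power b x)"
    unfolding partial_degree_le_def by blast
  then show ?thesis unfolding partial_degree_le_def
    by (intro exI[of _ "\<lambda>b. r * c b"]) (simp add: sum_distrib_left algebra_simps)
qed

lemma partial_degree_le_const: "partial_degree_le D (\<lambda>x. r)"
  using partial_degree_le_scale[OF partial_degree_le_coord_power[of "\<lambda>_. 0" D], of r]
  by (simp add: coord_power_def)

lemma partial_degree_le_sum:
  assumes "finite I" "\<And>i. i \<in> I \<Longrightarrow> partial_degree_le D (f i)"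
  shows "partial_degree_le D (\<lambda>x. \<Sum>i\<in>I. f i x)"
  using assms by (induction I) (auto intro: partial_degree_le_const partial_degree_le_add)

lemma partial_degree_le_mult:
  assumes "partial_degree_le D f" "partial_degree_le E g" shows "partial_degree_le (D + E) (\<lambda>x. f x * g x)"
proof -
  from assms obtain c d where c: "\<And>x. f x = (\<Sum>b\<in>{b. \<forall>i. b i \<le> D}. c b * coord_power b x)"
     and d: "\<And>x. g x = (\<Sum>b\<in>{b. \<forall>i. b i \<le> E}. d b * coord_power b x)" unfolding partial_degree_le_def by blast
  have "f x * g x = (\<Sum>b\<in>{b. \<forall>i. b i \<le> D}. \<Sum>b'\<in>{b. \<forall>i. b i \<le> E}. (c b * d b') * coord_power (\<lambda>i. b i + b' i) x)" for x
    by (simp add: c d sum_product coord_power_def power_add prod.distrib mult_ac)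
  moreover have "partial_degree_le (D + E) (\<lambda>x. \<Sum>b\<in>{b. \<forall>i. b i \<le> D}. \<Sum>b'\<in>{b. \<forall>i. b i \<le> E}. (c b * d b') * coord_power (\<lambda>i. b i + b' i) x)"
    by (intro partial_degree_le_sum finite_bounded_fun partial_degree_le_scale partial_degree_le_coord_power) (auto intro: add_mono)
  ultimately show ?thesis by simp
qed

lemma partial_degree_le_mono:
  assumes "partial_degree_le D f" "D \<le> E" shows "partial_degree_le E f"
  using partial_degree_le_mult[OF assms(1) partial_degree_le_const[of "E - D" 1]] assms(2) by simp

lemma partial_degree_le_power:
  assumes "partial_degree_le D f" shows "partial_degree_le (e * D) (\<lambda>x. f x ^ e)"
proof (induction e)
  case (Suc e)
  then show ?case using partial_degree_le_mult[OF assms Suc] by simp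
qed (simp add: partial_degree_le_const)

lemma real_polynomial_function_partial_degree:
  fixes f :: "real^'n \<Rightarrow> real"
  assumes "real_polynomial_function f" shows "\<exists>D. partial_degree_le D f"
  using assms
proof induction
  case (linear f)
  have "f y = (\<Sum>i\<in>UNIV. f (axis i 1) * coord_power (\<lambda>j. if j = i then 1 else 0) y)" for y
  proof -
    interpret f: bounded_linear f by fact
    have "y = (\<Sum>i\<in>UNIV. y $ i *\<^sub>R axis i 1)" by (simp add: vec_eq_iff axis_def if_distrib cong: if_cong)
    then have "f y = f (\<Sum>i\<in>UNIV. y $ i *\<^sub>R axis i 1)" by simp
    also have "\<dots> = (\<Sum>i\<in>UNIV. f (axis i 1) * y $ i)" by (simp add: f.sum f.scaleR mult.commute)
    also have "\<dots> = (\<Sum>i\<in>UNIV. f (axis i 1) * coord_power (\<lambda>j. if j = i then 1 else 0) y)"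
      by (simp add: coord_power_def if_distrib[of "\<lambda>e. _ ^ e"] cong: if_cong)
    finally show ?thesis .
  qed
  then have eq: "f = (\<lambda>y. \<Sum>i\<in>UNIV. f (axis i 1) * coord_power (\<lambda>j. if j = i then 1 else 0) y)" by (rule ext)
  have "partial_degree_le 1 f"
    by (subst eq, intro partial_degree_le_sum partial_degree_le_scale partial_degree_le_coord_power) auto
  then show ?case by (rule exI)
next
  case (add f g)
  then obtain D E where "partial_degree_le D f" "partial_degree_le E g" by blast
  then have "partial_degree_le (max D E) (\<lambda>x. f x + g x)"
    by (intro partial_degree_le_add) (auto elim: partial_degree_le_mono)
  then show ?case by (rule exI)
next
  case (const r)
  then show ?case using partial_degree_le_const by (rule exI)
next
  case (mult f g)
  then obtain D E where "partial_degree_le D f" "partial_degree_le E g" by blast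
  then show ?case using partial_degree_le_mult by blast
qed

lemma partial_degree_le_monomial:
  assumes "\<forall>f\<in>set fs. partial_degree_le D f" "set es \<subseteq> {..<N}"
  shows "partial_degree_le (length fs * (N * D)) (monomial fs es)"
  using assms
proof (induction fs es rule: list_induct2')
  case (4 f fs e es)
  have "partial_degree_le (N * D) (\<lambda>x. f x ^ e)"
    using partial_degree_le_power[of D f e] 4 by (auto elim!: partial_degree_le_mono)
  then have "partial_degree_le (N * D + length fs * (N * D)) (\<lambda>x. f x ^ e * monomial fs es x)"
    by (rule partial_degree_le_mult) (use 4 in auto)
  then show ?case by simp
qed (simp_all add: monomial_Nil partial_degree_le_const)

text \<open>The monomials of degree less than \<open>N\<close> in each of the \<open>m\<close> polynomials are \<open>N ^ m\<close> in number. They lie in a space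
  of functions that is spanned by \<open>(m * N * D + 1) ^ n\<close> monomials in the \<open>n\<close> coordinates. For \<open>m > n\<close> the
  first number is larger once \<open>N\<close> is large.\<close>

lemma algebraically_dependent:
  fixes fs :: "(real^'n \<Rightarrow> real) list"
  assumes fs: "\<forall>f\<in>set fs. real_polynomial_function f" and len: "length fs > CARD('n)"
  shows "\<exists>N c. (\<exists>es\<in>exponents (length fs) N. c es \<noteq> 0) \<and>
    (\<forall>x. (\<Sum>es\<in>exponents (length fs) N. c es * monomial fs es x) = 0)"
proof -
  have "\<exists>D. \<forall>f\<in>set fs. partial_degree_le D f"
    using fs
  proof (induction fs)
    case (Cons f fs)
    then obtain D E where "\<forall>f\<in>set fs. partial_degree_le D f" "partial_degree_le E f"
      using real_polynomial_function_partial_degree[of f] by auto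
    then show ?case using partial_degree_le_mono[of D _ "max D E"] partial_degree_le_mono[of E f "max D E"]
      by (intro exI[of _ "max D E"]) auto
  qed simp
  then obtain D where D: "\<forall>f\<in>set fs. partial_degree_le D f" by blast
  let ?m = "length fs" and ?n = "CARD('n)"
  \<comment> \<open>chosen so that \<open>(m N D + 1) ^ n \<le> N ^ n (m D + 1) ^ n < N ^ n * N\<close>\<close>
  define N where "N = Suc ((?m * D + 1) ^ ?n)"
  define B where "B = {b::'n \<Rightarrow> nat. \<forall>i. b i \<le> ?m * (N * D)}"
  have "card B = (?m * (N * D) + 1) ^ ?n" by (simp add: B_def card_bounded_fun)
  also have "\<dots> \<le> (N * (?m * D + 1)) ^ ?n" by (intro power_mono) (auto simp: N_def algebra_simps)
  also have "\<dots> = N ^ ?n * (?m * D + 1) ^ ?n" by (rule power_mult_distrib)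
  also have "\<dots> < N ^ ?n * N" by (rule mult_strict_left_mono) (auto simp: N_def)
  also have "\<dots> \<le> N ^ ?m"
    using len power_increasing[of "Suc ?n" ?m N] by (simp add: N_def mult.commute)
  also have "\<dots> = card (exponents ?m N)" by (simp add: card_exponents)
  finally have card: "card B < card (exponents ?m N)" .
  have "\<forall>es\<in>exponents ?m N. \<exists>M. \<forall>x. monomial fs es x = (\<Sum>b\<in>B. M b * coord_power b x)"
    using partial_degree_le_monomial[OF D] unfolding partial_degree_le_def B_def exponents_def by blast
  then obtain M where M: "\<And>es x. es \<in> exponents ?m N \<Longrightarrow> monomial fs es x = (\<Sum>b\<in>B. M es b * coord_power b x)"
    by metis
  obtain c where c: "\<exists>es\<in>exponents ?m N. c es \<noteq> 0" "\<And>b. b \<in> B \<Longrightarrow> (\<Sum>es\<in>exponents ?m N. c es * M es b) = 0"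
    using homogeneous_system_solution[OF _ finite_exponents card] finite_bounded_fun unfolding B_def by blast
  have "(\<Sum>es\<in>exponents ?m N. c es * monomial fs es x) = 0" for x
  proof -
    have "(\<Sum>es\<in>exponents ?m N. c es * monomial fs es x) =
        (\<Sum>es\<in>exponents ?m N. \<Sum>b\<in>B. c es * M es b * coord_power b x)"
      by (intro sum.cong) (auto simp: M sum_distrib_left mult_ac)
    also have "\<dots> = (\<Sum>b\<in>B. (\<Sum>es\<in>exponents ?m N. c es * M es b) * coord_power b x)"
      by (subst sum.swap) (simp add: sum_distrib_right)
    also have "\<dots> = 0" using c(2) by simp
    finally show ?thesis .
  qed
  with c(1) show ?thesis by blast
qed

lemma irreducible_UNIV: "irreducible_set (UNIV :: (real^'n) set)"
proof -
  have "entire_on_lines (\<lambda>x::real^'n. x $ i)" for i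
    by (intro entire_on_lines_linear linearI) auto
  from irreducible_image_convex[of "\<lambda>x::real^'n. x" UNIV, OF this] show ?thesis by simp
qed

lemma poly_prime_zero: "poly_prime {\<lambda>x::real^'n. 0}"
proof -
  have "f = (\<lambda>x. 0) \<or> g = (\<lambda>x. 0)"
    if "real_polynomial_function f" "real_polynomial_function g" "(\<lambda>x. f x * g x) = (\<lambda>x. 0)" for f g :: "real^'n \<Rightarrow> real"
  proof -
    have "\<forall>x\<in>UNIV. f x * g x = 0" using fun_cong[OF that(3)] by blast
    then have "(\<forall>x\<in>UNIV. f x = 0) \<or> (\<forall>x\<in>UNIV. g x = 0)"
      using irreducible_UNIV that(1,2) unfolding irreducible_set_def by blast
    then show ?thesis by (auto simp: fun_eq_iff)
  qed
  moreover have "c = 0" if "(\<lambda>x::real^'n. c) = (\<lambda>x. 0)" for c :: real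
    using fun_cong[OF that] by simp
  ultimately show ?thesis unfolding poly_prime_def by (simp add: real_polynomial_function.intros(2))
qed

lemma poly_prime_pullback:
  assumes "primeideal P (poly_fun_ring S)"
  shows "poly_prime {p. real_polynomial_function p \<and> restrict p S \<in> P}"
proof -
  let ?R = "poly_fun_ring S"
  interpret primeideal P ?R by fact
  have add: "restrict (\<lambda>x. p x + q x) S = restrict p S \<oplus>\<^bsub>?R\<^esub> restrict q S"
    and mult: "restrict (\<lambda>x. p x * q x) S = restrict p S \<otimes>\<^bsub>?R\<^esub> restrict q S" for p q
    by (auto simp: poly_fun_ring_simps fun_eq_iff)
  have carr: "restrict p S \<in> carrier ?R" if "real_polynomial_function p" for p
    using that by (auto simp: poly_fun_ring_simps)
  have const: "c = 0" if "restrict (\<lambda>x. c) S \<in> P" for c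
  proof (rule ccontr)
    assume "c \<noteq> 0"
    then have "\<one>\<^bsub>?R\<^esub> = restrict (\<lambda>x. c) S \<otimes>\<^bsub>?R\<^esub> restrict (\<lambda>x. 1 / c) S"
      by (auto simp: poly_fun_ring_simps fun_eq_iff)
    then have "\<one>\<^bsub>?R\<^esub> \<in> P" using I_r_closed[OF that carr[OF real_polynomial_function.intros(2)[of "1 / c"]]] by simp
    then show False using one_imp_carrier I_notcarr by blast
  qed
  define J where "J = {p. real_polynomial_function p \<and> restrict p S \<in> P}"
  have "(\<lambda>x. f x + g x) \<in> J" if "f \<in> J" "g \<in> J" for f g
    using that a_closed[of "restrict f S" "restrict g S"] by (auto simp: J_def add)
  moreover have "(\<lambda>x. f x * g x) \<in> J" if "f \<in> J" "real_polynomial_function g" for f g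
    using that I_r_closed[OF _ carr, of "restrict f S" g] by (auto simp: J_def mult)
  moreover have "f \<in> J \<or> g \<in> J"
    if "real_polynomial_function f" "real_polynomial_function g" "(\<lambda>x. f x * g x) \<in> J" for f g
    using I_prime[OF carr carr, of f g] that by (simp add: J_def mult)
  moreover have "c = 0" if "(\<lambda>x. c) \<in> J" for c using that const by (simp add: J_def)
  moreover have "J \<subseteq> Collect real_polynomial_function" by (auto simp: J_def)
  ultimately show ?thesis unfolding poly_prime_def J_def[symmetric]
    by (intro conjI ballI allI impI) auto
qed

text \<open>A chain of primes in the ring of functions on \<open>S\<close> pulls back to a chain of primes that contain \<open>q\<close>,
  and the zero ideal can be put below it. A chain longer than claimed would thus produce more
  independent polynomials than there are coordinates.\<close>

theorem semialg_dim_le_of_vanishing: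
  fixes S :: "(real^'n) set"
  assumes q: "real_polynomial_function q" "\<exists>x. q x \<noteq> 0" "\<And>x. x \<in> S \<Longrightarrow> q x = 0" and n: "CARD('n) = Suc n"
  shows "semialg_dim S \<le> enat n"
  unfolding semialg_dim_def krull_dim_def
proof (rule Sup_least, clarify)
  let ?R = "poly_fun_ring S"
  fix m P assume P: "\<forall>i\<le>m. primeideal (P i) ?R" "\<forall>i<m. P i \<subset> P (Suc i)"
  show "enat m \<le> enat n"
  proof (rule ccontr)
    assume "\<not> enat m \<le> enat n"
    then have m: "Suc n \<le> m" by simp
    define J where "J i = {p. real_polynomial_function p \<and> restrict p S \<in> P i}" for i
    \<comment> \<open>the zero ideal is prime, and \<open>q\<close> is the step from it to \<open>J 0\<close>\<close>
    define K where "K i = (case i of 0 \<Rightarrow> {\<lambda>x. 0} | Suc j \<Rightarrow> J j)" for i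
    have prime: "poly_prime (J i)" if "i \<le> m" for i unfolding J_def using P(1) that by (intro poly_prime_pullback) auto
    have "\<exists>f. f \<in> J (Suc i) - J i" if "i < m" for i
    proof -
      obtain g where g: "g \<in> P (Suc i)" "g \<notin> P i" using P(2) \<open>i < m\<close> by blast
      interpret primeideal "P (Suc i)" ?R using P(1) that by auto
      have "g \<in> carrier ?R" using g(1) by (rule a_Hcarr)
      then show ?thesis using g by (auto simp: J_def poly_fun_ring_simps)
    qed
    then obtain f where f: "\<And>i. i < m \<Longrightarrow> f i \<in> J (Suc i) - J i" by metis
    have zero: "restrict (\<lambda>x. 0) S \<in> P 0"
    proof -
      interpret primeideal "P 0" ?R using P(1) by auto
      have "\<zero>\<^bsub>?R\<^esub> \<in> P 0" by (rule additive_subgroup.zero_closed[OF is_additive_subgroup])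
      then show ?thesis by (simp add: poly_fun_ring_simps)
    qed
    define fs where "fs = q # map f [0..<Suc n]"
    have len: "length fs = Suc (Suc n)" by (simp add: fs_def)
    have mem: "fs ! i \<in> K (Suc i) - K i" if "i < Suc (Suc n)" for i
    proof (cases i)
      case 0
      have "restrict q S = restrict (\<lambda>x. 0) S" using q(3) by (auto simp: fun_eq_iff)
      then have "restrict q S \<in> P 0" using zero by simp
      then show ?thesis using q(1,2) 0 by (auto simp: fs_def K_def J_def)
    next
      case (Suc j)
      then have "fs ! i = f j" using that by (simp add: fs_def nth_append del: upt_Suc)
      then show ?thesis using f[of j] Suc that m by (auto simp: K_def)
    qed
    have primeK: "poly_prime (K i)" if "i \<le> Suc (Suc n)" for i
      using prime poly_prime_zero that m by (cases i) (auto simp: K_def)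
    have rfs: "\<forall>g\<in>set fs. real_polynomial_function g"
    proof
      fix g assume "g \<in> set fs"
      then obtain i where "i < Suc (Suc n)" "g = fs ! i" by (metis in_set_conv_nth len)
      then show "real_polynomial_function g" using mem[of i] by (auto simp: K_def J_def)
    qed
    obtain N c where c: "\<exists>es\<in>exponents (length fs) N. c es \<noteq> 0"
      "\<forall>x. (\<Sum>es\<in>exponents (length fs) N. c es * monomial fs es x) = 0"
      using algebraically_dependent[OF rfs] n len by auto
    have "c es = 0" if "es \<in> exponents (length fs) N" for es
    proof (rule prime_chain_independent[of fs K])
      show "(\<lambda>x. \<Sum>es\<in>exponents (length fs) N. c es * monomial fs es x) \<in> K 0"
        using c(2) by (simp add: K_def)
      show "K i \<subseteq> K (Suc i)" if "i < length fs" for i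
      proof (cases i)
        case 0
        then show ?thesis using zero by (auto simp: K_def J_def)
      next
        case (Suc j)
        then have "P j \<subseteq> P (Suc j)" using P(2)[rule_format, of j] that m len by auto
        then show ?thesis using Suc by (auto simp: K_def J_def)
      qed
      show "poly_prime (K i)" if "i \<le> length fs" for i using primeK[of i] that len by simp
      show "fs ! i \<in> K (Suc i) - K i" if "i < length fs" for i using mem[of i] that len by simp
    qed (fact that)
    with c(1) show False by blast
  qed
qed


section \<open>The ring of integers and its fundamental unit\<close>

text \<open>Elements of the field are real numbers, and \<open>cj\<close> is the second real embedding.\<close>

locale real_quadratic =
  fixes k :: int
  assumes k_gt_1: "k > 1" and squarefree_k: "squarefree k"
begin

abbreviation R where "R \<equiv> quad_int k"
abbreviation cj where "cj \<equiv> qconj k"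
abbreviation \<omega> where "\<omega> \<equiv> omega k"
text \<open>The algebraic conjugate of \<open>\<omega>\<close>, written out so that the simplifier does not have to treat it as a
  value of the description operator behind \<open>cj\<close>.\<close>

definition \<omega>' :: real where "\<omega>' = (1 - sqrt (of_int k)) / k0 k"

lemma sqrt_irrational: "sqrt (of_int k) \<notin> \<rat>"
proof
  assume "sqrt (of_int k) \<in> \<rat>"
  then obtain a b :: nat where b: "b \<noteq> 0" and eq: "\<bar>sqrt (of_int k)\<bar> = real a / real b" and co: "coprime a b"
    by (rule Rats_abs_nat_div_natE)
  have "of_int k = (real a / real b)\<^sup>2" using k_gt_1 eq[symmetric] by simp
  then have "real_of_int (k * (int b)\<^sup>2) = real_of_int ((int a)\<^sup>2)" using b by (simp add: field_simps power2_eq_square)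
  then have "k * (int b)\<^sup>2 = (int a)\<^sup>2" by (simp only: of_int_eq_iff)
  moreover from this have "(int b)\<^sup>2 dvd (int a)\<^sup>2" by (metis dvd_triv_right)
  then have "b dvd a" by (simp add: pow_divides_pow_iff)
  then have "b = 1" using co by (metis coprime_common_divisor_nat dvd_refl nat_dvd_1_iff_1 coprime_absorb_right is_unit_gcd)
  ultimately have k: "k = (int a)\<^sup>2" by simp
  then have "int a dvd 1" using squarefree_k unfolding squarefree_def by (metis dvd_refl)
  then show False using k k_gt_1 by simp
qed

lemma sqrt_coeffs_eq:
  assumes "a \<in> \<rat>" "b \<in> \<rat>" "c \<in> \<rat>" "d \<in> \<rat>" "a + b * sqrt (of_int k) = c + d * sqrt (of_int k)"
  shows "a = c \<and> b = d"
proof -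
  have "b = d"
  proof (rule ccontr)
    assume "b \<noteq> d"
    then have "sqrt (of_int k) = (c - a) / (b - d)" using assms(5) by (simp add: field_simps)
    then show False using sqrt_irrational assms(1-4) by (metis Rats_diff Rats_divide)
  qed
  with assms(5) show ?thesis by simp
qed

lemma cj_eq:
  assumes "a \<in> \<rat>" "b \<in> \<rat>"
  shows "cj (a + b * sqrt (of_int k)) = a - b * sqrt (of_int k)"
  unfolding qconj_def
proof (rule the_equality)
  show "\<exists>a'\<in>\<rat>. \<exists>b'\<in>\<rat>. a + b * sqrt (of_int k) = a' + b' * sqrt (of_int k) \<and>
     a - b * sqrt (of_int k) = a' - b' * sqrt (of_int k)" using assms by blast
  fix \<beta> assume "\<exists>a'\<in>\<rat>. \<exists>b'\<in>\<rat>. a + b * sqrt (of_int k) = a' + b' * sqrt (of_int k) \<and>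
     \<beta> = a' - b' * sqrt (of_int k)"
  then show "\<beta> = a - b * sqrt (of_int k)" using sqrt_coeffs_eq assms by metis
qed

lemma k0_rat: "k0 k \<in> \<rat>" "k0 k \<noteq> 0" "k0 k > 0"
  by (auto simp: k0_def)

lemma omega_eq: "\<omega> = 1 / k0 k + 1 / k0 k * sqrt (of_int k)"
  by (simp add: omega_def add_divide_distrib)

lemma cj_lincomb: "cj (of_int m + of_int n * \<omega>) = of_int m + of_int n * \<omega>'"
proof -
  have "of_int m + of_int n * \<omega> = (of_int m + of_int n / k0 k) + (of_int n / k0 k) * sqrt (of_int k)"
    by (simp add: omega_eq algebra_simps)
  also have "cj \<dots> = (of_int m + of_int n / k0 k) - (of_int n / k0 k) * sqrt (of_int k)"
    by (rule cj_eq) (auto simp: k0_rat)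
  finally show ?thesis by (simp add: \<omega>'_def diff_divide_distrib algebra_simps)
qed

lemma cj_omega [simp]: "cj \<omega> = \<omega>'"
  using cj_lincomb[of 0 1] by simp

lemma omega_diff_pos: "\<omega> - \<omega>' > 0"
  using k0_rat(3) k_gt_1 by (simp add: omega_def \<omega>'_def divide_strict_right_mono)

lemma omega_quadratic:
  obtains t q :: int where "\<omega> * \<omega> = of_int t * \<omega> + of_int q" "\<omega>' = of_int t - \<omega>" "\<omega> * \<omega>' = - of_int q"
proof (cases "k mod 4 = 1")
  case True
  then have "k = 4 * (k div 4) + 1" by presburger
  then have k: "real_of_int k = 4 * of_int (k div 4) + 1" by linarith
  have s: "sqrt (of_int k) * sqrt (of_int k) = 4 * of_int (k div 4) + 1" using k k_gt_1 by simp
  show ?thesis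
    by (rule that[of 1 "k div 4"]) (use True s in \<open>auto simp: omega_def \<omega>'_def k0_def field_simps\<close>)
next
  case False
  have s: "sqrt (of_int k) * sqrt (of_int k) = of_int k" using k_gt_1 by simp
  show ?thesis
    by (rule that[of 2 "k - 1"]) (use False s in \<open>auto simp: omega_def \<omega>'_def k0_def algebra_simps\<close>)
qed

lemma R_lincomb: "of_int m + of_int n * \<omega> \<in> R"
  unfolding quad_int_def by (rule range_eqI[of _ _ "[:m, n:]"]) (simp add: map_poly_pCons)

lemma R_E:
  assumes "x \<in> R" obtains m n :: int where "x = of_int m + of_int n * \<omega>" "cj x = of_int m + of_int n * \<omega>'"
proof -
  obtain t q :: int where tq: "\<omega> * \<omega> = of_int t * \<omega> + of_int q" by (rule omega_quadratic)
  have "\<exists>m n :: int. poly (map_poly of_int p) \<omega> = of_int m + of_int n * \<omega>" for p :: "int poly"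
  proof (induction p)
    case 0
    then show ?case by (intro exI[of _ 0]) simp
  next
    case (pCons a p)
    then obtain m n :: int where mn: "poly (map_poly of_int p) \<omega> = of_int m + of_int n * \<omega>" by blast
    have "poly (map_poly of_int (pCons a p)) \<omega> = of_int a + \<omega> * (of_int m + of_int n * \<omega>)"
      using mn by (simp add: map_poly_pCons)
    also have "\<dots> = of_int a + of_int m * \<omega> + of_int n * (\<omega> * \<omega>)" by (simp add: algebra_simps)
    also have "\<dots> = of_int (a + n * q) + of_int (m + n * t) * \<omega>" unfolding tq by (simp add: algebra_simps)
    finally show ?case by blast
  qed
  then obtain m n :: int where "x = of_int m + of_int n * \<omega>" using assms unfolding quad_int_def by blast
  then show ?thesis using that cj_lincomb by blast
qed

lemma R_of_int [simp]: "of_int m \<in> R" and cj_of_int [simp]: "cj (of_int m) = of_int m"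
  using R_lincomb[of m 0] cj_lincomb[of m 0] by simp_all

lemma R_0 [simp]: "0 \<in> R" and R_1 [simp]: "1 \<in> R" and cj_0 [simp]: "cj 0 = 0" and cj_1 [simp]: "cj 1 = 1"
  using R_of_int[of 0] R_of_int[of 1] cj_of_int[of 0] cj_of_int[of 1] by simp_all

lemma R_add: "x \<in> R \<Longrightarrow> y \<in> R \<Longrightarrow> x + y \<in> R" and cj_add: "x \<in> R \<Longrightarrow> y \<in> R \<Longrightarrow> cj (x + y) = cj x + cj y"
proof -
  assume "x \<in> R" "y \<in> R"
  then obtain m n m' n' :: int where x: "x = of_int m + of_int n * \<omega>" "cj x = of_int m + of_int n * \<omega>'"
    and y: "y = of_int m' + of_int n' * \<omega>" "cj y = of_int m' + of_int n' * \<omega>'" by (metis R_E)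
  have "x + y = of_int (m + m') + of_int (n + n') * \<omega>" by (simp add: x y algebra_simps)
  then show "x + y \<in> R" "cj (x + y) = cj x + cj y"
    using R_lincomb[of "m + m'" "n + n'"] cj_lincomb[of "m + m'" "n + n'"] by (simp_all add: x(2) y(2) algebra_simps)
qed

lemma R_mult: "x \<in> R \<Longrightarrow> y \<in> R \<Longrightarrow> x * y \<in> R" and cj_mult: "x \<in> R \<Longrightarrow> y \<in> R \<Longrightarrow> cj (x * y) = cj x * cj y"
proof -
  assume "x \<in> R" "y \<in> R"
  then obtain m n m' n' :: int where x: "x = of_int m + of_int n * \<omega>" "cj x = of_int m + of_int n * \<omega>'"
    and y: "y = of_int m' + of_int n' * \<omega>" "cj y = of_int m' + of_int n' * \<omega>'" by (metis R_E)
  obtain t q :: int where tq: "\<omega> * \<omega> = of_int t * \<omega> + of_int q" "\<omega>' = of_int t - \<omega>" by (rule omega_quadratic)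
  have tq': "\<omega>' * \<omega>' = of_int t * \<omega>' + of_int q" unfolding tq(2) using tq(1) by (simp add: algebra_simps)
  let ?m = "m * m' + n * n' * q" and ?n = "m * n' + n * m' + n * n' * t"
  have "x * y = of_int m * of_int m' + (of_int m * of_int n' + of_int n * of_int m') * \<omega> + of_int n * of_int n' * (\<omega> * \<omega>)"
    by (simp add: x algebra_simps y)
  then have xy: "x * y = of_int ?m + of_int ?n * \<omega>" unfolding tq(1) by (simp add: algebra_simps)
  have "cj x * cj y = of_int m * of_int m' + (of_int m * of_int n' + of_int n * of_int m') * \<omega>' + of_int n * of_int n' * (\<omega>' * \<omega>')"
    unfolding x(2) y(2) by (simp add: algebra_simps)
  then have "cj x * cj y = of_int ?m + of_int ?n * \<omega>'" unfolding tq' by (simp add: algebra_simps)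
  then show "x * y \<in> R" "cj (x * y) = cj x * cj y" unfolding xy cj_lincomb by (simp_all only: R_lincomb)
qed

lemma R_minus: "x \<in> R \<Longrightarrow> - x \<in> R" and cj_minus: "x \<in> R \<Longrightarrow> cj (- x) = - cj x"
  using R_mult[of "-1" x] cj_mult[of "-1" x] R_of_int[of "-1"] cj_of_int[of "-1"] by simp_all

lemma R_diff: "x \<in> R \<Longrightarrow> y \<in> R \<Longrightarrow> x - y \<in> R" and cj_diff: "x \<in> R \<Longrightarrow> y \<in> R \<Longrightarrow> cj (x - y) = cj x - cj y"
  using R_add[of x "-y"] cj_add[of x "-y"] by (simp_all add: R_minus cj_minus)

lemma lincomb_eq_0:
  assumes "of_int m + of_int n * \<omega> = 0 \<or> of_int m + of_int n * \<omega>' = 0" shows "m = 0 \<and> n = 0"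
proof -
  have "of_int n * \<omega> = of_int n / k0 k + of_int n / k0 k * sqrt (of_int k)"
    "of_int n * \<omega>' = of_int n / k0 k + - of_int n / k0 k * sqrt (of_int k)"
    by (simp_all add: omega_def \<omega>'_def algebra_simps diff_divide_distrib add_divide_distrib)
  then consider "(of_int m + of_int n / k0 k) + of_int n / k0 k * sqrt (of_int k) = 0 + 0 * sqrt (of_int k)" |
    "(of_int m + of_int n / k0 k) + - of_int n / k0 k * sqrt (of_int k) = 0 + 0 * sqrt (of_int k)"
    using assms by auto
  then have "of_int m + of_int n / k0 k = 0 \<and> of_int n / k0 k = 0"
  proof cases
    case 1
    then show ?thesis by (intro sqrt_coeffs_eq) (auto simp: k0_rat)
  next
    case 2
    have "of_int m + of_int n / k0 k = 0 \<and> - of_int n / k0 k = 0"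
      by (intro sqrt_coeffs_eq[OF _ _ _ _ 2]) (auto simp: k0_rat)
    then show ?thesis by simp
  qed
  moreover from this have "n = 0" using k0_rat(2) by simp
  ultimately show ?thesis by simp
qed

lemma cj_eq_0_iff [simp]: "x \<in> R \<Longrightarrow> cj x = 0 \<longleftrightarrow> x = 0"
proof
  assume "x \<in> R" "cj x = 0"
  then obtain m n :: int where "x = of_int m + of_int n * \<omega>" "of_int m + of_int n * \<omega>' = 0" by (metis R_E)
  then show "x = 0" using lincomb_eq_0[of m n] by simp
qed simp

text \<open>The norm is a rational integer.\<close>

lemma norm_ge_1:
  assumes "x \<in> R" "x \<noteq> 0" shows "\<bar>x * cj x\<bar> \<ge> 1"
proof -
  from assms(1) obtain m n :: int where x: "x = of_int m + of_int n * \<omega>" "cj x = of_int m + of_int n * \<omega>'" by (rule R_E)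
  obtain t q :: int where tq: "\<omega>' = of_int t - \<omega>" "\<omega> * \<omega>' = - of_int q" by (rule omega_quadratic)
  have "x * cj x = of_int m * of_int m + of_int m * of_int n * (\<omega> + \<omega>') + of_int n * of_int n * (\<omega> * \<omega>')"
    unfolding x(2) unfolding x(1) by (simp add: algebra_simps)
  also have "\<dots> = of_int (m * m + m * n * t - n * n * q)" unfolding tq(2) by (simp add: tq(1) algebra_simps)
  finally have eq: "x * cj x = of_int (m * m + m * n * t - n * n * q)" .
  moreover have "x * cj x \<noteq> 0" using assms by simp
  ultimately have "m * m + m * n * t - n * n * q \<noteq> 0" by (metis of_int_0)
  then have "1 \<le> \<bar>m * m + m * n * t - n * n * q\<bar>" by linarith
  then show ?thesis unfolding eq by (metis of_int_1_le_iff of_int_abs)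
qed

text \<open>The two embeddings together make \<open>R\<close> a lattice in the plane.\<close>

lemma finite_bounded_R: "finite {x \<in> R. \<bar>x\<bar> \<le> M \<and> \<bar>cj x\<bar> \<le> M}"
proof -
  define B where "B = 2 * \<bar>M\<bar> / (\<omega> - \<omega>')"
  define C where "C = \<bar>M\<bar> + B * \<bar>\<omega>\<bar>"
  have "{x \<in> R. \<bar>x\<bar> \<le> M \<and> \<bar>cj x\<bar> \<le> M} \<subseteq> (\<lambda>(m, n). of_int m + of_int n * \<omega>) ` ({-\<lceil>C\<rceil>..\<lceil>C\<rceil>} \<times> {-\<lceil>B\<rceil>..\<lceil>B\<rceil>})"
  proof clarify
    fix x assume x: "x \<in> R" "\<bar>x\<bar> \<le> M" "\<bar>cj x\<bar> \<le> M"
    then obtain m n :: int where mn: "x = of_int m + of_int n * \<omega>" "cj x = of_int m + of_int n * \<omega>'" by (metis R_E)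
    have "of_int n * (\<omega> - \<omega>') = x - cj x" unfolding mn(2) unfolding mn(1) by (simp add: algebra_simps)
    then have "\<bar>of_int n\<bar> * (\<omega> - \<omega>') = \<bar>x - cj x\<bar>" using omega_diff_pos by (metis abs_mult abs_of_pos)
    also have "\<dots> \<le> 2 * \<bar>M\<bar>" using x by linarith
    finally have n: "\<bar>of_int n\<bar> \<le> B" using omega_diff_pos by (simp add: B_def field_simps)
    have "\<bar>of_int m\<bar> = \<bar>x - of_int n * \<omega>\<bar>" unfolding mn by simp
    also have "\<dots> \<le> \<bar>x\<bar> + \<bar>of_int n\<bar> * \<bar>\<omega>\<bar>" by (metis abs_triangle_ineq4 abs_mult)
    also have "\<dots> \<le> C" unfolding C_def using x n by (intro add_mono mult_right_mono) auto
    finally have m: "\<bar>of_int m\<bar> \<le> C" .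
    have "m \<in> {-\<lceil>C\<rceil>..\<lceil>C\<rceil>}" "n \<in> {-\<lceil>B\<rceil>..\<lceil>B\<rceil>}" using m n by (auto simp: abs_le_iff) linarith+
    then show "x \<in> (\<lambda>(m, n). of_int m + of_int n * \<omega>) ` ({-\<lceil>C\<rceil>..\<lceil>C\<rceil>} \<times> {-\<lceil>B\<rceil>..\<lceil>B\<rceil>})"
      unfolding mn(1) by auto
  qed
  then show ?thesis by (rule finite_subset) simp
qed

lemma unit_norm:
  assumes "u \<in> quad_units k" shows "\<bar>u * cj u\<bar> = 1"
proof -
  from assms obtain v where uv: "u \<in> R" "v \<in> R" "u * v = 1" by (auto simp: quad_units_def)
  have "cj u * cj v = 1" using cj_mult[OF uv(1,2)] uv(3) by simp
  then have "(u * cj u) * (v * cj v) = (u * v) * 1" by (metis mult.assoc mult.left_commute)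
  then have "\<bar>u * cj u\<bar> * \<bar>v * cj v\<bar> = 1" using uv(3) by (metis abs_mult abs_one mult_1)
  moreover have "u \<noteq> 0" "v \<noteq> 0" using uv by auto
  then have "\<bar>u * cj u\<bar> \<ge> 1" "\<bar>v * cj v\<bar> \<ge> 1" using norm_ge_1 uv by auto
  ultimately show ?thesis by (smt (verit) mult_le_cancel_left1)
qed

lemma R_sqrt: "sqrt (of_int k) \<in> R"
proof (cases "k mod 4 = 1")
  case True
  then have "sqrt (of_int k) = 2 * \<omega> - 1" by (simp add: omega_def k0_def field_simps)
  then show ?thesis using R_lincomb[of "-1" 2] by simp
next
  case False
  then have "sqrt (of_int k) = \<omega> - 1" by (simp add: omega_def k0_def)
  then show ?thesis using R_lincomb[of "-1" 1] by simp
qed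

text \<open>For finitely many pairs the errors would have a positive minimum, which Dirichlet's theorem
  undercuts.\<close>

lemma infinite_good_approximations:
  "infinite {(h, j). 0 < (j::int) \<and> \<bar>of_int j * sqrt (of_int k) - of_int (h::int)\<bar> < 1 / of_int j}" (is "infinite ?A")
proof
  assume fin: "finite ?A"
  define D where "D = insert 1 ((\<lambda>(h, j). \<bar>of_int j * sqrt (of_int k) - of_int h\<bar>) ` ?A)"
  have pos: "\<bar>of_int j * sqrt (of_int k) - of_int h\<bar> > 0" if "j > 0" for h j :: int
  proof -
    have "of_int j * sqrt (of_int k) \<noteq> of_int h"
    proof
      assume "of_int j * sqrt (of_int k) = of_int h"
      then have "sqrt (of_int k) = of_int h / of_int j" using that by (simp add: field_simps)
      then show False using sqrt_irrational by simp
    qed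
    then show ?thesis by simp
  qed
  have "finite D" "D \<noteq> {}" using fin by (auto simp: D_def)
  then have "Min D > 0" using pos by (subst Min_gr_iff) (auto simp: D_def)
  then obtain N where N: "0 < N" "1 / real N < Min D" using real_arch_inverse[of "Min D"] by (auto simp: inverse_eq_divide)
  obtain h j :: int where hj: "0 < j" "j \<le> int N" "\<bar>of_int j * sqrt (of_int k) - of_int h\<bar> < 1 / N"
    by (rule Dirichlet_approx[OF N(1), of "sqrt (of_int k)"])
  have "real_of_int j \<le> real N" using hj(2) by linarith
  then have "1 / real N \<le> 1 / of_int j" using hj(1) by (intro divide_left_mono) auto
  then have "(h, j) \<in> ?A" using hj by auto
  then have "\<bar>of_int j * sqrt (of_int k) - of_int h\<bar> \<in> D" by (auto simp: D_def)
  then have "Min D \<le> \<bar>of_int j * sqrt (of_int k) - of_int h\<bar>" using \<open>finite D\<close> by simp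
  then show False using hj(3) N(2) by linarith
qed

text \<open>Good approximations \<open>(h, j)\<close> make \<open>h\<^sup>2 - k j\<^sup>2\<close> bounded, so by the pigeonhole principle two of them have the same
  value \<open>n\<close> and agree modulo \<open>n\<close>. Then \<open>(h + j \<surd>k) (h' - j' \<surd>k) / n\<close> has integral coefficients and norm one.\<close>

lemma pell_solution: "\<exists>a b :: int. a * a - k * (b * b) = 1 \<and> b \<noteq> 0"
proof -
  define A where "A = {(h, j). 0 < (j::int) \<and> \<bar>of_int j * sqrt (of_int k) - of_int (h::int)\<bar> < 1 / of_int j}"
  define nm where "nm = (\<lambda>(h, j). h * h - k * (j * j))"
  \<comment> \<open>pairs with the same value of \<open>f\<close> have the same norm and are congruent modulo that norm\<close>
  define f where "f p = (nm p, fst p mod nm p, snd p mod nm p)" for p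
  define C where "C = 2 * sqrt (of_int k) + 1"
  have sk: "sqrt (of_int k) > 0" "sqrt (of_int k) * sqrt (of_int k) = of_int k" using k_gt_1 by auto
  have bound: "\<bar>nm p\<bar> \<le> \<lceil>C\<rceil>" and nz: "nm p \<noteq> 0" if pA: "p \<in> A" for p
  proof -
    obtain h j where p: "p = (h, j)" "0 < j" "\<bar>of_int j * sqrt (of_int k) - of_int h\<bar> < 1 / of_int j"
    proof -
      obtain h j where p: "p = (h, j)" by fastforce
      show ?thesis by (rule that[of h j]) (use pA in \<open>simp_all add: p A_def\<close>)
    qed
    let ?d = "of_int j * sqrt (of_int k) - of_int h"
    have eq: "real_of_int (nm p) = - ?d * (2 * of_int j * sqrt (of_int k) - ?d)"
      using sk(2) by (simp add: nm_def p(1) algebra_simps)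
    have "1 / real_of_int j \<le> 1" using p(2) by simp
    then have "\<bar>2 * of_int j * sqrt (of_int k) - ?d\<bar> \<le> 2 * of_int j * sqrt (of_int k) + 1"
      using p(2,3) sk(1) by (smt (verit) mult_nonneg_nonneg of_int_pos)
    also have "\<dots> \<le> of_int j * C"
      using p(2) by (simp add: C_def algebra_simps)
    finally have "\<bar>real_of_int (nm p)\<bar> \<le> (1 / of_int j) * (of_int j * C)"
      unfolding eq abs_mult abs_minus_cancel using p(2,3) by (intro mult_mono) auto
    then have "\<bar>real_of_int (nm p)\<bar> \<le> C" using p(2) by simp
    then show "\<bar>nm p\<bar> \<le> \<lceil>C\<rceil>" by linarith
    show "nm p \<noteq> 0"
    proof
      assume "nm p = 0"
      then have "(real_of_int h)\<^sup>2 = (of_int j * sqrt (of_int k))\<^sup>2"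
        using sk(2) by (simp add: nm_def p(1) power2_eq_square power_mult_distrib algebra_simps)
          (metis of_int_mult)
      then have "\<bar>real_of_int h\<bar> = \<bar>of_int j * sqrt (of_int k)\<bar>" by (metis real_sqrt_abs)
      then have "\<bar>real_of_int h\<bar> = of_int j * sqrt (of_int k)" using p(2) sk(1) by simp
      then have "sqrt (of_int k) = \<bar>of_int h\<bar> / of_int j" using p(2) by (simp add: field_simps)
      then show False using sqrt_irrational by simp
    qed
  qed
  have "f ` A \<subseteq> {-\<lceil>C\<rceil>..\<lceil>C\<rceil>} \<times> {-\<lceil>C\<rceil>..\<lceil>C\<rceil>} \<times> {-\<lceil>C\<rceil>..\<lceil>C\<rceil>}"
  proof (rule image_subsetI)
    fix p assume p: "p \<in> A"
    have "\<bar>x mod nm p\<bar> \<le> \<lceil>C\<rceil>" for x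
      using abs_mod_less[OF nz[OF p], of x] bound[OF p] by linarith
    then show "f p \<in> {-\<lceil>C\<rceil>..\<lceil>C\<rceil>} \<times> {-\<lceil>C\<rceil>..\<lceil>C\<rceil>} \<times> {-\<lceil>C\<rceil>..\<lceil>C\<rceil>}"
      using bound[OF p] unfolding f_def mem_Times_iff atLeastAtMost_iff fst_conv snd_conv abs_le_iff
      by (simp add: minus_le_iff)
  qed
  then have "finite (f ` A)" by (rule finite_subset) simp
  then obtain p where p: "p \<in> A" "infinite {q \<in> A. f q = f p}"
    using pigeonhole_infinite[of A f] infinite_good_approximations unfolding A_def by blast
  then have "\<not> {q \<in> A. f q = f p} \<subseteq> {p}" by (meson finite.emptyI finite_insert finite_subset)
  then obtain q where q: "q \<in> A" "f q = f p" "q \<noteq> p" by blast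
  obtain h j h' j' where pq: "p = (h, j)" "q = (h', j')" by fastforce
  define n where "n = nm p"
  have j: "j > 0" "j' > 0" using p(1) q(1) by (auto simp: A_def pq)
  have n: "n \<noteq> 0" "h * h - k * (j * j) = n" "h' * h' - k * (j' * j') = n" and
    cong: "h' mod n = h mod n" "j' mod n = j mod n"
    using nz[OF p(1)] q(2) by (auto simp: n_def f_def nm_def pq)
  obtain s t where st: "h' = h + n * s" "j' = j + n * t"
    using cong by (metis mod_eqE mult.commute add.commute diff_add_cancel add_diff_cancel_left' minus_diff_eq)
  \<comment> \<open>\<open>a\<close> and \<open>b\<close> are the coefficients of \<open>(h + j \<surd>k) (h' - j' \<surd>k) / n\<close>\<close>
  define a where "a = 1 + h * s - k * (j * t)"
  define b where "b = j * s - h * t"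
  have na: "n * a = h * h' - k * (j * j')" using n(2) by (simp add: a_def st algebra_simps)
  have nb: "n * b = j * h' - h * j'" by (simp add: b_def st algebra_simps)
  have "(n * a) * (n * a) - k * ((n * b) * (n * b)) = (h * h - k * (j * j)) * (h' * h' - k * (j' * j'))"
    unfolding na nb by (simp add: algebra_simps)
  then have "n * n * (a * a - k * (b * b)) = n * n * 1" unfolding n by (simp add: algebra_simps)
  then have "a * a - k * (b * b) = 1" using n(1) by simp
  moreover have "b \<noteq> 0"
  proof
    assume "b = 0"
    then have e: "j * h' = h * j'" using nb by simp
    have "n * (j' * j') = (h * j') * (h * j') - k * (j * j) * (j' * j')" unfolding n(2)[symmetric] by (simp add: algebra_simps)
    also have "\<dots> = j * j * (h' * h' - k * (j' * j'))" unfolding e[symmetric] by (simp add: algebra_simps)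
    finally have "n * (j' * j') = n * (j * j)" unfolding n(3) by (simp add: mult_ac)
    then have "j' * j' = j * j" using n(1) by simp
    then have "j' = j" using j by (simp add: square_eq_iff)
    then show False using e j q(3) pq by simp
  qed
  ultimately show ?thesis by blast
qed

lemma units_gt_1_nonempty: "\<exists>u. u \<in> quad_units k \<and> u > 1"
proof -
  obtain a b :: int where ab: "a * a - k * (b * b) = 1" "b \<noteq> 0" using pell_solution by blast
  obtain r where r: "r = sqrt (of_int k)" "r * r = of_int k" "r > 1" using k_gt_1 by auto
  let ?u = "of_int \<bar>a\<bar> + of_int \<bar>b\<bar> * r" and ?v = "of_int \<bar>a\<bar> - of_int \<bar>b\<bar> * r"
  have "?u \<in> R" "?v \<in> R" unfolding r(1) by (auto intro!: R_add R_diff R_mult R_sqrt simp del: of_int_abs)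
  moreover have "?u * ?v = of_int (\<bar>a\<bar> * \<bar>a\<bar>) - of_int (\<bar>b\<bar> * \<bar>b\<bar>) * (r * r)"
    by (simp add: algebra_simps del: of_int_abs)
  then have "?u * ?v = of_int (a * a - k * (b * b))" unfolding r(2) by (simp del: of_int_abs)
  then have "?u * ?v = 1" using ab(1) by simp
  ultimately have "?u \<in> quad_units k" unfolding quad_units_def by blast
  moreover have b1: "real_of_int \<bar>b\<bar> \<ge> 1" using ab(2) by linarith
  then have "1 < real_of_int \<bar>b\<bar> * r" using r(3) by (smt (verit) mult_le_cancel_right1)
  then have "?u > 1" by (smt (verit) of_int_nonneg abs_ge_zero)
  ultimately show ?thesis by blast
qed

text \<open>The units between \<open>1\<close> and a given unit \<open>u0\<close> have conjugates of absolute value at most \<open>1\<close>, so there are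
  finitely many of them and the least one exists.\<close>

lemma eps0: "eps0 k \<in> quad_units k" "eps0 k > 1" "\<And>u. u \<in> quad_units k \<Longrightarrow> u > 1 \<Longrightarrow> eps0 k \<le> u"
proof -
  obtain u0 where u0: "u0 \<in> quad_units k" "u0 > 1" using units_gt_1_nonempty by blast
  define B where "B = {u \<in> quad_units k. 1 < u \<and> u \<le> u0}"
  have "B \<subseteq> {x \<in> R. \<bar>x\<bar> \<le> u0 \<and> \<bar>cj x\<bar> \<le> u0}"
  proof
    fix u assume u: "u \<in> B"
    then have "u * \<bar>cj u\<bar> = 1" using unit_norm[of u] by (auto simp: B_def abs_mult)
    moreover have "u > 1" using u by (auto simp: B_def)
    ultimately have "\<bar>cj u\<bar> \<le> 1" by (smt (verit) mult_le_cancel_right1)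
    then show "u \<in> {x \<in> R. \<bar>x\<bar> \<le> u0 \<and> \<bar>cj x\<bar> \<le> u0}" using u u0 by (auto simp: B_def quad_units_def)
  qed
  then have fin: "finite B" using finite_bounded_R finite_subset by blast
  have "u0 \<in> B" using u0 by (simp add: B_def)
  then have minB: "Min B \<in> B" "\<And>u. u \<in> B \<Longrightarrow> Min B \<le> u" using fin Min_in by auto
  have least: "Min B \<le> u" if "u \<in> quad_units k" "u > 1" for u
    using minB that by (cases "u \<le> u0") (auto simp: B_def)
  have "eps0 k = Min B" unfolding eps0_def
    by (rule Least_equality) (use minB(1) least in \<open>auto simp: B_def\<close>)
  then show "eps0 k \<in> quad_units k" "eps0 k > 1" "\<And>u. u \<in> quad_units k \<Longrightarrow> u > 1 \<Longrightarrow> eps0 k \<le> u"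
    using minB(1) least by (auto simp: B_def)
qed

end


section \<open>The action on a product of two half planes\<close>

text \<open>The square of the modulus of the denominator of a Moebius transformation, one of the two factors of
  \<open>cusp_norm\<close>.\<close>

definition nsq :: "real \<Rightarrow> real \<Rightarrow> complex \<Rightarrow> real" where
  "nsq c d z = (c * Re z + d)\<^sup>2 + c\<^sup>2 * (Im z)\<^sup>2"

definition mat22 :: "real \<Rightarrow> real \<Rightarrow> real \<Rightarrow> real \<Rightarrow> real^2^2" where
  "mat22 a b c d = vector [vector [a, b], vector [c, d]]"

definition adj22 :: "real^2^2 \<Rightarrow> real^2^2" where
  "adj22 A = mat22 (A $ 2 $ 2) (- A $ 1 $ 2) (- A $ 2 $ 1) (A $ 1 $ 1)"

lemma mat22_nth [simp]:
  "mat22 a b c d $ 1 $ 1 = a" "mat22 a b c d $ 1 $ 2 = b" "mat22 a b c d $ 2 $ 1 = c" "mat22 a b c d $ 2 $ 2 = d"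
  by (simp_all add: mat22_def)

lemma mult22_nth: "(A ** B) $ i $ j = A $ i $ 1 * B $ 1 $ j + A $ i $ 2 * B $ 2 $ j" for A B :: "real^2^2"
  by (simp add: matrix_matrix_mult_def sum_2)

lemma matrix22_eqI:
  fixes A B :: "real^2^2"
  assumes "A $ 1 $ 1 = B $ 1 $ 1" "A $ 1 $ 2 = B $ 1 $ 2" "A $ 2 $ 1 = B $ 2 $ 1" "A $ 2 $ 2 = B $ 2 $ 2"
  shows "A = B"
  using assms by (simp add: vec_eq_iff forall_2)

lemma adj22_mult: assumes "det A = 1" shows "A ** adj22 A = mat 1" "adj22 A ** A = mat 1"
  using assms by (auto intro!: matrix22_eqI simp: mult22_nth adj22_def mat_def det_2 algebra_simps)

lemma det_adj22: "det (adj22 A) = det A"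
  by (simp add: adj22_def det_2 algebra_simps)

lemma nsq_eq_norm: "nsq c d z = (cmod (of_real c * z + of_real d))\<^sup>2"
  by (simp add: nsq_def cmod_power2 power_mult_distrib)

lemma nsq_nonneg: "nsq c d z \<ge> 0"
  by (simp add: nsq_def)

lemma nsq_pos: "Im z > 0 \<Longrightarrow> c \<noteq> 0 \<or> d \<noteq> 0 \<Longrightarrow> nsq c d z > 0"
  by (cases "c = 0") (auto simp: nsq_def intro: add_nonneg_pos)

lemma det1_row: "det A = 1 \<Longrightarrow> A $ 2 $ 1 \<noteq> 0 \<or> A $ 2 $ 2 \<noteq> 0" for A :: "real^2^2"
  by (auto simp: det_2)

lemma moebius_denom:
  fixes A :: "real^2^2"
  assumes "Im z > 0" "det A = 1"
  shows "of_real (A $ 2 $ 1) * z + of_real (A $ 2 $ 2) \<noteq> 0"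
  using nsq_pos[OF assms(1) det1_row[OF assms(2)]] by (auto simp: nsq_eq_norm)

lemma Im_moebius:
  assumes "Im z > 0" "det A = 1"
  shows "Im (moebius A z) = Im z / nsq (A $ 2 $ 1) (A $ 2 $ 2) z"
proof -
  have "Im (moebius A z) = (A $ 1 $ 1 * A $ 2 $ 2 - A $ 1 $ 2 * A $ 2 $ 1) * Im z / nsq (A $ 2 $ 1) (A $ 2 $ 2) z"
    by (simp add: moebius_def Im_divide nsq_def power_mult_distrib algebra_simps)
  then show ?thesis using assms(2) by (simp add: det_2)
qed

lemma Im_moebius_pos: "Im z > 0 \<Longrightarrow> det A = 1 \<Longrightarrow> Im (moebius A z) > 0"
  using Im_moebius[of z A] nsq_pos[OF _ det1_row, of z A] by simp

lemma moebius_mult: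
  assumes "Im z > 0" "det B = 1" "det A = 1"
  shows "moebius (A ** B) z = moebius A (moebius B z)"
proof -
  let ?n = "of_real (B $ 1 $ 1) * z + of_real (B $ 1 $ 2)" and ?d = "of_real (B $ 2 $ 1) * z + of_real (B $ 2 $ 2)"
  have d: "?d \<noteq> 0" using moebius_denom assms by blast
  have "moebius A (?n / ?d) = (of_real (A $ 1 $ 1) * (?n / ?d) + of_real (A $ 1 $ 2)) * ?d / ((of_real (A $ 2 $ 1) * (?n / ?d) + of_real (A $ 2 $ 2)) * ?d)"
    using d by (simp add: moebius_def)
  also have "\<dots> = (of_real (A $ 1 $ 1) * ?n + of_real (A $ 1 $ 2) * ?d) / (of_real (A $ 2 $ 1) * ?n + of_real (A $ 2 $ 2) * ?d)"
    using d by (simp add: distrib_right)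
  also have "\<dots> = moebius (A ** B) z"
    by (simp add: moebius_def mult22_nth algebra_simps)
  finally show ?thesis by (simp add: moebius_def)
qed

text \<open>The cocycle property of the denominators.\<close>

lemma nsq_moebius:
  assumes "Im z > 0" "det A = 1"
  shows "nsq c d (moebius A z) * nsq (A $ 2 $ 1) (A $ 2 $ 2) z = nsq (c * A $ 1 $ 1 + d * A $ 2 $ 1) (c * A $ 1 $ 2 + d * A $ 2 $ 2) z"
proof -
  let ?n = "of_real (A $ 1 $ 1) * z + of_real (A $ 1 $ 2)" and ?d = "of_real (A $ 2 $ 1) * z + of_real (A $ 2 $ 2)"
  have d: "?d \<noteq> 0" using moebius_denom assms by blast
  have "(of_real c * (?n / ?d) + of_real d) * ?d = of_real c * ?n + of_real d * ?d"
    using d by (simp add: distrib_right)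
  also have "\<dots> = of_real (c * A $ 1 $ 1 + d * A $ 2 $ 1) * z + of_real (c * A $ 1 $ 2 + d * A $ 2 $ 2)"
    by (simp add: algebra_simps)
  finally show ?thesis
    unfolding nsq_eq_norm moebius_def power_mult_distrib[symmetric] norm_mult[symmetric] by (rule arg_cong)
qed

lemma norm_moebius:
  assumes "Im z > 0" "det A = 1"
  shows "(cmod (moebius A z))\<^sup>2 * nsq (A $ 2 $ 1) (A $ 2 $ 2) z = nsq (A $ 1 $ 1) (A $ 1 $ 2) z"
  using nsq_moebius[OF assms, of 1 0] by (simp add: nsq_eq_norm)

lemma moebius_one [simp]: "moebius (mat 1) z = z"
  by (simp add: moebius_def mat_def)

lemma moebius_minus [simp]: "moebius (- A) z = moebius A z"
proof -
  have "of_real ((- A) $ i $ 1) * z + of_real ((- A) $ i $ 2) = - (of_real (A $ i $ 1) * z + of_real (A $ i $ 2))" for i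
    by simp
  then show ?thesis unfolding moebius_def by (simp only: minus_divide_divide)
qed

lemma continuous_on_moebius:
  assumes "det A = 1" shows "continuous_on {z. Im z > 0} (moebius A)"
  unfolding moebius_def
  by (intro continuous_intros) (use moebius_denom[OF _ assms] in auto)

context real_quadratic
begin

abbreviation SL where "SL \<equiv> carrier (SL2 k)"
abbreviation X where "X \<equiv> upper_half_plane \<times> upper_half_plane"
abbreviation act where "act \<equiv> SL2_act k"
abbreviation cm where "cm \<equiv> conj_matrix k"

definition height :: "complex \<times> complex \<Rightarrow> real" where
  "height Z = Im (fst Z) * Im (snd Z)"

lemma SL_iff: "A \<in> SL \<longleftrightarrow> (\<forall>i j. A $ i $ j \<in> R) \<and> det A = 1"
  by (simp add: SL2_def)

lemma SL_entry: "A \<in> SL \<Longrightarrow> A $ i $ j \<in> R" and SL_det: "A \<in> SL \<Longrightarrow> det A = 1"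
  by (simp_all add: SL_iff)

lemma SL_det': "A \<in> SL \<Longrightarrow> A $ 1 $ 1 * A $ 2 $ 2 - A $ 1 $ 2 * A $ 2 $ 1 = 1"
  using SL_det[of A] by (simp add: det_2)

lemma mat22_SL: "mat22 a b c d \<in> SL \<longleftrightarrow> a \<in> R \<and> b \<in> R \<and> c \<in> R \<and> d \<in> R \<and> a * d - b * c = 1"
  by (auto simp: SL_iff forall_2 det_2)

lemma mult_SL: "A \<in> SL \<Longrightarrow> B \<in> SL \<Longrightarrow> A ** B \<in> SL"
  by (auto simp: SL_iff mult22_nth det_mul intro!: R_add R_mult)

lemma adj_SL: "A \<in> SL \<Longrightarrow> adj22 A \<in> SL"
  using det_adj22[of A] by (auto simp: SL_iff forall_2 adj22_def R_minus)

lemma one_SL: "mat 1 \<in> SL"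
  by (auto simp: SL_iff mat_def det_I[unfolded mat_def])

lemma minus_SL: "A \<in> SL \<Longrightarrow> - A \<in> SL"
  by (auto simp: SL_iff det_2 R_minus)

lemma cm_nth [simp]: "cm A $ i $ j = cj (A $ i $ j)"
  by (simp add: conj_matrix_def)

lemma cm_mult: "A \<in> SL \<Longrightarrow> B \<in> SL \<Longrightarrow> cm (A ** B) = cm A ** cm B"
  by (simp add: vec_eq_iff mult22_nth SL_entry cj_add cj_mult R_mult)

lemma det_cm: assumes "A \<in> SL" shows "det (cm A) = 1"
proof -
  have "cj (A $ 1 $ 1 * A $ 2 $ 2 - A $ 1 $ 2 * A $ 2 $ 1) = 1" using SL_det'[OF assms] by simp
  then show ?thesis using assms by (simp add: det_2 SL_entry cj_diff cj_mult R_mult)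
qed

lemma cm_one: "cm (mat 1) = mat 1"
  by (simp add: vec_eq_iff mat_def)

lemma cm_minus: "A \<in> SL \<Longrightarrow> cm (- A) = - cm A"
  by (simp add: vec_eq_iff cj_minus SL_entry)

lemma in_X: "Z \<in> X \<longleftrightarrow> Im (fst Z) > 0 \<and> Im (snd Z) > 0"
  by (cases Z) (simp add: upper_half_plane_def)

lemma act_fst: "fst (act A Z) = moebius A (fst Z)" and act_snd: "snd (act A Z) = moebius (cm A) (snd Z)"
  by (simp_all add: SL2_act_def split_def)

lemma act_X: "A \<in> SL \<Longrightarrow> Z \<in> X \<Longrightarrow> act A Z \<in> X"
  unfolding in_X act_fst act_snd by (simp add: Im_moebius_pos SL_det det_cm)

lemma act_mult: "A \<in> SL \<Longrightarrow> B \<in> SL \<Longrightarrow> Z \<in> X \<Longrightarrow> act (A ** B) Z = act A (act B Z)"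
  unfolding in_X by (intro prod_eqI) (simp_all add: act_fst act_snd cm_mult moebius_mult SL_det det_cm)

lemma act_one: "act (mat 1) Z = Z"
  by (intro prod_eqI) (simp_all add: act_fst act_snd cm_one)

lemma act_minus: "A \<in> SL \<Longrightarrow> act (- A) Z = act A Z"
  by (intro prod_eqI) (simp_all add: act_fst act_snd cm_minus)

lemma act_adj: "A \<in> SL \<Longrightarrow> Z \<in> X \<Longrightarrow> act (adj22 A) (act A Z) = Z" "A \<in> SL \<Longrightarrow> Z \<in> X \<Longrightarrow> act A (act (adj22 A) Z) = Z"
  using adj22_mult[of A] by (simp_all add: act_mult[symmetric] adj_SL SL_det act_one)

lemma continuous_on_act: "A \<in> SL \<Longrightarrow> continuous_on X (act A)"
  unfolding SL2_act_def split_def upper_half_plane_def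
  by (intro continuous_on_Pair continuous_on_compose2[OF continuous_on_moebius] continuous_on_fst continuous_on_snd continuous_on_id)
     (auto simp: SL_det det_cm)

lemma homeomorphism_act: "A \<in> SL \<Longrightarrow> homeomorphism X X (act A) (act (adj22 A))"
  by (intro homeomorphismI image_subsetI) (simp_all only: act_adj act_X adj_SL continuous_on_act)

lemma cusp_norm_eq: "cusp_norm k c d Z = nsq c d (fst Z) * nsq (cj c) (cj d) (snd Z)"
  by (simp add: cusp_norm_def nsq_def split_def)

lemma cusp_norm_pos: "Z \<in> X \<Longrightarrow> A \<in> SL \<Longrightarrow> cusp_norm k (A $ 2 $ 1) (A $ 2 $ 2) Z > 0"
  unfolding cusp_norm_eq in_X using det1_row[OF SL_det] det1_row[OF det_cm]
  by (intro mult_pos_pos nsq_pos) auto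

lemma Im_act:
  assumes "A \<in> SL" "Z \<in> X"
  shows "Im (fst (act A Z)) = Im (fst Z) / nsq (A $ 2 $ 1) (A $ 2 $ 2) (fst Z)"
    and "Im (snd (act A Z)) = Im (snd Z) / nsq (cj (A $ 2 $ 1)) (cj (A $ 2 $ 2)) (snd Z)"
  using assms Im_moebius[of "fst Z" A] Im_moebius[of "snd Z" "cm A"]
  unfolding in_X act_fst act_snd by (simp_all add: SL_det det_cm)

lemma height_act: "A \<in> SL \<Longrightarrow> Z \<in> X \<Longrightarrow> height (act A Z) = height Z / cusp_norm k (A $ 2 $ 1) (A $ 2 $ 2) Z"
  by (simp add: height_def Im_act cusp_norm_eq)

lemma height_pos: "Z \<in> X \<Longrightarrow> height Z > 0"
  by (simp add: height_def in_X)

lemma unimodular_pairs_iff: "(c, d) \<in> unimodular_pairs k \<longleftrightarrow> (\<exists>A\<in>SL. A $ 2 $ 1 = c \<and> A $ 2 $ 2 = d)"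
proof
  assume "(c, d) \<in> unimodular_pairs k"
  then have cd: "c \<in> R" "d \<in> R" "{c * u + d * v | u v. u \<in> R \<and> v \<in> R} = R"
    by (simp_all add: unimodular_pairs_def)
  have "1 \<in> {c * u + d * v | u v. u \<in> R \<and> v \<in> R}" unfolding cd(3) by simp
  then obtain u v where uv: "u \<in> R" "v \<in> R" "1 = c * u + d * v" by blast
  then have "mat22 v (- u) c d \<in> SL" using cd by (simp add: mat22_SL R_minus algebra_simps)
  then show "\<exists>A\<in>SL. A $ 2 $ 1 = c \<and> A $ 2 $ 2 = d" by (intro bexI) auto
next
  assume "\<exists>A\<in>SL. A $ 2 $ 1 = c \<and> A $ 2 $ 2 = d"
  then obtain A where A: "A \<in> SL" "A $ 2 $ 1 = c" "A $ 2 $ 2 = d" by auto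
  then have cd: "c \<in> R" "d \<in> R" using SL_entry by auto
  have "{c * u + d * v | u v. u \<in> R \<and> v \<in> R} = R"
  proof (intro equalityI subsetI)
    fix x assume x: "x \<in> R"
    have "x = x * (A $ 1 $ 1 * d - A $ 1 $ 2 * c)" using SL_det'[OF A(1)] A(2,3) by simp
    then have "x = c * (- (A $ 1 $ 2 * x)) + d * (A $ 1 $ 1 * x)" by (simp add: algebra_simps)
    moreover have "- (A $ 1 $ 2 * x) \<in> R" "A $ 1 $ 1 * x \<in> R" using A x by (auto intro!: R_minus R_mult SL_entry)
    ultimately show "x \<in> {c * u + d * v | u v. u \<in> R \<and> v \<in> R}" by blast
  next
    fix x assume "x \<in> {c * u + d * v | u v. u \<in> R \<and> v \<in> R}"
    then obtain u v where "u \<in> R" "v \<in> R" "x = c * u + d * v" by blast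
    then show "x \<in> R" using cd by (simp add: R_add R_mult)
  qed
  then show "(c, d) \<in> unimodular_pairs k" using cd by (simp add: unimodular_pairs_def)
qed

text \<open>Unimodular pairs are the lower rows of the matrices in \<open>SL\<^sub>2(R)\<close>, and the height is divided by the norm
  of the lower row. Thus \<open>F_zero\<close> consists of the highest points of the orbits, and norms no longer
  have to be mentioned.\<close>

lemma F_zero_iff: "Z \<in> F_zero k \<longleftrightarrow> Z \<in> X \<and> (\<forall>A\<in>SL. height (act A Z) \<le> height Z)"
proof (cases "Z \<in> X")
  case True
  have "height (act A Z) \<le> height Z \<longleftrightarrow> cusp_norm k (A $ 2 $ 1) (A $ 2 $ 2) Z \<ge> 1" if "A \<in> SL" for A
    unfolding height_act[OF that True] using cusp_norm_pos[OF True that] height_pos[OF True] by (simp add: divide_le_eq)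
  moreover have "Z \<in> F_zero k \<longleftrightarrow> (\<forall>c d. (c, d) \<in> unimodular_pairs k \<longrightarrow> cusp_norm k c d Z \<ge> 1)"
    using True unfolding F_zero_def mem_Collect_eq Ball_def split_paired_All prod.case by simp
  moreover have "\<dots> \<longleftrightarrow> (\<forall>A\<in>SL. cusp_norm k (A $ 2 $ 1) (A $ 2 $ 2) Z \<ge> 1)"
    unfolding unimodular_pairs_iff by fast
  ultimately show ?thesis using True by simp
next
  case False
  then have "Z \<notin> F_zero k" unfolding F_zero_def by simp
  with False show ?thesis by simp
qed

lemma open_X: "open X" and convex_X: "convex X"
proof -
  have "open upper_half_plane" "convex upper_half_plane"
    unfolding upper_half_plane_def by (rule open_halfspace_Im_gt, rule convex_halfspace_Im_gt)
  then show "open X" "convex X" by (simp_all add: open_Times convex_Times)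
qed

end


section \<open>The translates of the fundamental domain cover the space\<close>

lemma abs_le_of_square_le:
  fixes x :: real
  assumes "x\<^sup>2 \<le> K" shows "\<bar>x\<bar> \<le> K + 1"
proof -
  have "0 \<le> (\<bar>x\<bar> - 1)\<^sup>2" by simp
  then have "2 * \<bar>x\<bar> \<le> x\<^sup>2 + 1" by (simp add: power2_diff)
  then show ?thesis using assms by linarith
qed

lemma nsq_bound_c:
  assumes "M \<ge> 1" "1 / M \<le> Im z" "nsq c d z \<le> K"
  shows "\<bar>c\<bar> \<le> (K + 1) * M"
proof -
  have "(c * (1 / M))\<^sup>2 \<le> c\<^sup>2 * (Im z)\<^sup>2"
    unfolding power_mult_distrib using assms by (intro mult_left_mono power_mono) auto
  also have "\<dots> \<le> K" using assms(3) zero_le_power2[of "c * Re z + d"] unfolding nsq_def by linarith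
  finally have "\<bar>c * (1 / M)\<bar> \<le> K + 1" by (rule abs_le_of_square_le)
  then show ?thesis using assms(1) by (simp add: abs_mult field_simps)
qed

lemma nsq_bound_d:
  assumes "M \<ge> 1" "\<bar>Re z\<bar> \<le> M" "1 / M \<le> Im z" "nsq c d z \<le> K"
  shows "\<bar>d\<bar> \<le> (K + 1) * (1 + M * M)"
proof -
  have K: "K \<ge> 0" using assms(4) nsq_nonneg[of c d z] by linarith
  have "(c * Re z + d)\<^sup>2 \<le> nsq c d z" by (simp add: nsq_def)
  then have 1: "\<bar>c * Re z + d\<bar> \<le> K + 1" using assms(4) by (intro abs_le_of_square_le) linarith
  have "\<bar>c * Re z\<bar> \<le> (K + 1) * M * M"
    unfolding abs_mult using nsq_bound_c[OF assms(1,3,4)] assms(1,2) K by (intro mult_mono) auto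
  then show ?thesis using 1 by (simp add: algebra_simps)
qed

context real_quadratic
begin

abbreviation F where "F \<equiv> F_dom k"
abbreviation \<epsilon> where "\<epsilon> \<equiv> eps0 k"

definition s2_coord :: "complex \<times> complex \<Rightarrow> real" where
  "s2_coord Z = (Re (fst Z) - Re (snd Z)) / (\<omega> - \<omega>')"
definition s1_coord :: "complex \<times> complex \<Rightarrow> real" where
  "s1_coord Z = Re (fst Z) - s2_coord Z * \<omega>"
definition ratio :: "complex \<times> complex \<Rightarrow> real" where
  "ratio Z = Im (fst Z) / Im (snd Z)"

lemma s_coords: "Re (fst Z) = s1_coord Z + s2_coord Z * \<omega>" "Re (snd Z) = s1_coord Z + s2_coord Z * \<omega>'"
proof -
  have "s2_coord Z * (\<omega> - \<omega>') = Re (fst Z) - Re (snd Z)"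
    using omega_diff_pos by (simp add: s2_coord_def)
  then show "Re (fst Z) = s1_coord Z + s2_coord Z * \<omega>" "Re (snd Z) = s1_coord Z + s2_coord Z * \<omega>'"
    by (simp_all add: s1_coord_def algebra_simps)
qed

lemma s_coords_unique:
  assumes "Re (fst Z) = s1 + s2 * \<omega>" "Re (snd Z) = s1 + s2 * \<omega>'"
  shows "s1_coord Z = s1" "s2_coord Z = s2"
proof -
  have "s2_coord Z = (s2 * (\<omega> - \<omega>')) / (\<omega> - \<omega>')"
    unfolding s2_coord_def assms by (simp add: algebra_simps)
  then show "s2_coord Z = s2" using omega_diff_pos by simp
  then show "s1_coord Z = s1" by (simp add: s1_coord_def assms)
qed

lemma eps_gt_1: "\<epsilon> > 1" by (rule eps0(2))

text \<open>The fundamental unit multiplies the ratio by \<open>\<epsilon> ^ 4\<close>, which is the quotient of the two bounds.\<close>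

definition reduced_ratio :: "complex \<times> complex \<Rightarrow> bool" where
  "reduced_ratio Z \<longleftrightarrow> 1 / \<epsilon>\<^sup>2 \<le> ratio Z \<and> ratio Z \<le> \<epsilon>\<^sup>2"

lemma F_iff: "Z \<in> F \<longleftrightarrow> Z \<in> X \<and> \<bar>s1_coord Z\<bar> \<le> 1/2 \<and> \<bar>s2_coord Z\<bar> \<le> 1/2 \<and> reduced_ratio Z \<and> (\<forall>A\<in>SL. height (act A Z) \<le> height Z)"
proof -
  have "Z \<in> F_infty k \<longleftrightarrow> Z \<in> X \<and> \<bar>s1_coord Z\<bar> \<le> 1/2 \<and> \<bar>s2_coord Z\<bar> \<le> 1/2 \<and> reduced_ratio Z"
  proof -
    have "(\<exists>s1 s2. Re (fst Z) = s1 + s2 * \<omega> \<and> Re (snd Z) = s1 + s2 * cj \<omega> \<and> \<bar>s1\<bar> \<le> 1/2 \<and> \<bar>s2\<bar> \<le> 1/2)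
      \<longleftrightarrow> \<bar>s1_coord Z\<bar> \<le> 1/2 \<and> \<bar>s2_coord Z\<bar> \<le> 1/2"
      using s_coords[of Z] s_coords_unique[of Z] unfolding cj_omega by metis
    then show ?thesis unfolding F_infty_def reduced_ratio_def ratio_def by (simp add: split_def conj_assoc mem_Times_iff)
  qed
  then show ?thesis unfolding F_dom_def using F_zero_iff[of Z] by auto
qed

lemma F_sub_X: "F \<subseteq> X" using F_iff by blast

text \<open>A row with \<open>c \<noteq> 0\<close> has norm at least \<open>(N c * height Z)\<^sup>2\<close>, and a row with \<open>c = 0\<close> has norm \<open>(N d)\<^sup>2\<close>, where \<open>N\<close>
  denotes the norm of the field.\<close>

lemma high_point:
  assumes Z: "Z \<in> X" "height Z \<ge> 1" and A: "A \<in> SL" shows "height (act A Z) \<le> height Z"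
proof -
  let ?c = "A $ 2 $ 1" and ?d = "A $ 2 $ 2"
  have cd: "?c \<in> R" "?d \<in> R" "?c \<noteq> 0 \<or> ?d \<noteq> 0" using A det1_row SL_det by (auto simp: SL_entry)
  have "1 \<le> cusp_norm k ?c ?d Z"
  proof (cases "?c = 0")
    case True
    then have "\<bar>?d * cj ?d\<bar> \<ge> 1" using norm_ge_1 cd by auto
    then have "1 \<le> \<bar>?d * cj ?d\<bar>\<^sup>2" by (rule one_le_power)
    then show ?thesis using True by (simp add: cusp_norm_eq nsq_def power_mult_distrib)
  next
    case False
    then have "\<bar>?c * cj ?c\<bar> \<ge> 1" using norm_ge_1 cd by auto
    then have "1 * 1 \<le> \<bar>?c * cj ?c\<bar> * height Z" using Z(2) by (intro mult_mono) auto
    then have "1 \<le> (\<bar>?c * cj ?c\<bar> * height Z)\<^sup>2" by simp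
    also have "\<dots> = (?c\<^sup>2 * (Im (fst Z))\<^sup>2) * ((cj ?c)\<^sup>2 * (Im (snd Z))\<^sup>2)"
      by (simp add: height_def power_mult_distrib mult_ac)
    also have "\<dots> \<le> cusp_norm k ?c ?d Z" unfolding cusp_norm_eq nsq_def by (intro mult_mono) auto
    finally show ?thesis .
  qed
  then show ?thesis unfolding height_act[OF A Z(1)]
    using height_pos[OF Z(1)] by (simp add: divide_le_eq)
qed

lemma continuous_coords:
  "continuous_on X s1_coord" "continuous_on X s2_coord" "continuous_on X ratio" "continuous_on X height"
  unfolding s1_coord_def[abs_def] s2_coord_def[abs_def] ratio_def[abs_def] height_def[abs_def]
  using omega_diff_pos by (intro continuous_intros; force simp: upper_half_plane_def)+

lemma continuous_on_height_act: "A \<in> SL \<Longrightarrow> continuous_on X (\<lambda>Z. height (act A Z))"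
  using continuous_on_compose2[OF continuous_coords(4) continuous_on_act] act_X by blast

lemma closedin_le:
  fixes f g :: "'a::topological_space \<Rightarrow> real"
  assumes "continuous_on S f" "continuous_on S g"
  shows "closedin (top_of_set S) {x \<in> S. f x \<le> g x}"
proof -
  have "{x \<in> S. f x \<le> g x} = S \<inter> (\<lambda>x. g x - f x) -` {0..}" by auto
  then show ?thesis using assms by (auto intro!: continuous_closedin_preimage continuous_intros)
qed

lemma closedin_F: "closedin (top_of_set X) F"
proof -
  have "F = {Z \<in> X. \<bar>s1_coord Z\<bar> \<le> 1/2} \<inter> {Z \<in> X. \<bar>s2_coord Z\<bar> \<le> 1/2} \<inter> {Z \<in> X. 1 / \<epsilon>\<^sup>2 \<le> ratio Z} \<inter>
      {Z \<in> X. ratio Z \<le> \<epsilon>\<^sup>2} \<inter> (\<Inter>A\<in>SL. {Z \<in> X. height (act A Z) \<le> height Z})" (is "_ = ?F")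
    using one_SL by (auto simp: F_iff reduced_ratio_def)
  moreover have "closedin (top_of_set X) ?F"
    using one_SL by (intro closedin_Int closedin_INT closedin_le continuous_intros continuous_coords continuous_on_height_act) auto
  ultimately show ?thesis by simp
qed

text \<open>Strict inequalities for \<open>s\<^sub>1\<close>, \<open>s\<^sub>2\<close> and the ratio, and a height above \<open>1\<close>, define an open subset of \<open>F\<close>.\<close>

lemma interior_F: "interior F \<noteq> {}"
proof -
  define f where "f Z = (s1_coord Z, s2_coord Z, ratio Z, height Z)" for Z
  define B :: "(real \<times> real \<times> real \<times> real) set" where "B = {-1/2<..<1/2} \<times> {-1/2<..<1/2} \<times> {1 / \<epsilon>\<^sup>2<..<\<epsilon>\<^sup>2} \<times> {1<..}"
  have "continuous_on X f" unfolding f_def by (intro continuous_on_Pair continuous_coords)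
  then have op: "open (X \<inter> f -` B)" by (rule continuous_open_preimage) (auto simp: open_X B_def intro!: open_Times)
  have "X \<inter> f -` B \<subseteq> F"
  proof
    fix Z assume Z: "Z \<in> X \<inter> f -` B"
    then have "height Z \<ge> 1" by (auto simp: f_def B_def)
    then show "Z \<in> F" using Z high_point by (auto simp: F_iff f_def B_def reduced_ratio_def)
  qed
  then have "X \<inter> f -` B \<subseteq> interior F" using op by (rule interior_maximal)
  moreover have "(2 * \<i>, 2 * \<i>) \<in> X \<inter> f -` B"
    using eps_gt_1 by (simp add: in_X f_def B_def s1_coord_def s2_coord_def ratio_def height_def)
  ultimately show ?thesis by blast
qed

lemma ratio_act:
  assumes "A \<in> SL" "Z \<in> X"
  shows "ratio (act A Z) = ratio Z * (nsq (cj (A $ 2 $ 1)) (cj (A $ 2 $ 2)) (snd Z) / nsq (A $ 2 $ 1) (A $ 2 $ 2) (fst Z))"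
  by (simp add: ratio_def Im_act[OF assms])

text \<open>A diagonal entry \<open>d\<close> is a unit, so \<open>d\<^sup>2\<close> and the square of its conjugate are inverse to each other: the
  height stays the same and the ratio changes by a fourth power.\<close>

lemma triangular_act:
  assumes A: "A \<in> SL" "A $ 2 $ 1 = 0" and Z: "Z \<in> X"
  shows "height (act A Z) = height Z" "ratio (act A Z) = ratio Z / (A $ 2 $ 2) ^ 4"
    "A $ 1 $ 1 \<in> quad_units k" "A $ 2 $ 2 \<in> quad_units k" "A $ 1 $ 1 * A $ 2 $ 2 = 1"
proof -
  let ?a = "A $ 1 $ 1" and ?d = "A $ 2 $ 2"
  show ad: "?a * ?d = 1" using SL_det'[OF A(1)] A(2) by simp
  then show un: "?a \<in> quad_units k" "?d \<in> quad_units k"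
    using SL_entry[OF A(1)] unfolding quad_units_def by (auto intro: bexI[of _ ?a] bexI[of _ ?d] simp: mult.commute)
  have "(?d * cj ?d)\<^sup>2 = 1" using unit_norm[OF un(2)] by (metis power2_abs one_power2)
  then have d: "?d\<^sup>2 * (cj ?d)\<^sup>2 = 1" by (simp add: power_mult_distrib)
  then show "height (act A Z) = height Z" using A Z by (simp add: height_act cusp_norm_eq nsq_def)
  have nz: "?d \<noteq> 0" using ad by auto
  have "(cj ?d)\<^sup>2 = 1 / ?d\<^sup>2" using d nz by (simp add: field_simps)
  then show "ratio (act A Z) = ratio Z / ?d ^ 4"
    using nz A Z by (simp add: ratio_act nsq_def power_mult[symmetric] flip: power_add)
qed

lemma ratio_pos: "Z \<in> X \<Longrightarrow> ratio Z > 0"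
  by (simp add: in_X ratio_def)

text \<open>Induction on \<open>n\<close>, where \<open>\<epsilon> ^ (4 * n + 2)\<close> bounds the ratio and its inverse: the diagonal matrix of the
  fundamental unit, or its inverse, lowers \<open>n\<close> by one.\<close>

lemma reduce_ratio:
  assumes Z: "Z \<in> X"
  shows "\<exists>A\<in>SL. height (act A Z) = height Z \<and> reduced_ratio (act A Z)"
proof -
  obtain v where v: "v \<in> R" "\<epsilon> * v = 1" and eR: "\<epsilon> \<in> R" using eps0(1) by (auto simp: quad_units_def)
  have vv: "v = 1 / \<epsilon>" using v eps_gt_1 by (simp add: field_simps)
  let ?U = "mat22 \<epsilon> 0 0 v" and ?D = "mat22 v 0 0 \<epsilon>"
  have UD: "?U \<in> SL" "?D \<in> SL" using v eR by (auto simp: mat22_SL mult.commute)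
  have *: "\<exists>A\<in>SL. height (act A Z) = height Z \<and> reduced_ratio (act A Z)"
    if "Z \<in> X" "1 / \<epsilon> ^ (4 * n + 2) \<le> ratio Z" "ratio Z \<le> \<epsilon> ^ (4 * n + 2)" for n Z
    using that
  proof (induction n arbitrary: Z)
    case 0
    then show ?case using one_SL by (intro bexI[of _ "mat 1"]) (auto simp: act_one reduced_ratio_def power2_eq_square)
  next
    case (Suc n)
    have lift: ?case if lA: "A \<in> SL" "A $ 2 $ 1 = 0" "1 / \<epsilon> ^ (4 * n + 2) \<le> ratio (act A Z)" "ratio (act A Z) \<le> \<epsilon> ^ (4 * n + 2)" for A
    proof -
      obtain B where "B \<in> SL" "height (act B (act A Z)) = height (act A Z)" "reduced_ratio (act B (act A Z))"
        using Suc.IH[OF act_X[OF lA(1) Suc.prems(1)] lA(3,4)] by blast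
      then show ?thesis using triangular_act(1)[OF lA(1,2) Suc.prems(1)] lA(1) Suc.prems(1)
        by (intro bexI[of _ "B ** A"]) (simp_all add: act_mult mult_SL)
    qed
    define p where "p = \<epsilon> ^ (4 * n + 2)"
    define q where "q = \<epsilon> ^ 4"
    have "\<epsilon> ^ (4 * Suc n + 2) = p * q" unfolding p_def q_def power_add[symmetric] by (rule arg_cong[of _ _ "(^) \<epsilon>"]) simp
    then have prems: "1 / (p * q) \<le> ratio Z" "ratio Z \<le> p * q" using Suc.prems(2,3) by simp_all
    have big: "p * p \<ge> q"
      unfolding p_def q_def power_add[symmetric] using eps_gt_1 by (intro power_increasing) auto
    have pos: "p > 0" "q > 0" using eps_gt_1 by (simp_all add: p_def q_def)
    consider "ratio Z > p" | "ratio Z < 1 / p" | "1 / \<epsilon> ^ (4 * n + 2) \<le> ratio Z" "ratio Z \<le> \<epsilon> ^ (4 * n + 2)"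
      unfolding p_def by linarith
    then show ?case
    proof cases
      case 1
      have r: "ratio (act ?D Z) = ratio Z / q" using triangular_act(2)[OF UD(2) _ Suc.prems(1)] by (simp add: q_def)
      have "1 / p \<le> p / q" using big pos by (simp add: field_simps)
      also have "\<dots> \<le> ratio Z / q" using 1 pos by (intro divide_right_mono) auto
      finally have "1 / p \<le> ratio (act ?D Z)" unfolding r .
      moreover have "ratio (act ?D Z) \<le> p" unfolding r using prems(2) pos by (simp add: divide_le_eq)
      ultimately show ?thesis by (intro lift[OF UD(2)]) (simp_all add: p_def)
    next
      case 2
      have r: "ratio (act ?U Z) = ratio Z * q" using triangular_act(2)[OF UD(1) _ Suc.prems(1)] by (simp add: vv power_divide q_def)
      have "ratio Z * q \<le> 1 / p * q" using 2 pos by (intro mult_right_mono) auto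
      also have "\<dots> \<le> p" using big pos by (simp add: field_simps)
      finally have "ratio (act ?U Z) \<le> p" unfolding r .
      moreover have "1 / p \<le> ratio (act ?U Z)" unfolding r using prems(1) pos by (simp add: divide_le_eq mult_ac)
      ultimately show ?thesis by (intro lift[OF UD(1)]) (simp_all add: p_def)
    next
      case 3
      then show ?thesis using Suc.IH[OF Suc.prems(1)] by blast
    qed
  qed
  obtain n where n: "max (ratio Z) (1 / ratio Z) < \<epsilon> ^ n" using real_arch_pow[OF eps_gt_1] by blast
  have "\<epsilon> ^ n \<le> \<epsilon> ^ (4 * n + 2)" using eps_gt_1 by (intro power_increasing) auto
  then have "ratio Z \<le> \<epsilon> ^ (4 * n + 2)" "1 / ratio Z \<le> \<epsilon> ^ (4 * n + 2)" using n by auto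
  moreover from this(2) have "1 / \<epsilon> ^ (4 * n + 2) \<le> ratio Z"
    using ratio_pos[OF Z] eps_gt_1 by (simp add: field_simps)
  ultimately show ?thesis using *[OF Z] by blast
qed

text \<open>These open sets exhaust \<open>X\<close> and have compact closure in \<open>X\<close>; they serve as the neighbourhoods in which
  finiteness is proved.\<close>

definition coord_box :: "real \<Rightarrow> (complex \<times> complex) set" where
  "coord_box M = {Z. \<bar>Re (fst Z)\<bar> < M \<and> \<bar>Re (snd Z)\<bar> < M \<and> 1 / M < Im (fst Z) \<and> Im (fst Z) < M \<and> 1 / M < Im (snd Z) \<and> Im (snd Z) < M}"

lemma open_coord_box: "open (coord_box M)"
  unfolding coord_box_def by (intro open_Collect_conj open_Collect_less continuous_intros)

lemma exists_coord_box:
  assumes "Z \<in> X" shows "\<exists>M\<ge>1. Z \<in> coord_box M"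
proof -
  let ?S = "{1, \<bar>Re (fst Z)\<bar>, \<bar>Re (snd Z)\<bar>, Im (fst Z), Im (snd Z), 1 / Im (fst Z), 1 / Im (snd Z)}"
  define M where "M = Max ?S + 1"
  have le: "x < M" if "x \<in> ?S" for x
    using Max_ge[of ?S x] that unfolding M_def by (smt (verit) finite.emptyI finite.insertI)
  have "1 < M" using le by blast
  moreover have "1 / M < y" if "1 / y \<in> ?S" "y > 0" for y
    using le[OF that(1)] that(2) \<open>1 < M\<close> by (simp add: field_simps)
  moreover have "\<bar>Re (fst Z)\<bar> < M" "\<bar>Re (snd Z)\<bar> < M" "Im (fst Z) < M" "Im (snd Z) < M" by (rule le; simp)+
  ultimately show ?thesis using assms unfolding in_X
    by (intro exI[of _ M]) (simp add: coord_box_def)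
qed

lemma coord_box_sub_X: "M \<ge> 1 \<Longrightarrow> coord_box M \<subseteq> X"
  unfolding coord_box_def by (auto simp: upper_half_plane_def intro: order.strict_trans[rotated])

definition row_bound :: "real \<Rightarrow> real" where
  "row_bound M = (\<epsilon>\<^sup>2 * M\<^sup>2 + 1) * (1 + M * M)"

text \<open>Let \<open>u\<close> and \<open>v\<close> be the two factors of the norm of the lower row. The height does not decrease, so
  \<open>u * v \<le> 1\<close>; the ratio after the action is \<open>(y\<^sub>1 / y\<^sub>2) * (v / u)\<close>, so \<open>v / u\<close> lies between positive bounds. Both factors
  are therefore bounded, and with them the row and its conjugate.\<close>

lemma row_bounds:
  assumes M: "M \<ge> 1" and W: "W \<in> coord_box M" and B: "B \<in> SL" and h: "height W \<le> height (act B W)" and r: "reduced_ratio (act B W)"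
  shows "nsq (B $ 2 $ 1) (B $ 2 $ 2) (fst W) \<le> \<epsilon>\<^sup>2 * M\<^sup>2" "nsq (cj (B $ 2 $ 1)) (cj (B $ 2 $ 2)) (snd W) \<le> \<epsilon>\<^sup>2 * M\<^sup>2"
    "\<bar>B $ 2 $ j\<bar> \<le> row_bound M" "\<bar>cj (B $ 2 $ j)\<bar> \<le> row_bound M"
proof -
  have WX: "W \<in> X" using coord_box_sub_X[OF M] W by blast
  define u where "u = nsq (B $ 2 $ 1) (B $ 2 $ 2) (fst W)"
  define v where "v = nsq (cj (B $ 2 $ 1)) (cj (B $ 2 $ 2)) (snd W)"
  define y1 where "y1 = Im (fst W)"
  define y2 where "y2 = Im (snd W)"
  have y: "y1 > 0" "y2 > 0" "y1 \<le> M" "y2 \<le> M" "1 / M \<le> y1" "1 / M \<le> y2" using W WX by (auto simp: coord_box_def in_X y1_def y2_def)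
  have uv: "u > 0" "v > 0"
    using det1_row[OF SL_det[OF B]] det1_row[OF det_cm[OF B]] WX unfolding u_def v_def in_X by (auto intro!: nsq_pos)
  have "u * v \<le> 1"
    using h cusp_norm_pos[OF WX B] height_pos[OF WX] unfolding height_act[OF B WX]
    by (simp add: le_divide_eq cusp_norm_eq u_def v_def)
  have r': "1 / \<epsilon>\<^sup>2 \<le> (y1 / y2) * (v / u)" "(y1 / y2) * (v / u) \<le> \<epsilon>\<^sup>2"
    using r unfolding reduced_ratio_def ratio_act[OF B WX] by (simp_all add: ratio_def u_def v_def y1_def y2_def)
  define K where "K = \<epsilon>\<^sup>2 * M\<^sup>2"
  have K1: "K \<ge> 1" unfolding K_def using M eps_gt_1 by (smt (verit) mult_le_cancel_left1 one_le_power zero_le_power2)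
  have yy: "y1 \<le> M\<^sup>2 * y2" "y2 \<le> M\<^sup>2 * y1"
  proof -
    have "M * 1 \<le> M * (M * y2)" "M * 1 \<le> M * (M * y1)" using y M by (intro mult_left_mono; simp add: field_simps)+
    then have "y1 \<le> M * (M * y2)" "y2 \<le> M * (M * y1)" using y by linarith+
    then show "y1 \<le> M\<^sup>2 * y2" "y2 \<le> M\<^sup>2 * y1" by (simp_all add: power2_eq_square mult.assoc)
  qed
  have e2: "\<epsilon>\<^sup>2 > 0" using eps_gt_1 by simp
  have "u * y2 \<le> \<epsilon>\<^sup>2 * (y1 * v)" using r'(1) uv y e2 by (simp add: field_simps)
  also have "\<dots> \<le> \<epsilon>\<^sup>2 * (M\<^sup>2 * y2 * v)" using yy(1) uv e2 by (intro mult_left_mono mult_right_mono) auto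
  finally have "u * y2 \<le> (K * v) * y2" by (simp add: K_def mult_ac)
  then have 1: "u \<le> K * v" using y by simp
  have "v * y1 \<le> \<epsilon>\<^sup>2 * (y2 * u)" using r'(2) uv y e2 by (simp add: field_simps)
  also have "\<dots> \<le> \<epsilon>\<^sup>2 * (M\<^sup>2 * y1 * u)" using yy(2) uv e2 by (intro mult_left_mono mult_right_mono) auto
  finally have "v * y1 \<le> (K * u) * y1" by (simp add: K_def mult_ac)
  then have 2: "v \<le> K * u" using y by simp
  \<comment> \<open>if \<open>a > K\<close>, then \<open>K < a\<^sup>2 \<le> K * (a * b) \<le> K\<close>\<close>
  have small: "a \<le> K" if "a > 0" "b > 0" "a * b \<le> 1" "a \<le> K * b" for a b
  proof (rule ccontr)
    assume "\<not> a \<le> K"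
    then have "K * 1 < a * a" using K1 by (intro mult_less_le_imp_less) auto
    also have "\<dots> \<le> K * b * a" using that by (intro mult_right_mono) auto
    also have "\<dots> \<le> K * 1" using that K1 unfolding mult.assoc by (intro mult_left_mono) (auto simp: mult.commute)
    finally show False by simp
  qed
  show u: "nsq (B $ 2 $ 1) (B $ 2 $ 2) (fst W) \<le> \<epsilon>\<^sup>2 * M\<^sup>2"
    using small[OF uv \<open>u * v \<le> 1\<close> 1] by (simp add: K_def u_def)
  show v: "nsq (cj (B $ 2 $ 1)) (cj (B $ 2 $ 2)) (snd W) \<le> \<epsilon>\<^sup>2 * M\<^sup>2"
    using small[OF uv(2,1) _ 2] \<open>u * v \<le> 1\<close> by (simp add: K_def v_def mult.commute)
  have "M * 1 \<le> M * M" using M by (intro mult_left_mono) auto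
  then have M2: "(K + 1) * M \<le> (K + 1) * (1 + M * M)" using K1 by (intro mult_left_mono) auto
  have bds: "\<bar>Re (fst W)\<bar> \<le> M" "\<bar>Re (snd W)\<bar> \<le> M" "1 / M \<le> Im (fst W)" "1 / M \<le> Im (snd W)" using W by (auto simp: coord_box_def)
  have "j = 1 \<or> j = 2" using exhaust_2 by blast
  then show "\<bar>B $ 2 $ j\<bar> \<le> row_bound M" "\<bar>cj (B $ 2 $ j)\<bar> \<le> row_bound M"
    using nsq_bound_c[OF M bds(3) u] nsq_bound_c[OF M bds(4) v] nsq_bound_d[OF M bds(1,3) u] nsq_bound_d[OF M bds(2,4) v] M2
    unfolding row_bound_def K_def[symmetric] by auto
qed

text \<open>Every height in the orbit is attained by an element with reduced ratio, and the lower rows of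
  those elements that do not decrease the height are bounded. Hence only finitely many heights above that
  of \<open>Z\<close> occur and there is a highest point with reduced ratio. A translation changes neither height nor
  ratio and reduces \<open>s\<^sub>1\<close> and \<open>s\<^sub>2\<close>.\<close>

lemma cover:
  assumes Z: "Z \<in> X" shows "\<exists>A\<in>SL. act A Z \<in> F"
proof -
  obtain M where M: "M \<ge> 1" "Z \<in> coord_box M" using exists_coord_box[OF Z] by blast
  define \<A> where "\<A> = {A \<in> SL. height Z \<le> height (act A Z) \<and> reduced_ratio (act A Z)}"
  define Q where "Q = {x \<in> R. \<bar>x\<bar> \<le> row_bound M \<and> \<bar>cj x\<bar> \<le> row_bound M}"
  have "(\<lambda>A. height (act A Z)) ` \<A> \<subseteq> (\<lambda>(c, d). height Z / cusp_norm k c d Z) ` (Q \<times> Q)"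
  proof (rule image_subsetI)
    fix A assume A: "A \<in> \<A>"
    then have "A $ 2 $ 1 \<in> Q" "A $ 2 $ 2 \<in> Q"
      using row_bounds(3,4)[OF M] SL_entry unfolding \<A>_def Q_def by blast+
    then show "height (act A Z) \<in> (\<lambda>(c, d). height Z / cusp_norm k c d Z) ` (Q \<times> Q)"
      using A height_act[OF _ Z, of A] by (auto simp: \<A>_def intro: rev_image_eqI[of "(A $ 2 $ 1, A $ 2 $ 2)"])
  qed
  then have fin: "finite ((\<lambda>A. height (act A Z)) ` \<A>)"
    by (rule finite_subset) (simp add: Q_def finite_bounded_R)
  have reduce: "\<exists>A'\<in>SL. height (act A' Z) = height (act A Z) \<and> reduced_ratio (act A' Z)" if A: "A \<in> SL" for A
  proof -
    obtain E where E: "E \<in> SL" "height (act E (act A Z)) = height (act A Z)" "reduced_ratio (act E (act A Z))"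
      using reduce_ratio[OF act_X[OF A Z]] by blast
    then show ?thesis using A Z by (intro bexI[of _ "E ** A"]) (simp_all add: act_mult mult_SL)
  qed
  from reduce[OF one_SL] obtain A1 where "A1 \<in> SL" "height (act A1 Z) = height Z" "reduced_ratio (act A1 Z)"
    unfolding act_one by blast
  then have "A1 \<in> \<A>" by (simp add: \<A>_def)
  then have ne: "(\<lambda>A. height (act A Z)) ` \<A> \<noteq> {}" by blast
  obtain A0 where A0: "A0 \<in> \<A>" "Max ((\<lambda>A. height (act A Z)) ` \<A>) = height (act A0 Z)"
    using Max_in[OF fin ne] by blast
  have A0max: "height (act A Z) \<le> height (act A0 Z)" if "A \<in> \<A>" for A
    unfolding A0(2)[symmetric] using that by (intro Max_ge fin imageI)
  have A0SL: "A0 \<in> SL" and A0h: "height Z \<le> height (act A0 Z)" and A0r: "reduced_ratio (act A0 Z)" using A0(1) by (auto simp: \<A>_def)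
  have max: "height (act A Z) \<le> height (act A0 Z)" if ASL: "A \<in> SL" for A
  proof (cases "height Z \<le> height (act A Z)")
    case True
    obtain A' where A': "A' \<in> SL" "height (act A' Z) = height (act A Z)" "reduced_ratio (act A' Z)" using reduce[OF ASL] by blast
    then have "A' \<in> \<A>" using True by (simp add: \<A>_def)
    then show ?thesis using A0max[of A'] A'(2) by simp
  qed (use A0h in linarith)
  define W where "W = act A0 Z"
  have WX: "W \<in> X" unfolding W_def by (rule act_X[OF A0SL Z])
  \<comment> \<open>the translation by \<open>m + n \<omega>\<close> adds \<open>m\<close> to \<open>s\<^sub>1\<close> and \<open>n\<close> to \<open>s\<^sub>2\<close>\<close>
  define m where "m = - round (s1_coord W)"
  define n where "n = - round (s2_coord W)"
  define T where "T = mat22 1 (of_int m + of_int n * \<omega>) 0 1"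
  have T: "T \<in> SL" unfolding T_def by (simp add: mat22_SL R_lincomb)
  have fstT: "fst (act T W) = fst W + of_real (of_int m + of_int n * \<omega>)"
    and sndT: "snd (act T W) = snd W + of_real (of_int m + of_int n * \<omega>')"
    by (simp_all add: T_def act_fst act_snd moebius_def cj_lincomb)
  have s: "s1_coord (act T W) = s1_coord W + m" "s2_coord (act T W) = s2_coord W + n"
    using s_coords_unique[of "act T W" "s1_coord W + m" "s2_coord W + n"]
    by (simp_all add: fstT sndT s_coords[of W] algebra_simps)
  have TW: "height (act T W) = height W" "ratio (act T W) = ratio W"
    using triangular_act(1,2)[OF T _ WX] by (simp_all add: T_def)
  have "\<bar>s1_coord (act T W)\<bar> \<le> 1/2" "\<bar>s2_coord (act T W)\<bar> \<le> 1/2"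
    using of_int_round_abs_le[of "s1_coord W"] of_int_round_abs_le[of "s2_coord W"]
    unfolding s m_def n_def by (simp_all add: abs_minus_commute)
  moreover have "height (act C (act T W)) \<le> height (act T W)" if "C \<in> SL" for C
  proof -
    have "act C (act T W) = act (C ** (T ** A0)) Z"
      using that T A0SL Z by (simp add: act_mult mult_SL act_X W_def)
    then show ?thesis using max[of "C ** (T ** A0)"] that T A0SL TW by (simp add: mult_SL W_def)
  qed
  ultimately have "act T W \<in> F" using act_X[OF T WX] A0r TW by (simp add: F_iff reduced_ratio_def W_def)
  then show ?thesis using T A0SL Z by (intro bexI[of _ "T ** A0"]) (simp_all add: act_mult mult_SL W_def)
qed


section \<open>Local finiteness and the walls that carry the faces\<close>

text \<open>A nonzero element of \<open>R\<close> has norm at least one, so an upper bound for its conjugate gives a lower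
  bound for the element itself.\<close>

lemma nsq_lower_bound:
  assumes M: "M \<ge> 1" and C: "C \<ge> 1" and cd: "c \<in> R" "d \<in> R" "c \<noteq> 0 \<or> d \<noteq> 0"
    and b: "\<bar>c\<bar> \<le> C" "\<bar>d\<bar> \<le> C" "\<bar>cj c\<bar> \<le> C" "\<bar>cj d\<bar> \<le> C" and z: "1 / M \<le> Im z" "1 / M \<le> Im z'"
  shows "1 / (C * M)\<^sup>2 \<le> nsq c d z" "1 / (C * M)\<^sup>2 \<le> nsq (cj c) (cj d) z'"
proof -
  have big: "1 / C \<le> \<bar>x\<bar>" "1 / C \<le> \<bar>cj x\<bar>" if "x \<in> R" "x \<noteq> 0" "\<bar>x\<bar> \<le> C" "\<bar>cj x\<bar> \<le> C" for x
  proof -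
    have 1: "1 \<le> \<bar>x\<bar> * \<bar>cj x\<bar>" using norm_ge_1[OF that(1,2)] by (simp add: abs_mult)
    also have "\<dots> \<le> \<bar>x\<bar> * C" using that by (intro mult_left_mono) auto
    finally show "1 / C \<le> \<bar>x\<bar>" using C by (simp add: field_simps)
    have "1 \<le> \<bar>x\<bar> * \<bar>cj x\<bar>" by (rule 1)
    also have "\<dots> \<le> C * \<bar>cj x\<bar>" using that by (intro mult_right_mono) auto
    finally show "1 / C \<le> \<bar>cj x\<bar>" using C by (simp add: field_simps)
  qed
  have key: "1 / (C * M)\<^sup>2 \<le> nsq p q w" if "p = 0 \<and> 1 / C \<le> \<bar>q\<bar> \<or> 1 / C \<le> \<bar>p\<bar>" "1 / M \<le> Im w" for p q w
    using that(1)
  proof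
    assume "p = 0 \<and> 1 / C \<le> \<bar>q\<bar>"
    moreover have "1 / (C * M) \<le> 1 / C" using M C by (simp add: field_simps)
    ultimately have "(1 / (C * M))\<^sup>2 \<le> \<bar>q\<bar>\<^sup>2" using M C by (intro power_mono) auto
    then show ?thesis using \<open>p = 0 \<and> _\<close> by (simp add: nsq_def power_one_over)
  next
    assume "1 / C \<le> \<bar>p\<bar>"
    then have "1 / C * (1 / M) \<le> \<bar>p\<bar> * Im w" using M C that(2) by (intro mult_mono) auto
    then have "(1 / C * (1 / M))\<^sup>2 \<le> (\<bar>p\<bar> * Im w)\<^sup>2" using M C by (intro power_mono) auto
    also have "\<dots> \<le> nsq p q w" by (simp add: nsq_def power_mult_distrib)
    finally show ?thesis by (simp add: power_one_over)
  qed
  show "1 / (C * M)\<^sup>2 \<le> nsq c d z" "1 / (C * M)\<^sup>2 \<le> nsq (cj c) (cj d) z'"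
  proof -
    have "c = 0 \<and> 1 / C \<le> \<bar>d\<bar> \<or> 1 / C \<le> \<bar>c\<bar>" "cj c = 0 \<and> 1 / C \<le> \<bar>cj d\<bar> \<or> 1 / C \<le> \<bar>cj c\<bar>"
      using big[OF cd(1) _ b(1,3)] big[OF cd(2) _ b(2,4)] cd(3) by (cases "c = 0"; simp)+
    then show "1 / (C * M)\<^sup>2 \<le> nsq c d z" "1 / (C * M)\<^sup>2 \<le> nsq (cj c) (cj d) z'"
      using z by (blast intro: key)+
  qed
qed

text \<open>The lower row is bounded by \<open>row_bounds\<close>. The upper row \<open>(a, b)\<close> satisfies \<open>\<bar>a z + b\<bar>\<^sup>2 = \<bar>z'\<bar>\<^sup>2 * u\<close>, where \<open>z'\<close> is the image of \<open>z\<close> and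
  \<open>u\<close> the factor of the norm of the lower row. The real part of \<open>z'\<close> is bounded because the image lies in \<open>F\<close>, its
  imaginary part is \<open>Im z / u\<close>, and \<open>u\<close> is bounded from both sides.\<close>

lemma entries_bounded:
  assumes M: "M \<ge> 1"
  shows "\<exists>C. \<forall>W B i j. W \<in> coord_box M \<and> B \<in> SL \<and> act B W \<in> F \<longrightarrow> \<bar>B $ i $ j\<bar> \<le> C \<and> \<bar>cj (B $ i $ j)\<bar> \<le> C"
proof -
  define K where "K = \<epsilon>\<^sup>2 * M\<^sup>2"
  define C1 where "C1 = row_bound M"
  define S where "S = 1 + \<bar>\<omega>\<bar> + \<bar>\<omega>'\<bar>"
  define K2 where "K2 = S\<^sup>2 * K + M\<^sup>2 * (C1 * M)\<^sup>2"
  define C2 where "C2 = (K2 + 1) * (1 + M * M)"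
  have C1: "C1 \<ge> 1"
  proof -
    have "1 * 1 \<le> (\<epsilon>\<^sup>2 * M\<^sup>2 + 1) * (1 + M * M)" by (intro mult_mono) auto
    then show ?thesis by (simp add: C1_def row_bound_def)
  qed
  have "\<bar>B $ i $ j\<bar> \<le> max C1 C2 \<and> \<bar>cj (B $ i $ j)\<bar> \<le> max C1 C2"
    if W: "W \<in> coord_box M" and B: "B \<in> SL" and BF: "act B W \<in> F" for W B i j
  proof -
    have WX: "W \<in> X" using coord_box_sub_X[OF M] W by blast
    have red: "reduced_ratio (act B W)" and s: "\<bar>s1_coord (act B W)\<bar> \<le> 1/2" "\<bar>s2_coord (act B W)\<bar> \<le> 1/2"
      using BF by (auto simp: F_iff)
    have "height (act (adj22 B) (act B W)) \<le> height (act B W)" using BF adj_SL[OF B] by (auto simp: F_iff)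
    then have h: "height W \<le> height (act B W)" using act_adj(1)[OF B WX] by simp
    note rb = row_bounds[OF M W B h red]
    define u where "u = nsq (B $ 2 $ 1) (B $ 2 $ 2) (fst W)"
    define v where "v = nsq (cj (B $ 2 $ 1)) (cj (B $ 2 $ 2)) (snd W)"
    have uv: "u \<le> K" "v \<le> K" using rb(1,2) by (simp_all add: u_def v_def K_def)
    have bx: "\<bar>Re (fst W)\<bar> \<le> M" "\<bar>Re (snd W)\<bar> \<le> M" "1 / M \<le> Im (fst W)" "1 / M \<le> Im (snd W)"
      "Im (fst W) \<le> M" "Im (snd W) \<le> M" using W by (auto simp: coord_box_def)
    have lb: "1 / (C1 * M)\<^sup>2 \<le> u" "1 / (C1 * M)\<^sup>2 \<le> v"
      unfolding u_def v_def
      using nsq_lower_bound[OF M C1 SL_entry[OF B] SL_entry[OF B] det1_row[OF SL_det[OF B]] _ _ _ _ bx(3,4)] rb(3,4)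
      unfolding C1_def by blast+
    have C1M: "(C1 * M)\<^sup>2 > 0" using C1 M by simp
    have pos: "u > 0" "v > 0" using lb C1M by (smt (verit) zero_less_divide_1_iff)+
    have inv: "1 / u \<le> (C1 * M)\<^sup>2" "1 / v \<le> (C1 * M)\<^sup>2"
      using lb pos C1M by (simp_all add: field_simps)
    have bound: "nsq a b z \<le> K2"
      if "(cmod z')\<^sup>2 * t = nsq a b z" "\<bar>Re z'\<bar> \<le> S" "Im z' = Im z / t" "0 < t" "t \<le> K" "1 / t \<le> (C1 * M)\<^sup>2" "0 \<le> Im z" "Im z \<le> M"
      for a b z z' t
    proof -
      have "nsq a b z = \<bar>Re z'\<bar>\<^sup>2 * t + (Im z)\<^sup>2 * (1 / t)"
        using that(4) unfolding that(1)[symmetric] cmod_power2 that(3) by (simp add: field_simps power2_eq_square)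
      also have "\<dots> \<le> S\<^sup>2 * K + M\<^sup>2 * (C1 * M)\<^sup>2"
        using that by (intro add_mono mult_mono power_mono) auto
      finally show ?thesis by (simp add: K2_def)
    qed
    have S: "\<bar>Re (fst (act B W))\<bar> \<le> S" "\<bar>Re (snd (act B W))\<bar> \<le> S"
    proof -
      have "\<bar>x + y * w\<bar> \<le> 1 + \<bar>w\<bar>" if "\<bar>x\<bar> \<le> 1/2" "\<bar>y\<bar> \<le> 1/2" for x y w :: real
      proof -
        have "\<bar>x + y * w\<bar> \<le> \<bar>x\<bar> + \<bar>y\<bar> * \<bar>w\<bar>" by (metis abs_mult abs_triangle_ineq)
        also have "\<dots> \<le> 1 + 1 * \<bar>w\<bar>" using that by (intro add_mono mult_right_mono) auto
        finally show ?thesis by simp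
      qed
      from this[OF s] show "\<bar>Re (fst (act B W))\<bar> \<le> S" "\<bar>Re (snd (act B W))\<bar> \<le> S"
        unfolding s_coords[of "act B W"] S_def by (smt (verit) abs_ge_zero)+
    qed
    have W0: "Im (fst W) > 0" "Im (snd W) > 0" using WX by (simp_all add: in_X)
    have a: "nsq (B $ 1 $ 1) (B $ 1 $ 2) (fst W) \<le> K2"
      using norm_moebius[OF W0(1) SL_det[OF B]] S(1) Im_act(1)[OF B WX] pos(1) uv(1) inv(1) W0(1) bx(5)
      by (intro bound[of "fst (act B W)" u]) (simp_all add: act_fst u_def)
    have a': "nsq (cj (B $ 1 $ 1)) (cj (B $ 1 $ 2)) (snd W) \<le> K2"
      using norm_moebius[OF W0(2) det_cm[OF B]] S(2) Im_act(2)[OF B WX] pos(2) uv(2) inv(2) W0(2) bx(6)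
      by (intro bound[of "snd (act B W)" v]) (simp_all add: act_snd v_def)
    have "K2 \<ge> 0" using a nsq_nonneg by (rule order.trans[rotated])
    have "M * 1 \<le> M * M" using M by (intro mult_left_mono) auto
    then have M2: "(K2 + 1) * M \<le> C2" unfolding C2_def using \<open>K2 \<ge> 0\<close> by (intro mult_left_mono) auto
    have top: "\<bar>B $ 1 $ j\<bar> \<le> C2 \<and> \<bar>cj (B $ 1 $ j)\<bar> \<le> C2"
      using exhaust_2[of j] nsq_bound_c[OF M bx(3) a] nsq_bound_c[OF M bx(4) a'] nsq_bound_d[OF M bx(1,3) a]
        nsq_bound_d[OF M bx(2,4) a'] M2 unfolding C2_def[symmetric] by auto
    show ?thesis using exhaust_2[of i] top rb(3,4)[of j] unfolding C1_def[symmetric] by auto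
  qed
  then show ?thesis by blast
qed

lemma finite_bounded_SL: "finite {B \<in> SL. \<forall>i j. \<bar>B $ i $ j\<bar> \<le> C \<and> \<bar>cj (B $ i $ j)\<bar> \<le> C}"
proof -
  define Q where "Q = {x \<in> R. \<bar>x\<bar> \<le> C \<and> \<bar>cj x\<bar> \<le> C}"
  have "{B \<in> SL. \<forall>i j. \<bar>B $ i $ j\<bar> \<le> C \<and> \<bar>cj (B $ i $ j)\<bar> \<le> C} \<subseteq> (\<lambda>(a, b, c, d). mat22 a b c d) ` (Q \<times> Q \<times> Q \<times> Q)"
  proof
    fix B assume B: "B \<in> {B \<in> SL. \<forall>i j. \<bar>B $ i $ j\<bar> \<le> C \<and> \<bar>cj (B $ i $ j)\<bar> \<le> C}"
    then have "B $ i $ j \<in> Q" for i j using SL_entry by (auto simp: Q_def)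
    moreover have "B = mat22 (B $ 1 $ 1) (B $ 1 $ 2) (B $ 2 $ 1) (B $ 2 $ 2)" by (rule matrix22_eqI) simp_all
    ultimately show "B \<in> (\<lambda>(a, b, c, d). mat22 a b c d) ` (Q \<times> Q \<times> Q \<times> Q)"
      by (intro rev_image_eqI[of "(B $ 1 $ 1, B $ 1 $ 2, B $ 2 $ 1, B $ 2 $ 2)"]) auto
  qed
  then show ?thesis by (rule finite_subset) (simp add: Q_def finite_bounded_R)
qed

lemma adj22_adj22: "adj22 (adj22 A) = A"
  by (rule matrix22_eqI) (simp_all add: adj22_def)

lemma locally_finite_tiles:
  assumes "p \<in> X"
  shows "\<exists>N. open N \<and> p \<in> N \<and> N \<subseteq> X \<and> finite {A \<in> SL. act A ` F \<inter> N \<noteq> {}}"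
proof -
  obtain M where M: "M \<ge> 1" "p \<in> coord_box M" using exists_coord_box[OF assms] by blast
  obtain C where C: "\<And>W B i j. W \<in> coord_box M \<Longrightarrow> B \<in> SL \<Longrightarrow> act B W \<in> F \<Longrightarrow> \<bar>B $ i $ j\<bar> \<le> C \<and> \<bar>cj (B $ i $ j)\<bar> \<le> C"
    using entries_bounded[OF M(1)] by metis
  have "{A \<in> SL. act A ` F \<inter> coord_box M \<noteq> {}} \<subseteq> adj22 ` {B \<in> SL. \<forall>i j. \<bar>B $ i $ j\<bar> \<le> C \<and> \<bar>cj (B $ i $ j)\<bar> \<le> C}"
  proof clarify
    fix A assume A: "A \<in> SL" "act A ` F \<inter> coord_box M \<noteq> {}"
    then obtain Z where Z: "Z \<in> F" "act A Z \<in> coord_box M" by auto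
    then have "act (adj22 A) (act A Z) \<in> F" using act_adj(1)[OF A(1)] F_sub_X by auto
    then have "adj22 A \<in> {B \<in> SL. \<forall>i j. \<bar>B $ i $ j\<bar> \<le> C \<and> \<bar>cj (B $ i $ j)\<bar> \<le> C}"
      using C[OF Z(2) adj_SL[OF A(1)]] adj_SL[OF A(1)] by blast
    then show "A \<in> adj22 ` {B \<in> SL. \<forall>i j. \<bar>B $ i $ j\<bar> \<le> C \<and> \<bar>cj (B $ i $ j)\<bar> \<le> C}"
      by (rule rev_image_eqI) (simp add: adj22_adj22)
  qed
  then have "finite {A \<in> SL. act A ` F \<inter> coord_box M \<noteq> {}}" using finite_bounded_SL finite_surj by blast
  then show ?thesis using M open_coord_box coord_box_sub_X by blast
qed

text \<open>The hypersurfaces that can carry a face of the fundamental domain.\<close>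

inductive wall :: "(complex \<times> complex) set \<Rightarrow> bool" where
  cusp: "c \<in> R \<Longrightarrow> d \<in> R \<Longrightarrow> c \<noteq> 0 \<Longrightarrow> wall {Z \<in> X. cusp_norm k c d Z = 1}"
| ratio: "wall {Z \<in> X. ratio Z = \<rho>}"
| s1: "wall {Z \<in> X. s1_coord Z = t}"
| s2: "wall {Z \<in> X. s2_coord Z = t}"

text \<open>Let \<open>Z\<close> and \<open>B Z\<close> both lie in \<open>F\<close>. Both are highest in their common orbit, so the norm of the lower
  row at \<open>Z\<close> is \<open>1\<close>; this is the equation of a wall if \<open>c \<noteq> 0\<close>. If \<open>c = 0\<close> and the diagonal is not \<open>\<plusminus>1\<close>, its entries are
  at least \<open>\<epsilon>\<close> or at most \<open>1 / \<epsilon>\<close> in absolute value, and the ratio can stay in its interval only by moving from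
  one end to the other. If \<open>B\<close> is a translation up to sign, \<open>s\<^sub>1\<close> or \<open>s\<^sub>2\<close> moves by a nonzero integer inside \<open>[-1/2, 1/2]\<close>.\<close>

lemma face_in_wall:
  assumes B: "B \<in> SL" "B \<noteq> mat 1" "B \<noteq> - mat 1"
  shows "\<exists>V. wall V \<and> {Z \<in> F. act B Z \<in> F} \<subseteq> V"
proof (cases "B $ 2 $ 1 = 0")
  case False
  have "cusp_norm k (B $ 2 $ 1) (B $ 2 $ 2) Z = 1" if Z: "Z \<in> F" "act B Z \<in> F" for Z
  proof -
    have ZX: "Z \<in> X" using Z F_sub_X by blast
    have "height (act B Z) \<le> height Z" using Z B by (simp add: F_iff)
    moreover have "height (act (adj22 B) (act B Z)) \<le> height (act B Z)" using Z adj_SL[OF B(1)] by (simp add: F_iff)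
    ultimately have "height (act B Z) = height Z" using act_adj(1)[OF B(1) ZX] by simp
    then show ?thesis using height_pos[OF ZX] cusp_norm_pos[OF ZX B(1)] unfolding height_act[OF B(1) ZX]
      by (simp add: field_simps)
  qed
  then have "{Z \<in> F. act B Z \<in> F} \<subseteq> {Z \<in> X. cusp_norm k (B $ 2 $ 1) (B $ 2 $ 2) Z = 1}" using F_sub_X by blast
  then show ?thesis using wall.cusp[OF SL_entry[OF B(1)] SL_entry[OF B(1)] False] by blast
next
  case c0: True
  let ?d = "B $ 2 $ 2" and ?a = "B $ 1 $ 1"
  \<comment> \<open>the facts about the diagonal entries are stated for an action at a point, and any point will do\<close>
  obtain Z0 where Z0: "Z0 \<in> X" using interior_F F_sub_X interior_subset by blast
  have units: "?a \<in> quad_units k" "?d \<in> quad_units k" "?a * ?d = 1" using triangular_act(3-5)[OF B(1) c0 Z0] .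
  have dR: "?d \<noteq> 0" using units(3) by auto
  have unit_abs: "\<bar>u\<bar> \<ge> \<epsilon>" if u: "u \<in> quad_units k" "\<bar>u\<bar> > 1" for u
  proof -
    obtain v where "u \<in> R" "v \<in> R" "u * v = 1" using u(1) by (auto simp: quad_units_def)
    then have "- u \<in> quad_units k" unfolding quad_units_def by (auto intro!: R_minus bexI[of _ "- v"])
    then show ?thesis using eps0(3)[of u] eps0(3)[of "-u"] u by (cases "u > 0") auto
  qed
  have e4: "\<epsilon> ^ 4 \<le> x ^ 4" if "\<epsilon> \<le> \<bar>x\<bar>" for x :: real
    using power_mono[OF that, of 4] eps_gt_1 by simp
  define q where "q = \<epsilon>\<^sup>2"
  have e42: "\<epsilon> ^ 4 = q * q" by (simp add: q_def flip: power_add)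
  have q0: "q > 0" using eps_gt_1 by (simp add: q_def)
  have translation: "\<exists>V. wall V \<and> {Z \<in> F. act T Z \<in> F} \<subseteq> V"
    if T: "T \<in> SL" "T \<noteq> mat 1" "T $ 2 $ 1 = 0" "T $ 2 $ 2 = 1" for T
  proof -
    have a1: "T $ 1 $ 1 = 1" using triangular_act(5)[OF T(1,3) Z0] T(4) by simp
    obtain m n :: int where mn: "T $ 1 $ 2 = of_int m + of_int n * \<omega>" "cj (T $ 1 $ 2) = of_int m + of_int n * \<omega>'"
      using R_E[OF SL_entry[OF T(1)]] by metis
    have "T $ 1 $ 2 \<noteq> 0" using T(2-4) a1 matrix22_eqI[of T "mat 1"] by (auto simp: mat_def)
    then have mn0: "m \<noteq> 0 \<or> n \<noteq> 0" using mn by auto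
    have s: "s1_coord (act T Z) = s1_coord Z + m" "s2_coord (act T Z) = s2_coord Z + n" for Z
    proof -
      have "fst (act T Z) = fst Z + of_real (of_int m + of_int n * \<omega>)"
        "snd (act T Z) = snd Z + of_real (of_int m + of_int n * \<omega>')"
        using T(3,4) a1 mn by (simp_all add: act_fst act_snd moebius_def)
      then show "s1_coord (act T Z) = s1_coord Z + m" "s2_coord (act T Z) = s2_coord Z + n"
        using s_coords_unique[of "act T Z" "s1_coord Z + m" "s2_coord Z + n"]
        by (simp_all add: s_coords[of Z] algebra_simps)
    qed
    \<comment> \<open>an integer shift inside \<open>[-1/2, 1/2]\<close> starts at an end point\<close>
    have half: "x = - sgn (of_int i) / 2" if "\<bar>x\<bar> \<le> 1/2" "\<bar>x + of_int i\<bar> \<le> 1/2" "i \<noteq> 0" for x :: real and i :: int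
    proof (cases "i > 0")
      case True
      then have "real_of_int i \<ge> 1" by linarith
      then show ?thesis using that True by simp
    next
      case False
      then have "real_of_int i \<le> -1" using that(3) by linarith
      then show ?thesis using that False by simp
    qed
    show ?thesis
    proof (cases "m = 0")
      case True
      then have "s2_coord Z = - sgn (of_int n) / 2" if "Z \<in> F" "act T Z \<in> F" for Z
        using that s(2)[of Z] mn0 by (intro half) (auto simp: F_iff)
      then have "{Z \<in> F. act T Z \<in> F} \<subseteq> {Z \<in> X. s2_coord Z = - sgn (of_int n) / 2}" using F_sub_X by blast
      then show ?thesis using wall.s2 by blast
    next
      case False
      then have "s1_coord Z = - sgn (of_int m) / 2" if "Z \<in> F" "act T Z \<in> F" for Z
        using that s(1)[of Z] by (intro half) (auto simp: F_iff)
      then have "{Z \<in> F. act T Z \<in> F} \<subseteq> {Z \<in> X. s1_coord Z = - sgn (of_int m) / 2}" using F_sub_X by blast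
      then show ?thesis using wall.s1 by blast
    qed
  qed
  consider "\<bar>?d\<bar> > 1" | "\<bar>?d\<bar> < 1" | "?d = 1" | "?d = -1" by linarith
  then show ?thesis
  proof cases
    case 1
    have d4: "\<epsilon> ^ 4 \<le> ?d ^ 4" using unit_abs[OF units(2) 1] by (rule e4)
    have "ratio Z = q" if Z: "Z \<in> F" "act B Z \<in> F" for Z
    proof -
      have ZX: "Z \<in> X" using Z F_sub_X by blast
      have r: "ratio Z \<le> q" "1 / q \<le> ratio Z / ?d ^ 4"
        using Z triangular_act(2)[OF B(1) c0 ZX] by (auto simp: F_iff reduced_ratio_def q_def)
      have qq: "0 < q * q" using q0 by simp
      have dd: "q * q \<le> ?d ^ 4" using d4 unfolding e42 .
      have "ratio Z / ?d ^ 4 \<le> ratio Z / (q * q)" using ratio_pos[OF ZX]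
        by (intro divide_left_mono[OF dd] mult_pos_pos less_le_trans[OF qq dd] qq) simp
      then have "1 / q \<le> ratio Z / (q * q)" using r(2) by linarith
      then have "q \<le> ratio Z" using q0 by (simp add: field_simps)
      then show ?thesis using r by simp
    qed
    then have "{Z \<in> F. act B Z \<in> F} \<subseteq> {Z \<in> X. ratio Z = q}" using F_sub_X by blast
    then show ?thesis using wall.ratio by blast
  next
    case 2
    have "\<bar>?a\<bar> * \<bar>?d\<bar> = 1" using units(3) by (metis abs_mult abs_one)
    then have "\<not> \<bar>?a\<bar> \<le> 1" using 2 mult_right_mono[of "\<bar>?a\<bar>" 1 "\<bar>?d\<bar>"] by auto
    then have "\<bar>?a\<bar> > 1" by simp
    then have a4: "\<epsilon> ^ 4 \<le> ?a ^ 4" using unit_abs[OF units(1)] by (intro e4)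
    have ad: "?a = 1 / ?d" using units(3) dR by (simp add: field_simps)
    have "ratio Z = 1 / q" if Z: "Z \<in> F" "act B Z \<in> F" for Z
    proof -
      have ZX: "Z \<in> X" using Z F_sub_X by blast
      have "ratio (act B Z) = ratio Z * ?a ^ 4"
        using triangular_act(2)[OF B(1) c0 ZX] by (simp add: ad power_one_over)
      then have r: "1 / q \<le> ratio Z" "ratio Z * ?a ^ 4 \<le> q"
        using Z by (auto simp: F_iff reduced_ratio_def q_def)
      have "ratio Z * (q * q) \<le> ratio Z * ?a ^ 4" using a4 ratio_pos[OF ZX] unfolding e42 by (intro mult_left_mono) auto
      then have "(ratio Z * q) * q \<le> 1 * q" using r(2) by (simp add: mult.assoc)
      then have "ratio Z * q \<le> 1" using q0 by (simp only: mult_le_cancel_right_pos)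
      then have "ratio Z \<le> 1 / q" using q0 by (simp add: field_simps)
      then show ?thesis using r by simp
    qed
    then have "{Z \<in> F. act B Z \<in> F} \<subseteq> {Z \<in> X. ratio Z = 1 / q}" using F_sub_X by blast
    then show ?thesis using wall.ratio by blast
  next
    case 3
    then show ?thesis using translation[of B] B c0 by blast
  next
    case 4
    have "- B \<noteq> mat 1" using B(3) by (metis minus_minus)
    then show ?thesis using translation[of "- B"] minus_SL[OF B(1)] c0 4 act_minus[OF B(1)] by simp
  qed
qed

end


section \<open>Open pieces of walls have dimension three\<close>

lemma real_coords_nth [simp]:
  "real_coords Z $ 1 = Re (fst Z)" "real_coords Z $ 2 = Re (snd Z)"
  "real_coords Z $ 3 = Im (fst Z)" "real_coords Z $ 4 = Im (snd Z)"
  by (simp_all add: real_coords_def split_def vector_def)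

definition of_real_coords :: "real^4 \<Rightarrow> complex \<times> complex" where
  "of_real_coords x = (Complex (x $ 1) (x $ 3), Complex (x $ 2) (x $ 4))"

lemma of_real_coords [simp]: "of_real_coords (real_coords Z) = Z"
  by (simp add: of_real_coords_def prod_eq_iff complex_eq_iff)

lemma polynomial_coord: "real_polynomial_function (\<lambda>x::real^'n. x $ i)"
  by (intro real_polynomial_function.intros(1) bounded_linear_vec_nth)

lemma inner_of_real_coords:
  "w \<bullet> of_real_coords x = Re (fst w) * x $ 1 + Im (fst w) * x $ 3 + Re (snd w) * x $ 2 + Im (snd w) * x $ 4"
  by (simp add: of_real_coords_def inner_prod_def inner_complex_def)

lemma polynomial_inner: "real_polynomial_function (\<lambda>x. w \<bullet> of_real_coords x - c)"
  unfolding inner_of_real_coords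
  by (intro real_polynomial_function_diff real_polynomial_function.intros(2-4) polynomial_coord)

text \<open>The chart \<open>\<Phi>\<close> maps a hyperplane with normal \<open>a\<close> to the hypersurface, and the \<open>E i\<close> are orthogonal directions in
  this hyperplane. The flag starts with a ball of the hyperplane and fixes one direction after the
  other. The polynomial \<open>Q i\<close> vanishes once the directions up to \<open>E i\<close> are fixed but not on the line
  through \<open>q\<close> in direction \<open>E i\<close>, which separates consecutive members of the flag.\<close>

lemma semialg_dim_hypersurface:
  fixes \<Phi> :: "complex \<times> complex \<Rightarrow> complex \<times> complex" and E :: "nat \<Rightarrow> complex \<times> complex"
  assumes \<Phi>: "\<And>i. entire_on_lines (\<lambda>L. real_coords (\<Phi> L) $ i)"
    and S: "\<delta> > 0" "\<And>L. L \<in> ball q \<delta> \<Longrightarrow> a \<bullet> (L - q) = 0 \<Longrightarrow> \<Phi> L \<in> S"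
    and E: "\<And>i. i < 3 \<Longrightarrow> E i \<noteq> 0 \<and> a \<bullet> E i = 0 \<and> (\<forall>j<i. E j \<bullet> E i = 0)"
    and Q: "\<And>i. i < 3 \<Longrightarrow> real_polynomial_function (Q i)"
      "\<And>i L. i < 3 \<Longrightarrow> a \<bullet> (L - q) = 0 \<Longrightarrow> \<forall>j\<le>i. E j \<bullet> (L - q) = 0 \<Longrightarrow> Q i (real_coords (\<Phi> L)) = 0"
      "\<And>i s. i < 3 \<Longrightarrow> 0 < s \<Longrightarrow> s < 1 \<Longrightarrow> Q i (real_coords (\<Phi> (q + s *\<^sub>R E i))) \<noteq> 0"
    and p: "real_polynomial_function p" "\<And>Z. Z \<in> S \<Longrightarrow> p (real_coords Z) = 0" "\<exists>x. p x \<noteq> 0"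
  shows "semialg_dim (real_coords ` S) = 3"
proof -
  have "semialg_dim (real_coords ` S) \<le> enat 3"
    by (rule semialg_dim_le_of_vanishing[OF p(1,3)]) (use p(2) in auto)
  moreover have "enat 3 \<le> semialg_dim (real_coords ` S)"
  proof (rule semialg_dim_ge_chart[OF \<Phi>])
    define D where "D i = ball q \<delta> \<inter> {L. a \<bullet> L = a \<bullet> q} \<inter> (\<Inter>j<i. {L. E j \<bullet> L = E j \<bullet> q})" for i :: nat
    show "convex (D i)" for i unfolding D_def
      by (intro convex_Int convex_INT convex_ball convex_hyperplane)
    have "q \<in> D 3" using S(1) by (simp add: D_def)
    then show "D 3 \<noteq> {}" by blast
    show "D (Suc i) \<subseteq> D i" for i by (auto simp: D_def)
    show "(\<lambda>L. real_coords (\<Phi> L)) ` D 0 \<subseteq> real_coords ` S"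
      using S(2) by (auto simp: D_def inner_diff_right)
    show "\<exists>f. real_polynomial_function f \<and> (\<forall>x\<in>D (Suc i). f (real_coords (\<Phi> x)) = 0) \<and> (\<exists>x\<in>D i. f (real_coords (\<Phi> x)) \<noteq> 0)"
      if i: "i < 3" for i
    proof (intro exI[of _ "Q i"] conjI ballI)
      show "real_polynomial_function (Q i)" by (rule Q(1)[OF i])
      show "Q i (real_coords (\<Phi> x)) = 0" if "x \<in> D (Suc i)" for x
        using that by (intro Q(2)[OF i]) (auto simp: D_def inner_diff_right)
      define s where "s = min (1/2) (\<delta> / 2 / norm (E i))"
      have nE: "norm (E i) > 0" using E[OF i] by simp
      have s: "0 < s" "s < 1" "s * norm (E i) < \<delta>"
      proof -
        show "0 < s" "s < 1" using nE S(1) by (auto simp: s_def)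
        have "s * norm (E i) \<le> \<delta> / 2 / norm (E i) * norm (E i)" using nE by (intro mult_right_mono) (auto simp: s_def)
        then show "s * norm (E i) < \<delta>" using nE S(1) by simp
      qed
      then have "q + s *\<^sub>R E i \<in> D i"
        using E[OF i] by (auto simp: D_def dist_norm inner_add_right)
      then show "\<exists>x\<in>D i. Q i (real_coords (\<Phi> x)) \<noteq> 0" using Q(3)[OF i s(1,2)] by blast
    qed
  qed
  ultimately show ?thesis by (simp add: numeral_eq_enat)
qed

lemma less_3_cases: "i < 3 \<Longrightarrow> (i = 0 \<Longrightarrow> P) \<Longrightarrow> (i = 1 \<Longrightarrow> P) \<Longrightarrow> (i = 2 \<Longrightarrow> P) \<Longrightarrow> P" for i :: nat
  by linarith

lemma entire_on_lines_real_coordsI: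
  "entire_on_lines (\<lambda>L. Re (fst (\<Phi> L))) \<Longrightarrow> entire_on_lines (\<lambda>L. Re (snd (\<Phi> L))) \<Longrightarrow>
   entire_on_lines (\<lambda>L. Im (fst (\<Phi> L))) \<Longrightarrow> entire_on_lines (\<lambda>L. Im (snd (\<Phi> L))) \<Longrightarrow>
   entire_on_lines (\<lambda>L. real_coords (\<Phi> L) $ i)"
  using exhaust_4[of i] by auto

lemma semialg_dim_hyperplane_piece:
  fixes E :: "nat \<Rightarrow> complex \<times> complex"
  assumes "open M" "q \<in> M" "a \<bullet> q = t" "\<And>Z. Z \<in> M \<Longrightarrow> a \<bullet> Z = t \<Longrightarrow> Z \<in> S" "\<And>Z. Z \<in> S \<Longrightarrow> a \<bullet> Z = t" and a: "a \<noteq> 0"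
    and E: "\<And>i. i < 3 \<Longrightarrow> E i \<noteq> 0 \<and> a \<bullet> E i = 0 \<and> (\<forall>j<i. E j \<bullet> E i = 0)"
  shows "semialg_dim (real_coords ` S) = 3"
proof -
  obtain \<delta> where \<delta>: "\<delta> > 0" "ball q \<delta> \<subseteq> M" using assms(1,2) openE by blast
  show ?thesis
  proof (rule semialg_dim_hypersurface[of "\<lambda>L. L" \<delta> q a S E "\<lambda>i x. E i \<bullet> of_real_coords x - E i \<bullet> q" "\<lambda>x. a \<bullet> of_real_coords x - t"])
    show "entire_on_lines (\<lambda>L. real_coords L $ i)" for i
      by (rule entire_on_lines_real_coordsI; rule entire_on_lines_linear; intro linearI; simp)
    show "L \<in> S" if "L \<in> ball q \<delta>" "a \<bullet> (L - q) = 0" for L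
    proof (rule assms(4))
      show "L \<in> M" using that(1) \<delta>(2) by blast
      show "a \<bullet> L = t" using that(2) assms(3) by (simp add: inner_diff_right)
    qed
    show "\<exists>x. a \<bullet> of_real_coords x - t \<noteq> 0"
      using a assms(3) by (intro exI[of _ "real_coords (q + a)"]) (simp add: inner_add_right)
  qed (use \<delta>(1) E assms(5) in \<open>auto simp: inner_diff_right inner_add_right intro: polynomial_inner\<close>)
qed

text \<open>With \<open>u = d / c\<close> and \<open>v\<close> its conjugate, the logarithm of \<open>\<parallel>cZ + d\<parallel>\<close> becomes an affine function of \<open>L\<close>.\<close>

definition log_chart :: "real \<Rightarrow> real \<Rightarrow> complex \<times> complex \<Rightarrow> complex \<times> complex" where
  "log_chart u v L = (exp (fst L) - of_real u, exp (snd L) - of_real v)"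

text \<open>The domain on which \<open>log_chart\<close> is a homeomorphism onto the product of the two half planes, whatever the
  real shifts \<open>u\<close> and \<open>v\<close> are.\<close>

definition strip2 :: "(complex \<times> complex) set" where
  "strip2 = {L. 0 < Im (fst L) \<and> Im (fst L) < pi \<and> 0 < Im (snd L) \<and> Im (snd L) < pi}"

lemma open_strip2: "open strip2"
  unfolding strip2_def by (intro open_Collect_conj open_Collect_less continuous_intros)

lemma homeomorphism_log_chart:
  "homeomorphism strip2 (upper_half_plane \<times> upper_half_plane) (log_chart u v)
     (\<lambda>Z. (Ln (fst Z + of_real u), Ln (snd Z + of_real v)))" (is "homeomorphism _ ?X _ ?g")
proof -
  have im_exp: "Im (exp z) > 0" if "0 < Im z" "Im z < pi" for z
    using that by (simp add: Im_exp sin_gt_zero)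
  have pos: "z + of_real u \<noteq> 0" "z + of_real u \<notin> \<real>\<^sub>\<le>\<^sub>0" if "Im z > 0" for z and u :: real
    using that by (auto simp: complex_eq_iff complex_nonpos_Reals_iff)
  show ?thesis
  proof (rule homeomorphismI)
    show "continuous_on strip2 (log_chart u v)" unfolding log_chart_def by (intro continuous_intros)
    show "continuous_on ?X ?g"
      by (intro continuous_intros pos(2)) (simp_all add: upper_half_plane_def mem_Times_iff)
    show "log_chart u v ` strip2 \<subseteq> ?X"
      by (rule image_subsetI) (simp add: im_exp strip2_def log_chart_def upper_half_plane_def)
    show "?g ` ?X \<subseteq> strip2"
      by (rule image_subsetI) (simp add: Im_Ln_pos_lt_imp strip2_def upper_half_plane_def mem_Times_iff)
    show "?g (log_chart u v L) = L" if "L \<in> strip2" for L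
      using that by (simp add: log_chart_def strip2_def prod_eq_iff)
    show "log_chart u v (?g Z) = Z" if "Z \<in> ?X" for Z
      using that pos(1) by (simp add: log_chart_def upper_half_plane_def mem_Times_iff)
  qed
qed

lemma entire_log_chart: "entire_on_lines (\<lambda>L. real_coords (log_chart u v L) $ i)"
proof -
  have lin: "entire_on_lines (\<lambda>L::complex \<times> complex. Re (fst L))" "entire_on_lines (\<lambda>L::complex \<times> complex. Im (fst L))"
    "entire_on_lines (\<lambda>L::complex \<times> complex. Re (snd L))" "entire_on_lines (\<lambda>L::complex \<times> complex. Im (snd L))"
    by (rule entire_on_lines_linear; intro linearI; simp)+
  have ex: "entire_on_lines (\<lambda>L. exp (f L))" if "entire_on_lines f" for f :: "complex \<times> complex \<Rightarrow> real"
    by (rule entire_on_lines_compose[OF that holomorphic_on_exp]) (simp add: exp_of_real)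
  have co: "entire_on_lines (\<lambda>L. cos (f L))" if "entire_on_lines f" for f :: "complex \<times> complex \<Rightarrow> real"
    by (rule entire_on_lines_compose[OF that holomorphic_on_cos]) (simp add: cos_of_real)
  have si: "entire_on_lines (\<lambda>L. sin (f L))" if "entire_on_lines f" for f :: "complex \<times> complex \<Rightarrow> real"
    by (rule entire_on_lines_compose[OF that holomorphic_on_sin]) (simp add: sin_of_real)
  show ?thesis
    by (rule entire_on_lines_real_coordsI)
       (auto simp: log_chart_def Re_exp Im_exp diff_conv_add_uminus simp del: add_uminus_conv_diff
         intro!: entire_on_lines_add entire_on_lines_mult entire_on_lines_const ex co si lin)
qed

context real_quadratic
begin

lemma wall_sub_X: "wall V \<Longrightarrow> V \<subseteq> X"
  by (auto elim: wall.cases)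

lemma linear_walls:
  "{Z \<in> X. s1_coord Z = t} = {Z \<in> X. (of_real (- \<omega>'), of_real \<omega>) \<bullet> Z = t * (\<omega> - \<omega>')}"
  "{Z \<in> X. s2_coord Z = t} = {Z \<in> X. (1, -1) \<bullet> Z = t * (\<omega> - \<omega>')}"
  "{Z \<in> X. ratio Z = t} = {Z \<in> X. (\<i>, - of_real t * \<i>) \<bullet> Z = 0}"
proof -
  have "(of_real (- \<omega>'), of_real \<omega>) \<bullet> Z = s1_coord Z * (\<omega> - \<omega>')" "(1, -1) \<bullet> Z = s2_coord Z * (\<omega> - \<omega>')" for Z
    using s_coords[of Z] by (cases Z; simp add: inner_complex_def algebra_simps)+
  then show "{Z \<in> X. s1_coord Z = t} = {Z \<in> X. (of_real (- \<omega>'), of_real \<omega>) \<bullet> Z = t * (\<omega> - \<omega>')}"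
    "{Z \<in> X. s2_coord Z = t} = {Z \<in> X. (1, -1) \<bullet> Z = t * (\<omega> - \<omega>')}"
    using omega_diff_pos by simp_all
  have "ratio Z = t \<longleftrightarrow> (\<i>, - of_real t * \<i>) \<bullet> Z = 0" if "Z \<in> X" for Z
    using that by (cases Z) (auto simp: ratio_def in_X inner_complex_def field_simps)
  then show "{Z \<in> X. ratio Z = t} = {Z \<in> X. (\<i>, - of_real t * \<i>) \<bullet> Z = 0}" by blast
qed

lemma omega_nz: "\<omega> \<noteq> 0" "\<omega>' \<noteq> 0"
  using lincomb_eq_0[of 0 1] by auto

lemma cusp_wall_log_chart:
  assumes "c \<in> R" "c \<noteq> 0"
  shows "{Z \<in> X. cusp_norm k c d Z = 1} =
    log_chart (d / c) (cj d / cj c) ` {L \<in> strip2. (1, 1) \<bullet> L = - ln \<bar>c * cj c\<bar>}"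
proof -
  let ?\<Phi> = "log_chart (d / c) (cj d / cj c)"
  have c': "cj c \<noteq> 0" using assms by simp
  have nsq: "nsq p q (exp z - of_real (q / p)) = (\<bar>p\<bar> * exp (Re z))\<^sup>2" if "p \<noteq> 0" for p q z
    using that by (simp add: nsq_eq_norm algebra_simps norm_mult)
  have norm: "cusp_norm k c d (?\<Phi> L) = (\<bar>c * cj c\<bar> * exp ((1, 1) \<bullet> L))\<^sup>2" for L
    using nsq[OF assms(2), of d "fst L"] nsq[OF c', of "cj d" "snd L"]
    by (cases L) (simp add: cusp_norm_eq log_chart_def inner_complex_def exp_add abs_mult power_mult_distrib mult_ac)
  have iff: "cusp_norm k c d (?\<Phi> L) = 1 \<longleftrightarrow> (1, 1) \<bullet> L = - ln \<bar>c * cj c\<bar>" for L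
  proof -
    have pos: "\<bar>c * cj c\<bar> > 0" using assms c' by simp
    have "cusp_norm k c d (?\<Phi> L) = 1 \<longleftrightarrow> \<bar>c * cj c\<bar> * exp ((1, 1) \<bullet> L) = 1"
      unfolding norm using pos by (simp add: power2_eq_1_iff) (smt (verit) mult_nonneg_nonneg exp_ge_zero abs_ge_zero)
    also have "\<dots> \<longleftrightarrow> exp (ln \<bar>c * cj c\<bar> + (1, 1) \<bullet> L) = exp 0"
      using pos by (simp add: exp_add)
    also have "\<dots> \<longleftrightarrow> (1, 1) \<bullet> L = - ln \<bar>c * cj c\<bar>" by (subst exp_inj_iff) linarith
    finally show ?thesis .
  qed
  have im: "?\<Phi> ` strip2 = X" using homeomorphism_log_chart[of "d / c" "cj d / cj c"] by (simp add: homeomorphism_def)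
  have "{Z \<in> X. cusp_norm k c d Z = 1} = ?\<Phi> ` {L \<in> strip2. cusp_norm k c d (?\<Phi> L) = 1}"
    unfolding im[symmetric] by (rule Compr_image_eq)
  then show ?thesis unfolding iff .
qed

lemma wall_two_sided: "wall V \<Longrightarrow> two_sided X V"
proof (induction rule: wall.induct)
  case (cusp c d)
  have nz: "(1, 1) \<noteq> (0 :: complex \<times> complex)" by (simp add: zero_prod_def)
  have "two_sided X (log_chart (d / c) (cj d / cj c) ` {L \<in> strip2. (1, 1) \<bullet> L = - ln \<bar>c * cj c\<bar>})"
    by (rule two_sided_image[OF two_sided_hyperplane[OF nz] homeomorphism_log_chart open_strip2 open_X Collect_restrict])
  then show ?case by (simp only: cusp_wall_log_chart[OF cusp(1,3)])
next
  case (ratio \<rho>)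
  have "(\<i>, - of_real \<rho> * \<i>) \<noteq> (0 :: complex \<times> complex)" by (simp add: zero_prod_def)
  then show ?case unfolding linear_walls by (rule two_sided_hyperplane)
next
  case (s1 t)
  have "(of_real (- \<omega>'), of_real \<omega>) \<noteq> (0 :: complex \<times> complex)" using omega_nz by (simp add: zero_prod_def)
  then show ?case unfolding linear_walls by (rule two_sided_hyperplane)
next
  case (s2 t)
  have "(1, -1) \<noteq> (0 :: complex \<times> complex)" by (simp add: zero_prod_def)
  then show ?case unfolding linear_walls by (rule two_sided_hyperplane)
qed

text \<open>On the linear walls the identity is a chart. On the curved walls the polynomials \<open>Q i\<close> fix, in turn, the
  arguments of the two shifted points \<open>z + d/c\<close> and the modulus of the first one; the modulus of the second one is
  then determined by the equation of the wall.\<close>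

lemma wall_piece_dim:
  assumes "wall V" "open M" "M \<inter> V \<noteq> {}" "M \<inter> V \<subseteq> S" "S \<subseteq> V"
  shows "semialg_dim (real_coords ` S) = 3"
proof -
  have hyper: "semialg_dim (real_coords ` S) = 3"
    if V: "V = {Z \<in> X. a \<bullet> Z = t}" "a \<noteq> 0"
      and E: "\<And>i. i < 3 \<Longrightarrow> E i \<noteq> 0 \<and> a \<bullet> E i = 0 \<and> (\<forall>j<i. E j \<bullet> E i = 0)" for a t and E :: "nat \<Rightarrow> complex \<times> complex"
  proof -
    obtain q where "q \<in> M \<inter> V" using assms(3) by blast
    then show ?thesis
      using assms(2,4,5) V open_X by (intro semialg_dim_hyperplane_piece[of "M \<inter> X" q a t S E] E open_Int) auto
  qed
  show ?thesis
    using assms(1)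
  proof cases
    case (ratio \<rho>)
    show ?thesis
      by (rule hyper[OF ratio[unfolded linear_walls], of "\<lambda>i. if i = 0 then (1, 0) else if i = 1 then (0, 1) else (of_real \<rho> * \<i>, \<i>)"])
         (auto elim!: less_3_cases simp: inner_complex_def prod_eq_iff complex_eq_iff less_Suc_eq numeral_2_eq_2)
  next
    case (s1 t)
    show ?thesis using omega_nz
      by (intro hyper[OF s1[unfolded linear_walls], of "\<lambda>i. if i = 0 then (\<i>, 0) else if i = 1 then (0, \<i>) else (of_real \<omega>, of_real \<omega>')"])
         (auto elim!: less_3_cases simp: inner_complex_def prod_eq_iff complex_eq_iff less_Suc_eq numeral_2_eq_2)
  next
    case (s2 t)
    show ?thesis
      by (rule hyper[OF s2[unfolded linear_walls], of "\<lambda>i. if i = 0 then (\<i>, 0) else if i = 1 then (0, \<i>) else (1, 1)"])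
         (auto elim!: less_3_cases simp: inner_complex_def prod_eq_iff complex_eq_iff less_Suc_eq numeral_2_eq_2)
  next
    case (cusp c d)
    let ?u = "d / c" and ?v = "cj d / cj c"
    define \<Phi> where "\<Phi> = log_chart ?u ?v"
    define \<tau> where "\<tau> = - ln \<bar>c * cj c\<bar>"
    have c: "c \<noteq> 0" "cj c \<noteq> 0" using cusp by simp_all
    have V: "V = \<Phi> ` {L \<in> strip2. (1, 1) \<bullet> L = \<tau>}"
      unfolding \<Phi>_def \<tau>_def cusp(1) by (rule cusp_wall_log_chart[OF cusp(2,4)])
    obtain q where q: "q \<in> strip2" "(1, 1) \<bullet> q = \<tau>" "\<Phi> q \<in> M" using assms(3) V by blast
    have "open (strip2 \<inter> \<Phi> -` M)"
      using homeomorphism_log_chart[of ?u ?v] assms(2) open_strip2 unfolding \<Phi>_def homeomorphism_def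
      by (intro continuous_open_preimage) auto
    then obtain \<delta> where \<delta>: "\<delta> > 0" "ball q \<delta> \<subseteq> strip2 \<inter> \<Phi> -` M" using q by (meson IntI openE vimageI)
    \<comment> \<open>\<open>Q 0\<close> and \<open>Q 1\<close> are the imaginary part of a shifted point times the conjugate of its value at \<open>q\<close>, hence
      a positive multiple of the sine of the difference of the arguments\<close>
    define Q where "Q i x = (if i = (0::nat) then (x $ 3) * Re (exp (fst q)) - (x $ 1 + ?u) * Im (exp (fst q))
      else if i = 1 then (x $ 4) * Re (exp (snd q)) - (x $ 2 + ?v) * Im (exp (snd q))
      else (x $ 1 + ?u)\<^sup>2 + (x $ 3)\<^sup>2 - (norm (exp (fst q)))\<^sup>2)" for i and x :: "real^4"
    define E where "E i = (if i = (0::nat) then (\<i>, 0) else if i = 1 then (0, \<i>) else (1, -1 :: complex))" for i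
    define p where "p x = ((c * x $ 1 + d)\<^sup>2 + c\<^sup>2 * (x $ 3)\<^sup>2) * ((cj c * x $ 2 + cj d)\<^sup>2 + (cj c)\<^sup>2 * (x $ 4)\<^sup>2) - 1" for x :: "real^4"
    have rot: "Im (exp z) * Re (exp w) - Re (exp z) * Im (exp w) = exp (Re z + Re w) * sin (Im z - Im w)" for z w
      by (simp add: Re_exp Im_exp exp_add sin_diff algebra_simps)
    have Q01: "Q 0 (real_coords (\<Phi> L)) = exp (Re (fst L) + Re (fst q)) * sin (Im (fst L) - Im (fst q))"
      "Q 1 (real_coords (\<Phi> L)) = exp (Re (snd L) + Re (snd q)) * sin (Im (snd L) - Im (snd q))" for L
      using rot[of "fst L" "fst q"] rot[of "snd L" "snd q"] by (simp_all add: Q_def \<Phi>_def log_chart_def)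
    have Q2: "Q 2 (real_coords (\<Phi> L)) = (exp (Re (fst L)))\<^sup>2 - (exp (Re (fst q)))\<^sup>2" for L
      using cmod_power2[of "exp (fst L)"] by (simp add: Q_def \<Phi>_def log_chart_def)
    show ?thesis
    proof (rule semialg_dim_hypersurface[of \<Phi> \<delta> q "(1, 1)" S E Q p])
      show "entire_on_lines (\<lambda>L. real_coords (\<Phi> L) $ i)" for i unfolding \<Phi>_def by (rule entire_log_chart)
      show "\<Phi> L \<in> S" if "L \<in> ball q \<delta>" "(1, 1) \<bullet> (L - q) = 0" for L
      proof -
        have "L \<in> strip2" "\<Phi> L \<in> M" using that(1) \<delta>(2) by auto
        moreover have "(1, 1) \<bullet> L = \<tau>" using that(2) q(2) by (simp only: inner_diff_right)
        ultimately show ?thesis using assms(4) V by blast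
      qed
      show "E i \<noteq> 0 \<and> (1, 1) \<bullet> E i = 0 \<and> (\<forall>j<i. E j \<bullet> E i = 0)" if "i < 3" for i
        using that by (elim less_3_cases) (auto simp: E_def inner_complex_def prod_eq_iff less_Suc_eq numeral_2_eq_2)
      show "real_polynomial_function (Q i)" if "i < 3" for i
        using that unfolding Q_def
        by (elim less_3_cases) (simp, intro real_polynomial_function_diff real_polynomial_function_power real_polynomial_function.intros(2-4) polynomial_coord)+
      show "Q i (real_coords (\<Phi> L)) = 0" if i: "i < 3" "(1, 1) \<bullet> (L - q) = 0" "\<forall>j\<le>i. E j \<bullet> (L - q) = 0" for i L
        using i(1)
      proof (rule less_3_cases)
        assume i0: "i = 0"
        then have "E 0 \<bullet> (L - q) = 0" using i(3) by blast
        then have "Im (fst L) = Im (fst q)" by (simp add: E_def inner_prod_def inner_complex_def)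
        then show ?thesis using i0 Q01 by simp
      next
        assume i1: "i = 1"
        then have "E 1 \<bullet> (L - q) = 0" using i(3) by blast
        then have "Im (snd L) = Im (snd q)" by (simp add: E_def inner_prod_def inner_complex_def)
        then show ?thesis using i1 Q01(2) by simp
      next
        assume i2: "i = 2"
        then have "E 2 \<bullet> (L - q) = 0" using i(3) by blast
        then have "Re (fst L) = Re (fst q)" using i(2) by (simp add: E_def inner_prod_def inner_complex_def)
        then show ?thesis using i2 Q2 by simp
      qed
      show "Q i (real_coords (\<Phi> (q + s *\<^sub>R E i))) \<noteq> 0" if "i < 3" and s: "0 < s" "s < 1" for i s
        using \<open>i < 3\<close>
      proof (rule less_3_cases)
        have "sin s \<noteq> 0" using sin_gt_zero[of s] s pi_gt3 by linarith
        then show "Q i (real_coords (\<Phi> (q + s *\<^sub>R E i))) \<noteq> 0" if "i = 0"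
          unfolding that Q01 by (simp add: E_def)
        show "Q i (real_coords (\<Phi> (q + s *\<^sub>R E i))) \<noteq> 0" if "i = 1"
          unfolding that Q01 using \<open>sin s \<noteq> 0\<close> by (simp add: E_def)
        show "Q i (real_coords (\<Phi> (q + s *\<^sub>R E i))) \<noteq> 0" if "i = 2"
          unfolding that Q2 using s(1) by (simp add: E_def flip: exp_double)
      qed
      show "real_polynomial_function p" unfolding p_def
        by (intro real_polynomial_function_diff real_polynomial_function_power real_polynomial_function.intros(2-4) polynomial_coord)
      show "p (real_coords Z) = 0" if "Z \<in> S" for Z
      proof -
        have "cusp_norm k c d Z = 1" using that assms(5) cusp(1) by blast
        then show ?thesis by (simp add: p_def cusp_norm_eq nsq_def)
      qed
      \<comment> \<open>at \<open>z\<^sub>1 = - d / c\<close>, outside the half plane, the first factor of the norm vanishes\<close>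
      show "\<exists>x. p x \<noteq> 0"
        using c by (intro exI[of _ "real_coords (of_real (- d / c), 0)"]) (simp add: p_def)
    qed (rule \<delta>(1))
  qed
qed

end


section \<open>The pairing transformations generate\<close>

context real_quadratic
begin

abbreviation N where "N \<equiv> {mat 1, - mat 1 :: real^2^2}"
abbreviation proj where "proj A \<equiv> N #>\<^bsub>SL2 k\<^esub> A"

lemma SL2_simps [simp]: "x \<otimes>\<^bsub>SL2 k\<^esub> y = x ** y" "\<one>\<^bsub>SL2 k\<^esub> = mat 1"
  by (simp_all add: SL2_def)

lemma minus_one_mult: "(- mat 1) ** A = - A" "A ** (- mat 1) = - A" for A :: "real^2^2"
  by (rule matrix22_eqI; simp add: mult22_nth mat_def)+

lemma mult_minus22: "A ** (- B) = - (A ** B)" "(- A) ** B = - (A ** B)" for A B :: "real^2^2"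
  by (rule matrix22_eqI; simp add: mult22_nth)+

lemma group_SL2: "group (SL2 k)"
proof (rule groupI)
  show "\<exists>B\<in>SL. B \<otimes>\<^bsub>SL2 k\<^esub> A = \<one>\<^bsub>SL2 k\<^esub>" if "A \<in> SL" for A
    using adj_SL[OF that] adj22_mult(2)[OF SL_det[OF that]] by auto
qed (simp_all add: mult_SL one_SL matrix_mul_assoc)

lemma inv_SL2: "A \<in> SL \<Longrightarrow> inv\<^bsub>SL2 k\<^esub> A = adj22 A"
  using group.inv_equality[OF group_SL2, of "adj22 A" A] by (simp add: adj_SL adj22_mult SL_det)

lemma normal_N: "N \<lhd> SL2 k"
proof -
  have N_SL: "N \<subseteq> SL" using one_SL minus_SL by auto
  have "subgroup N (SL2 k)"
  proof (rule group.subgroupI[OF group_SL2 N_SL])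
    fix A assume A: "A \<in> N"
    have "adj22 (mat 1) = mat 1" "adj22 (- mat 1) = - mat 1"
      by (rule matrix22_eqI; simp add: adj22_def mat_def)+
    then show "inv\<^bsub>SL2 k\<^esub> A \<in> N" using A N_SL inv_SL2 by auto
    show "A \<otimes>\<^bsub>SL2 k\<^esub> B \<in> N" if "B \<in> N" for B using A that by (auto simp: minus_one_mult)
  qed simp
  moreover have "A ** B ** adj22 A \<in> N" if "A \<in> SL" "B \<in> N" for A B
    using that(2) adj22_mult(1)[OF SL_det[OF that(1)]] by (auto simp: minus_one_mult mult_minus22)
  ultimately show ?thesis
    unfolding group.normal_inv_iff[OF group_SL2] by (simp add: inv_SL2)
qed

lemma proj_eq: "proj A = {A, - A}"
  by (auto simp: r_coset_def minus_one_mult)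

lemma carrier_PSL2: "carrier (PSL2 k) = proj ` SL"
  by (auto simp: PSL2_def FactGroup_def RCOSETS_def)

lemma group_PSL2: "group (PSL2 k)"
  unfolding PSL2_def by (rule normal.factorgroup_is_group[OF normal_N])

lemma proj_mult: "A \<in> SL \<Longrightarrow> B \<in> SL \<Longrightarrow> proj A \<otimes>\<^bsub>PSL2 k\<^esub> proj B = proj (A ** B)"
  using normal.rcos_sum[OF normal_N, of A B] by (simp add: PSL2_def FactGroup_def)

lemma proj_one: "\<one>\<^bsub>PSL2 k\<^esub> = proj (mat 1)"
  by (simp add: PSL2_def FactGroup_def proj_eq)

lemma proj_inv: "A \<in> SL \<Longrightarrow> inv\<^bsub>PSL2 k\<^esub> (proj A) = proj (adj22 A)"
  using group.inv_equality[OF group_PSL2, of "proj (adj22 A)" "proj A"]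
  by (simp add: proj_mult adj_SL adj22_mult SL_det proj_one carrier_PSL2)

lemma PSL2_act_proj: "A \<in> SL \<Longrightarrow> PSL2_act k (proj A) Z = act A Z"
  by (simp add: PSL2_act_def proj_eq act_minus)

text \<open>This is the set whose dimension decides whether \<open>D\<close> is a pairing transformation, described by one
  representative matrix.\<close>

lemma overlap_eq:
  assumes D: "D \<in> SL"
  shows "F \<inter> PSL2_act k (inv\<^bsub>PSL2 k\<^esub> (proj D)) ` F = {Z \<in> F. act D Z \<in> F}"
proof -
  have "PSL2_act k (inv\<^bsub>PSL2 k\<^esub> (proj D)) ` F = act (adj22 D) ` F"
    by (simp add: proj_inv D PSL2_act_proj adj_SL)
  moreover have "Z \<in> act (adj22 D) ` F \<longleftrightarrow> act D Z \<in> F" if "Z \<in> F" for Z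
  proof
    assume "Z \<in> act (adj22 D) ` F"
    then obtain W where W: "W \<in> F" "Z = act (adj22 D) W" by (rule imageE)
    then have "act D Z = W" using act_adj(2)[OF D subsetD[OF F_sub_X W(1)]] by simp
    then show "act D Z \<in> F" using W(1) by simp
  next
    assume "act D Z \<in> F"
    then have "act (adj22 D) (act D Z) \<in> act (adj22 D) ` F" by (rule imageI)
    then show "Z \<in> act (adj22 D) ` F" using act_adj(1)[OF D subsetD[OF F_sub_X that]] by simp
  qed
  ultimately show ?thesis by blast
qed

lemma closedin_tile: "A \<in> SL \<Longrightarrow> closedin (top_of_set X) (act A ` F)"
  using homeomorphism_imp_closed_map[OF homeomorphism_act closedin_F] .

lemma interior_tile: assumes A: "A \<in> SL" shows "interior (act A ` F) \<noteq> {}"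
proof -
  have IX: "interior F \<subseteq> X" using interior_subset F_sub_X by blast
  have "openin (top_of_set X) (act A ` interior F)"
    using IX open_X by (intro homeomorphism_imp_open_map[OF homeomorphism_act[OF A]]) (simp add: openin_open_eq)
  then have "open (act A ` interior F)" using open_X by (simp add: openin_open_eq)
  then have "act A ` interior F \<subseteq> interior (act A ` F)"
    by (intro interior_maximal image_mono interior_subset)
  then show ?thesis using interior_F by blast
qed

lemma tiles_cover: "X \<subseteq> (\<Union>A\<in>SL. act A ` F)"
proof
  fix Z assume Z: "Z \<in> X"
  then obtain A where A: "A \<in> SL" "act A Z \<in> F" using cover by blast
  then have "Z = act (adj22 A) (act A Z)" using act_adj(1) Z by simp
  then show "Z \<in> (\<Union>A\<in>SL. act A ` F)" using A adj_SL by blast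
qed

text \<open>The matrices \<open>A\<close> in \<open>I\<close> and \<open>B\<close> in \<open>J\<close> are never equal up to sign, so \<open>B\<inverse> A\<close> moves \<open>F\<close> and the common points of
  \<open>A F\<close> and \<open>B F\<close> lie on the image under \<open>A\<close> of a wall.\<close>

theorem pairing_transformations_generate:
  "generate (PSL2 k) (pairing_transformations k) = carrier (PSL2 k)"
proof
  let ?P = "PSL2 k" and ?T = "pairing_transformations k"
  have T: "?T \<subseteq> carrier ?P" by (auto simp: pairing_transformations_def)
  have sub: "subgroup (generate ?P ?T) ?P" by (rule group.generate_is_subgroup[OF group_PSL2 T])
  then show "generate ?P ?T \<subseteq> carrier ?P" by (rule subgroup.subset)
  define I where "I = {A \<in> SL. proj A \<in> generate ?P ?T}"
  define J where "J = SL - I"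
  have IJ: "I \<union> J = SL" by (auto simp: I_def J_def)
  have "J = {}"
  proof (rule ccontr)
    assume "J \<noteq> {}"
    have "mat 1 \<in> I" using generate.one[of ?P ?T] by (simp add: I_def one_SL proj_one)
    have D: "adj22 B ** A \<in> SL" "adj22 B ** A \<noteq> mat 1" "adj22 B ** A \<noteq> - mat 1" if "A \<in> I" "B \<in> J" for A B
    proof -
      have AB: "A \<in> SL" "B \<in> SL" using that IJ by auto
      then show "adj22 B ** A \<in> SL" by (intro mult_SL adj_SL)
      have eq: "B ** (adj22 B ** A) = A" using adj22_mult(1)[OF SL_det[OF AB(2)]] by (simp add: matrix_mul_assoc)
      have "proj A \<noteq> proj B" using that by (auto simp: I_def J_def)
      then show "adj22 B ** A \<noteq> mat 1" "adj22 B ** A \<noteq> - mat 1"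
        using eq by (auto simp: proj_eq minus_one_mult)
    qed
    define V where "V D = (SOME V. wall V \<and> {Z \<in> F. act D Z \<in> F} \<subseteq> V)" for D
    have V: "wall (V D) \<and> {Z \<in> F. act D Z \<in> F} \<subseteq> V D" if "D \<in> SL" "D \<noteq> mat 1" "D \<noteq> - mat 1" for D
      unfolding V_def by (rule someI_ex[OF face_in_wall[OF that]])
    have overlap: "act A ` F \<inter> act B ` F = act A ` {Z \<in> F. act (adj22 B ** A) Z \<in> F}" if AB: "A \<in> SL" "B \<in> SL" for A B
    proof -
      have "act A Z \<in> act B ` F \<longleftrightarrow> act (adj22 B ** A) Z \<in> F" if Z: "Z \<in> F" for Z
      proof -
        have ZX: "Z \<in> X" using Z F_sub_X by (rule rev_subsetD)
        have eq: "act (adj22 B ** A) Z = act (adj22 B) (act A Z)" by (rule act_mult[OF adj_SL[OF AB(2)] AB(1) ZX])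
        show ?thesis unfolding eq
        proof
          assume "act A Z \<in> act B ` F"
          then obtain W where W: "W \<in> F" "act A Z = act B W" by (rule imageE)
          then have "act (adj22 B) (act A Z) = W" using act_adj(1)[OF AB(2) subsetD[OF F_sub_X W(1)]] by simp
          then show "act (adj22 B) (act A Z) \<in> F" using W(1) by simp
        next
          assume "act (adj22 B) (act A Z) \<in> F"
          then have "act B (act (adj22 B) (act A Z)) \<in> act B ` F" by (rule imageI)
          then show "act A Z \<in> act B ` F" using act_adj(2)[OF AB(2) act_X[OF AB(1) ZX]] by simp
        qed
      qed
      then show ?thesis by blast
    qed
    have "\<exists>A\<in>I. \<exists>B\<in>J. \<exists>M. open M \<and> M \<inter> act A ` V (adj22 B ** A) \<noteq> {} \<and>
        M \<inter> act A ` V (adj22 B ** A) \<subseteq> act A ` F \<inter> act B ` F"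
    proof (rule common_wall_piece[of X I J "\<lambda>A. act A ` F" "\<lambda>A B. act A ` V (adj22 B ** A)"])
      show "connected X" by (rule convex_connected[OF convex_X])
      show "X \<subseteq> (\<Union>A\<in>I \<union> J. act A ` F)" unfolding IJ by (rule tiles_cover)
      show "\<exists>N. open N \<and> p \<in> N \<and> N \<subseteq> X \<and> finite {A \<in> I \<union> J. act A ` F \<inter> N \<noteq> {}}" if "p \<in> X" for p
        unfolding IJ by (rule locally_finite_tiles[OF that])
      show "act A ` F \<inter> act B ` F \<subseteq> act A ` V (adj22 B ** A) \<and> two_sided X (act A ` V (adj22 B ** A))"
        if AB: "A \<in> I" "B \<in> J" for A B
      proof
        have SL: "A \<in> SL" "B \<in> SL" using AB IJ by auto
        note VAB = V[OF D[OF AB], THEN conjunct1] V[OF D[OF AB], THEN conjunct2]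
        show "act A ` F \<inter> act B ` F \<subseteq> act A ` V (adj22 B ** A)"
          unfolding overlap[OF SL] by (rule image_mono[OF VAB(2)])
        show "two_sided X (act A ` V (adj22 B ** A))"
          by (rule two_sided_image[OF wall_two_sided[OF VAB(1)] homeomorphism_act[OF SL(1)] open_X open_X wall_sub_X[OF VAB(1)]])
      qed
      show "closedin (top_of_set X) (act A ` F)" if "A \<in> I \<union> J" for A using that unfolding IJ by (rule closedin_tile)
      show "interior (act A ` F) \<noteq> {}" if "A \<in> I \<union> J" for A using that unfolding IJ by (rule interior_tile)
      show "I \<noteq> {}" using \<open>mat 1 \<in> I\<close> by blast
    qed (rule open_X, rule \<open>J \<noteq> {}\<close>)
    then obtain A B M where AB: "A \<in> I" "B \<in> J" and M: "open M" "M \<inter> act A ` V (adj22 B ** A) \<noteq> {}"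
      "M \<inter> act A ` V (adj22 B ** A) \<subseteq> act A ` F \<inter> act B ` F" by blast
    have SL: "A \<in> SL" "B \<in> SL" using AB IJ by auto
    define D where "D = adj22 B ** A"
    note DSL = D[OF AB, folded D_def]
    have VD: "wall (V D)" "{Z \<in> F. act D Z \<in> F} \<subseteq> V D" using V[OF DSL] by auto
    have VX: "V D \<subseteq> X" using VD(1) by (rule wall_sub_X)
    have "semialg_dim (real_coords ` {Z \<in> F. act D Z \<in> F}) = 3"
    proof (rule wall_piece_dim[OF VD(1) _ _ _ VD(2), of "X \<inter> act A -` M"])
      show "open (X \<inter> act A -` M)" by (rule continuous_open_preimage[OF continuous_on_act[OF SL(1)] open_X M(1)])
      obtain Z where "Z \<in> V D" "act A Z \<in> M" using M(2) unfolding D_def[symmetric] by blast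
      then have "Z \<in> X \<inter> act A -` M \<inter> V D" using subsetD[OF VX] by simp
      then show "X \<inter> act A -` M \<inter> V D \<noteq> {}" by blast
      show "X \<inter> act A -` M \<inter> V D \<subseteq> {Z \<in> F. act D Z \<in> F}"
      proof
        fix Z assume Z: "Z \<in> X \<inter> act A -` M \<inter> V D"
        then have "act A Z \<in> M \<inter> act A ` V D" by simp
        then have "act A Z \<in> act A ` {Z \<in> F. act D Z \<in> F}"
          using subsetD[OF M(3)] unfolding overlap[OF SL] D_def[symmetric] by simp
        then obtain W where W: "W \<in> {Z \<in> F. act D Z \<in> F}" "act A Z = act A W" by (rule imageE)
        have "W \<in> X" using W(1) F_sub_X by blast
        then have "Z = W" using W(2) act_adj(1)[OF SL(1), of Z] act_adj(1)[OF SL(1), of W] Z by simp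
        then show "Z \<in> {Z \<in> F. act D Z \<in> F}" using W(1) by simp
      qed
    qed
    then have "semialg_dim (real_coords ` (F \<inter> PSL2_act k (inv\<^bsub>?P\<^esub> (proj D)) ` F)) = 3"
      unfolding overlap_eq[OF DSL(1)] .
    moreover have "proj D \<noteq> \<one>\<^bsub>?P\<^esub>" using DSL(2,3) by (auto simp: proj_one proj_eq)
    ultimately have "proj D \<in> ?T" using DSL(1) by (simp add: pairing_transformations_def carrier_PSL2)
    then have "proj D \<in> generate ?P ?T" by (rule generate.incl)
    then have "inv\<^bsub>?P\<^esub> (proj D) \<in> generate ?P ?T" by (rule subgroup.m_inv_closed[OF sub])
    moreover have "proj A \<in> generate ?P ?T" using AB by (simp add: I_def)
    ultimately have "proj A \<otimes>\<^bsub>?P\<^esub> inv\<^bsub>?P\<^esub> (proj D) \<in> generate ?P ?T" by (intro subgroup.m_closed[OF sub])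
    moreover have "A ** adj22 D = B"
    proof -
      have "A = B ** D" using adj22_mult(1)[OF SL_det[OF SL(2)]] by (simp add: D_def matrix_mul_assoc)
      then have "A ** adj22 D = B ** (D ** adj22 D)" by (simp add: matrix_mul_assoc)
      then show ?thesis using adj22_mult(1)[OF SL_det[OF DSL(1)]] by simp
    qed
    ultimately have "proj B \<in> generate ?P ?T" using SL(1) DSL(1) by (simp add: proj_inv proj_mult adj_SL)
    then show False using AB SL by (simp add: I_def J_def)
  qed
  then have "I = SL" using IJ by auto
  then show "carrier ?P \<subseteq> generate ?P ?T" unfolding carrier_PSL2 I_def by blast
qed

end

theorem theorem5p3:
  fixes k :: int
  assumes "k > 1" and "squarefree k"
  shows "generate (PSL2 k) (pairing_transformations k) = carrier (PSL2 k)"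
proof -
  interpret real_quadratic k by unfold_locales (fact assms)+
  show ?thesis by (rule pairing_transformations_generate)
qed

end
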